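(* Let $a<b$ be real numbers, $L\in C([a,b]\times\mathbb{R}\times\mathbb{R})$, $K\subset[a,b]\times\mathbb{R}$ compact, and let $\omega:[0,\infty[\times[0,\infty[\to[0,\infty[$ be increasing in both arguments with $\omega(k,0)=0$ for all $k\ge 0$. Assume that: (i) for each compact $G\subset[a,b]\times\mathbb{R}\times\mathbb{R}$ there exist $C=C(G)>0$ and $\alpha=\alpha(G)>0$ such that $|L(x_1,u_1,v_1)-L(x_2,u_2,v_2)|\le C(|x_1-x_2|+|u_1-u_2|+|v_1-v_2|)^{\alpha}$ for all $(x_1,u_1,v_1),(x_2,u_2,v_2)\in G$; (ii) $L_{vv}\in C([a,b]\times\mathbb{R}\times\mathbb{R})$ and there exists $\mu>0$ such that $L_{vv}\ge\mu$ everywhere. Let $c>0$, let $N$ be the constant associated with $c$ described in the context, and let $\delta_0>0$ satisfy $\delta_0+N\sqrt{\delta_0}\le 1$. Assume moreover that (iii) $\displaystyle\lim_{\varepsilon\to0}\int_0^{e\varepsilon}\overline{\omega}(k,\xi)\frac{d\xi}{\xi}=0$ for all $k\in[0,\infty[$, where $\overline{\omega}$ is the function defined in the context. Then every $u\in\mathcal{L}_\omega(L,K,c,\delta_0)$ has Tonelli's partial regularity.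
   Context: Conventions. "Increasing" means non-decreasing (e.g. $\omega\equiv0$ is allowed). $e$ is Napier's number. Functions in $W^{1,1}([a,b])$ are identified with their absolutely continuous representatives. $L=L(x,u,v)$; $L_v,L_{vv}$ are partial derivatives in $v$. Notation. For $u\in W^{1,1}([a,b])$, $\mathcal{J}_L(u;[a,b]):=\int_a^bL(x,u(x),u'(x))\,dx$. For $s,t\in[a,b]$ with $s<t$, $k_u(s,t):=\frac{u(s)-u(t)}{s-t}$, and $u_{s,t}\in W^{1,1}([a,b])$ is defined by $u_{s,t}(x)=u(s)+k_u(s,t)(x-s)$ if $x\in]s,t[$ and $u_{s,t}(x)=u(x)$ if $x\in[a,b]\setminus]s,t[$. The class $\mathcal{L}_\omega(L,K,c,\delta_0)$ is the set of $u\in W^{1,1}([a,b])$ such that: (A1) $\{(x,u(x)):x\in[a,b]\}\subset K$; (A2) $\mathcal{J}_L(u;[a,b])\le c$; (A3) for every $s,t\in[a,b]$ with $s<t$ and $|s-t|\le\delta_0$, $\mathcal{J}_L(u;[a,b])\le\mathcal{J}_L(u_{s,t};[a,b])+\omega(|k_u(s,t)|,|s-t|)\,|s-t|$. The constant $N$. Under (ii) there is a constant $N>0$ such that $\|u'\|_{L^2([a,b])}\le N$ for every $u\in W^{1,1}([a,b])$ satisfying (A1) and (A2); $N$ denotes such a fixed constant (depending on $L,K,c$). The function $\overline{\omega}$. Put $K_0:=\{(t,w)\in[a,b]\times\mathbb{R}:\mathrm{dist}((t,w);K)\le\delta_0+N\sqrt{\delta_0}\}$, where $\mathrm{dist}((t,w);K):=\inf\{|x-t|+|u-w|:(x,u)\in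 K\}$. For $k\ge0$ let $c(k):=\max\{\sup_{K_0\times[-k,k]}|L|,\ \sup_{K_0\times[-k,k]}|L_v|\}$, let $M(k)>0$ be a constant such that $|\zeta|\ge M(k)$ implies $\frac{\mu}{4}\zeta^2-2c(k)(|\zeta|+1)\ge\omega(k,\delta_0+N\sqrt{\delta_0})$, and let $\alpha(k)>0$ be the Hölder exponent of $L$ given by (i) for the compact set $G=K_0\times[-(k+M(k)),k+M(k)]$. Then, with $\widehat{\omega}(k,\varepsilon):=\sqrt{\omega(k,\varepsilon+N\sqrt{\varepsilon})}$, $$\overline{\omega}(k,\varepsilon):=\Big[\sqrt{\widehat{\omega}(k,\varepsilon)}\Big]^{\alpha(k)}+\sqrt{\widehat{\omega}(k,\varepsilon)}+\widehat{\omega}(k,\varepsilon).$$ Tonelli's partial regularity. For $u\in W^{1,1}([a,b])$ let $\Omega_u:=\{x\in[a,b]:u\text{ is differentiable at }x\}$ (finite derivative, one-sided at $a$ and $b$). $u$ has Tonelli's partial regularity if: $\Omega_u$ is an open subset of $[a,b]$; $[a,b]\setminus\Omega_u=\{x\in[a,b]:u'(x)=-\infty\text{ or }u'(x)=\infty\}$; and $u'\in C([a,b];[-\infty,\infty])$. *)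

theory Defs
  imports "HOL-Analysis.Analysis"
begin

text \<open>
  Functions on \<open>[a,b]\<close> are total functions \<open>real \<Rightarrow> real\<close>; every notion below depends only on their
  values on \<open>{a..b}\<close>. The Lagrangian is curried, \<open>L x w v\<close>, and only matters for \<open>x \<in> {a..b}\<close>.
\<close>

section \<open>The Sobolev space \<open>W\<^sup>1\<^sup>,\<^sup>1([a,b])\<close>\<close>

definition test_fun :: "real \<Rightarrow> real \<Rightarrow> (real \<Rightarrow> real) \<Rightarrow> bool" where
  "test_fun a b \<phi> \<longleftrightarrow>
     (\<forall>n x. (deriv ^^ n) \<phi> differentiable (at x)) \<and> closure {x. \<phi> x \<noteq> 0} \<subseteq> {a<..<b}"

definition has_weak_deriv :: "real \<Rightarrow> real \<Rightarrow> (real \<Rightarrow> real) \<Rightarrow> (real \<Rightarrow> real) \<Rightarrow> bool" where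
  "has_weak_deriv a b u g \<longleftrightarrow>
     set_integrable lebesgue {a..b} g \<and>
     (\<forall>\<phi>. test_fun a b \<phi> \<longrightarrow>
        (LINT x:{a..b}|lebesgue. u x * deriv \<phi> x) = - (LINT x:{a..b}|lebesgue. g x * \<phi> x))"

definition abs_cont_on :: "real \<Rightarrow> real \<Rightarrow> (real \<Rightarrow> real) \<Rightarrow> bool" where
  "abs_cont_on a b u \<longleftrightarrow>
     (\<forall>\<epsilon>>0. \<exists>\<delta>>0. \<forall>(n::nat) p q.
        (\<forall>i<n. a \<le> p i \<and> p i \<le> q i \<and> q i \<le> b) \<and>
        disjoint_family_on (\<lambda>i. {p i<..<q i}) {..<n} \<and>
        (\<Sum>i<n. q i - p i) < \<delta> \<longrightarrow>
        (\<Sum>i<n. \<bar>u (q i) - u (p i)\<bar>) < \<epsilon>)"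

text \<open>Sobolev functions are identified with their absolutely continuous representatives.\<close>

definition W11 :: "real \<Rightarrow> real \<Rightarrow> (real \<Rightarrow> real) set" where
  "W11 a b = {u. abs_cont_on a b u \<and> (\<exists>g. has_weak_deriv a b u g)}"

text \<open>The weak derivative is determined up to null sets; every use below is insensitive to the choice.\<close>

definition weak_deriv :: "real \<Rightarrow> real \<Rightarrow> (real \<Rightarrow> real) \<Rightarrow> real \<Rightarrow> real" where
  "weak_deriv a b u = (SOME g. has_weak_deriv a b u g)"

definition L2_bounded :: "real \<Rightarrow> real \<Rightarrow> (real \<Rightarrow> real) \<Rightarrow> real \<Rightarrow> bool" where
  "L2_bounded a b g N \<longleftrightarrow>
     set_integrable lebesgue {a..b} (\<lambda>x. (g x)\<^sup>2) \<and>
     sqrt (LINT x:{a..b}|lebesgue. (g x)\<^sup>2) \<le> N"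

section \<open>The functional and the class of almost-minimizers\<close>

text \<open>
  The functional takes values in \<open>ereal\<close>: a Bochner integral would be \<open>0\<close> for a non-integrable
  integrand, and \<open>J \<le> c\<close> would then hold spuriously. \<^term>\<open>ennreal\<close> truncates negative arguments
  to \<open>0\<close>, so the two terms are the integrals of the positive and the negative part. For the
  Lagrangians considered here, uniformly convex in \<open>v\<close>, the negative part has finite integral.
\<close>

definition J ::
  "(real \<Rightarrow> real \<Rightarrow> real \<Rightarrow> real) \<Rightarrow> real \<Rightarrow> real \<Rightarrow> (real \<Rightarrow> real) \<Rightarrow> ereal" where
  "J L a b u =
     enn2ereal (\<integral>\<^sup>+x\<in>{a..b}. ennreal (L x (u x) (weak_deriv a b u x)) \<partial>lebesgue) -
     enn2ereal (\<integral>\<^sup>+x\<in>{a..b}. ennreal (- L x (u x) (weak_deriv a b u x)) \<partial>lebesgue)"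

definition slope :: "(real \<Rightarrow> real) \<Rightarrow> real \<Rightarrow> real \<Rightarrow> real" where
  "slope u s t = (u s - u t) / (s - t)"

definition chord :: "(real \<Rightarrow> real) \<Rightarrow> real \<Rightarrow> real \<Rightarrow> real \<Rightarrow> real" where
  "chord u s t x = (if x \<in> {s<..<t} then u s + slope u s t * (x - s) else u x)"

definition graph_in :: "real \<Rightarrow> real \<Rightarrow> (real \<times> real) set \<Rightarrow> (real \<Rightarrow> real) \<Rightarrow> bool" where
  "graph_in a b K u \<longleftrightarrow> {(x, u x) |x. x \<in> {a..b}} \<subseteq> K"

definition almost_minimizers ::
  "(real \<Rightarrow> real \<Rightarrow> real) \<Rightarrow> real \<Rightarrow> real \<Rightarrow> (real \<Rightarrow> real \<Rightarrow> real \<Rightarrow> real) \<Rightarrow>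
     (real \<times> real) set \<Rightarrow> real \<Rightarrow> real \<Rightarrow> (real \<Rightarrow> real) set" where
  "almost_minimizers \<omega> a b L K c \<delta>\<^sub>0 =
     {u \<in> W11 a b.
        graph_in a b K u \<and>
        J L a b u \<le> ereal c \<and>
        (\<forall>s\<in>{a..b}. \<forall>t\<in>{a..b}. s < t \<and> \<bar>s - t\<bar> \<le> \<delta>\<^sub>0 \<longrightarrow>
           J L a b u \<le> J L a b (chord u s t) + ereal (\<omega> \<bar>slope u s t\<bar> \<bar>s - t\<bar> * \<bar>s - t\<bar>))}"

section \<open>The function \<open>\<omega>\<close>-bar\<close>

definition Dv :: "(real \<Rightarrow> real \<Rightarrow> real \<Rightarrow> real) \<Rightarrow> real \<Rightarrow> real \<Rightarrow> real \<Rightarrow> real" where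
  "Dv L x w v = deriv (\<lambda>y. L x w y) v"

definition dist1 :: "real \<times> real \<Rightarrow> (real \<times> real) set \<Rightarrow> real" where
  "dist1 p K = (INF q\<in>K. \<bar>fst q - fst p\<bar> + \<bar>snd q - snd p\<bar>)"

definition K0 :: "real \<Rightarrow> real \<Rightarrow> (real \<times> real) set \<Rightarrow> real \<Rightarrow> real \<Rightarrow> (real \<times> real) set" where
  "K0 a b K \<delta>\<^sub>0 N = {p \<in> {a..b} \<times> UNIV. dist1 p K \<le> \<delta>\<^sub>0 + N * sqrt \<delta>\<^sub>0}"

definition slab :: "(real \<times> real) set \<Rightarrow> real \<Rightarrow> (real \<times> real \<times> real) set" where
  "slab A r = {(x, w, v). (x, w) \<in> A \<and> v \<in> {- r..r}}"

text \<open>The constant \<open>c(k)\<close>, with \<open>A = K\<^sub>0\<close>.\<close>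

definition bound_const ::
  "(real \<Rightarrow> real \<Rightarrow> real \<Rightarrow> real) \<Rightarrow> (real \<times> real) set \<Rightarrow> real \<Rightarrow> real" where
  "bound_const L A k =
     max (SUP (x, w, v)\<in>slab A k. \<bar>L x w v\<bar>) (SUP (x, w, v)\<in>slab A k. \<bar>Dv L x w v\<bar>)"

definition omega_hat :: "(real \<Rightarrow> real \<Rightarrow> real) \<Rightarrow> real \<Rightarrow> real \<Rightarrow> real \<Rightarrow> real" where
  "omega_hat \<omega> N k \<epsilon> = sqrt (\<omega> k (\<epsilon> + N * sqrt \<epsilon>))"

text \<open>Here \<open>\<alpha>k\<close> is the exponent \<open>\<alpha>(k)\<close>; as it is positive, \<open>0 powr \<alpha>k = 0\<close> is the intended value.\<close>

definition omega_bar :: "(real \<Rightarrow> real \<Rightarrow> real) \<Rightarrow> real \<Rightarrow> real \<Rightarrow> real \<Rightarrow> real \<Rightarrow> real" where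
  "omega_bar \<omega> N \<alpha>k k \<epsilon> =
     sqrt (omega_hat \<omega> N k \<epsilon>) powr \<alpha>k + sqrt (omega_hat \<omega> N k \<epsilon>) + omega_hat \<omega> N k \<epsilon>"

section \<open>Tonelli's partial regularity\<close>

text \<open>The derivative relative to \<open>[a,b]\<close> as an extended real, one-sided at the end points.\<close>

definition has_ext_deriv :: "real \<Rightarrow> real \<Rightarrow> (real \<Rightarrow> real) \<Rightarrow> ereal \<Rightarrow> real \<Rightarrow> bool" where
  "has_ext_deriv a b u D x \<longleftrightarrow>
     ((\<lambda>y. ereal ((u y - u x) / (y - x))) \<longlongrightarrow> D) (at x within {a..b})"

definition Omega :: "real \<Rightarrow> real \<Rightarrow> (real \<Rightarrow> real) \<Rightarrow> real set" where
  "Omega a b u = {x \<in> {a..b}. u differentiable (at x within {a..b})}"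

definition tonelli_partial_regularity :: "real \<Rightarrow> real \<Rightarrow> (real \<Rightarrow> real) \<Rightarrow> bool" where
  "tonelli_partial_regularity a b u \<longleftrightarrow>
     openin (top_of_set {a..b}) (Omega a b u) \<and>
     {a..b} - Omega a b u =
       {x \<in> {a..b}. has_ext_deriv a b u (- \<infinity>) x \<or> has_ext_deriv a b u \<infinity> x} \<and>
     (\<exists>d :: real \<Rightarrow> ereal. (\<forall>x\<in>{a..b}. has_ext_deriv a b u (d x) x) \<and> continuous_on {a..b} d)"

end

theory Submission
  imports Defs "HOL-Computational_Algebra.Polynomial"
begin

text \<open>
  Replace \<open>u\<close> by its chord of slope \<open>k\<close> on an interval \<open>I\<close> of length \<open>h\<close>. Uniform convexity of \<open>L\<close> in \<open>v\<close>, the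
  Hoelder continuity of \<open>L\<close> and of \<open>L\<^sub>v\<close> (the latter with half the exponent), and
  \<open>\<bar>u(x) - u(y)\<bar> \<le> N \<surd>\<bar>x - y\<bar>\<close> turn almost-minimality into the Campanato-type estimate
  \<open>\<integral>\<^sub>I (u' - k)\<^sup>2 \<le> A h (\<omega>(R, h) + h\<^sup>\<beta>)\<close>, valid for \<open>\<bar>k\<bar> \<le> R\<close> and \<open>h\<close> small. Hence slopes on nested intervals of
  comparable length differ by at most a constant times \<open>\<surd>\<omega>(R, h) + h\<^sup>\<beta>\<^sup>/\<^sup>2\<close>, and the Dini condition makes these
  errors summable along dyadic lengths, because \<open>\<surd>\<omega>(R, h)\<close> is at most \<open>\<omega>\<close>-bar. So on a short interval whose
  slope is at most \<open>R\<close> in modulus, all subintervals have nearly the same slope, and \<open>u\<close> is \<open>C\<^sup>1\<close> there. Around a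
  point without such intervals all slopes tend to one and the same infinity.
\<close>

section \<open>Slopes\<close>

text \<open>What makes the integral estimate close is the place where coefficients are frozen.
  Convexity at \<open>(x, u x)\<close> produces a linear term with coefficient
  \<open>Dv L x (u x) k\<close>. Only after freezing it at \<open>(s, u s)\<close> does the term
  integrate to zero, because \<open>k\<close> is the mean of \<open>u'\<close>. Freezing costs a
  modulus of continuity of L_v in its first two arguments, which is not given directly and is
  extracted from the Hoelder bound on L and a local bound on L_vv. The error enters squared, so
  losing half the exponent is harmless; distances are of order \<open>sqrt h\<close>, so it
  contributes a power of \<open>h\<close>.

  The estimate holds only under a slope bound, which could be lost on shorter intervals. The
  iteration therefore works with \<open>R + 1\<close> and uses that the total drift, not only each
  step, is at most 1.

  \<open>J\<close> is evaluated at an arbitrarily chosen weak derivative. Comparing \<open>u\<close>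
  with a chord thus needs two facts: an integral has its integrand as weak derivative (Fubini), and
  a weak derivative integrates back to the function (explicit smooth bumps). The second also yields
  uniqueness almost everywhere.\<close>

lemma slope_commute: "slope u s t = slope u t s"
  unfolding slope_def by (metis minus_diff_eq minus_divide_divide)

lemma slope_mult:
  assumes "s \<noteq> t"
  shows "slope u s t * (t - s) = u t - u s"
  using assms by (subst slope_commute) (simp add: slope_def)

section \<open>From slope control to partial regularity\<close>

lemma has_real_derivative_iff_slope:
  "(u has_real_derivative D) (at x within S) \<longleftrightarrow> ((\<lambda>y. slope u y x) \<longlongrightarrow> D) (at x within S)"
  by (simp add: has_field_derivative_iff slope_def)

lemma has_ext_deriv_iff_slope:
  "has_ext_deriv a b u D x \<longleftrightarrow> ((\<lambda>y. ereal (slope u y x)) \<longlongrightarrow> D) (at x within {a..b})"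
  by (simp add: has_ext_deriv_def slope_def)

lemma has_ext_deriv_ereal_iff:
  "has_ext_deriv a b u (ereal D) x \<longleftrightarrow> (u has_real_derivative D) (at x within {a..b})"
  by (simp add: has_ext_deriv_iff_slope has_real_derivative_iff_slope)

text \<open>The control hypothesis compares an interval only with one containing it, so unrelated
  intervals are compared through a common hull, at the cost of a factor 2.\<close>

lemma slope_in_hull_control:
  fixes u :: "real \<Rightarrow> real"
  assumes "p1 < q1" "p2 < q2" "p \<le> p1" "p \<le> p2" "q1 \<le> q" "q2 \<le> q"
    and "\<And>s' t'. p \<le> s' \<Longrightarrow> s' < t' \<Longrightarrow> t' \<le> q \<Longrightarrow> \<bar>slope u s' t' - slope u p q\<bar> \<le> \<epsilon>"
  shows "\<bar>slope u p1 q1 - slope u p2 q2\<bar> \<le> 2 * \<epsilon>"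
  using assms(7)[of p1 q1] assms(7)[of p2 q2] assms(1-6) by linarith

text \<open>Interface between the variational and the pointwise half of the proof: no Lagrangian
  occurs inside this locale. In \<open>control\<close>, \<open>h\<close> depends only on
  \<open>R\<close> and \<epsilon>, and the inner interval may be arbitrarily short; this is what
  makes slopes converge.\<close>

locale slope_control =
  fixes a b :: real and u :: "real \<Rightarrow> real"
  assumes ab: "a < b"
    and cont: "continuous_on {a..b} u"
    and control: "\<And>R \<epsilon>. 0 \<le> R \<Longrightarrow> 0 < \<epsilon> \<Longrightarrow>
      \<exists>h>0. \<forall>s t s' t'. a \<le> s \<longrightarrow> s \<le> s' \<longrightarrow> s' < t' \<longrightarrow> t' \<le> t \<longrightarrow> t \<le> b \<longrightarrow> t - s \<le> h \<longrightarrow>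
         \<bar>slope u s t\<bar> \<le> R \<longrightarrow> \<bar>slope u s' t' - slope u s t\<bar> \<le> \<epsilon>"
begin

lemma controlE:
  assumes "0 \<le> R" "0 < \<epsilon>"
  obtains h where "0 < h" "\<And>s t s' t'. a \<le> s \<Longrightarrow> s \<le> s' \<Longrightarrow> s' < t' \<Longrightarrow> t' \<le> t \<Longrightarrow> t \<le> b \<Longrightarrow>
      t - s \<le> h \<Longrightarrow> \<bar>slope u s t\<bar> \<le> R \<Longrightarrow> \<bar>slope u s' t' - slope u s t\<bar> \<le> \<epsilon>"
  using control[OF assms] by metis

text \<open>Control at precision 1 bounds every slope inside \<open>{s..t}\<close> by
  \<open>R + 1\<close>. It can then be applied again, at level \<open>R + 1\<close> and any
  precision, to all short subintervals, so difference quotients are uniformly Cauchy.\<close>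

lemma C1_on_interval:
  assumes "0 \<le> R"
  obtains h where "0 < h"
    "\<And>s t. a \<le> s \<Longrightarrow> s < t \<Longrightarrow> t \<le> b \<Longrightarrow> t - s \<le> h \<Longrightarrow> \<bar>slope u s t\<bar> \<le> R \<Longrightarrow>
       \<exists>d. continuous_on {s..t} d \<and> (\<forall>x\<in>{s..t}. (u has_real_derivative d x) (at x within {s..t}))"
proof -
  obtain h where h: "0 < h" "\<And>s t s' t'. a \<le> s \<Longrightarrow> s \<le> s' \<Longrightarrow> s' < t' \<Longrightarrow> t' \<le> t \<Longrightarrow> t \<le> b \<Longrightarrow>
      t - s \<le> h \<Longrightarrow> \<bar>slope u s t\<bar> \<le> R \<Longrightarrow> \<bar>slope u s' t' - slope u s t\<bar> \<le> 1"
    using controlE[OF assms zero_less_one] by blast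
  show ?thesis
  proof (rule that[OF h(1)])
    fix s t assume st: "a \<le> s" "s < t" "t \<le> b" "t - s \<le> h" "\<bar>slope u s t\<bar> \<le> R"
    have bdd: "\<bar>slope u p q\<bar> \<le> R + 1" if "s \<le> p" "p < q" "q \<le> t" for p q
      using h(2)[of s p q t] that st by linarith
    \<comment> \<open>Uniform in \<open>x\<close>: the hull of \<open>x\<close>, \<open>y\<close>,
      \<open>z\<close> has slope at most \<open>R + 1\<close>, and both quotients are slopes of
      subintervals of it.\<close>
    have close: "\<exists>h'>0. \<forall>x\<in>{s..t}. \<forall>y\<in>{s..t}. \<forall>z\<in>{s..t}. x \<noteq> y \<longrightarrow> x \<noteq> z \<longrightarrow>
         \<bar>x - y\<bar> < h' \<longrightarrow> \<bar>x - z\<bar> < h' \<longrightarrow> \<bar>slope u y x - slope u z x\<bar> \<le> \<epsilon>" if "0 < \<epsilon>" for \<epsilon>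
    proof -
      obtain h' where h': "0 < h'" "\<And>s t s' t'. a \<le> s \<Longrightarrow> s \<le> s' \<Longrightarrow> s' < t' \<Longrightarrow> t' \<le> t \<Longrightarrow> t \<le> b \<Longrightarrow>
        t - s \<le> h' \<Longrightarrow> \<bar>slope u s t\<bar> \<le> R + 1 \<Longrightarrow> \<bar>slope u s' t' - slope u s t\<bar> \<le> \<epsilon> / 2"
        using controlE[of "R + 1" "\<epsilon> / 2"] assms \<open>0 < \<epsilon>\<close> by (metis add_increasing2 half_gt_zero zero_le_one)
      have "\<bar>slope u y x - slope u z x\<bar> \<le> \<epsilon>"
        if "x \<in> {s..t}" "y \<in> {s..t}" "z \<in> {s..t}" "x \<noteq> y" "x \<noteq> z" "\<bar>x - y\<bar> < h' / 2" "\<bar>x - z\<bar> < h' / 2"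
        for x y z
      proof -
        define p q where "p = min x (min y z)" and "q = max x (max y z)"
        have pq: "p < q" "s \<le> p" "q \<le> t" "q - p \<le> h'"
          using that unfolding p_def q_def by (auto simp: min_def max_def)
        have 1: "slope u y x = slope u (min x y) (max x y)" "slope u z x = slope u (min x z) (max x z)"
          by (auto simp: min_def max_def slope_commute)
        have "\<bar>slope u (min x y) (max x y) - slope u (min x z) (max x z)\<bar> \<le> 2 * (\<epsilon> / 2)"
        proof (rule slope_in_hull_control[where p = p and q = q])
          show "\<bar>slope u s' t' - slope u p q\<bar> \<le> \<epsilon> / 2" if "p \<le> s'" "s' < t'" "t' \<le> q" for s' t'
            using h'(2)[of p s' t' q] bdd[of p q] pq st that by linarith
        qed (use that in \<open>auto simp: p_def q_def\<close>)
        then show ?thesis unfolding 1 by simp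
      qed
      then show ?thesis using h'(1) by (intro exI[of _ "h' / 2"]) auto
    qed
    have "\<exists>D. ((\<lambda>y. slope u y x) \<longlongrightarrow> D) (at x within {s..t})" if x: "x \<in> {s..t}" for x
    proof -
      have "x islimpt {s..t}" using st(2) x by (simp add: islimpt_Icc)
      then obtain f where f: "\<And>n. f n \<in> {s..t} - {x}" "f \<longlonglongrightarrow> x"
        unfolding islimpt_sequential by blast
      have ev: "\<forall>\<^sub>F n in sequentially. \<bar>x - f n\<bar> < h'" if "0 < h'" for h'
        using tendstoD[OF f(2) that] by (simp add: dist_real_def abs_minus_commute)
      have "Cauchy (\<lambda>n. slope u (f n) x)"
      proof (rule metric_CauchyI)
        fix e :: real assume "0 < e"
        obtain h' where h': "0 < h'" "\<forall>x\<in>{s..t}. \<forall>y\<in>{s..t}. \<forall>z\<in>{s..t}. x \<noteq> y \<longrightarrow> x \<noteq> z \<longrightarrow>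
         \<bar>x - y\<bar> < h' \<longrightarrow> \<bar>x - z\<bar> < h' \<longrightarrow> \<bar>slope u y x - slope u z x\<bar> \<le> e / 2"
          using close[of "e / 2"] \<open>0 < e\<close> by auto
        obtain M where M: "\<And>n. n \<ge> M \<Longrightarrow> \<bar>x - f n\<bar> < h'" using ev[OF h'(1)] unfolding eventually_sequentially by auto
        have "dist (slope u (f m) x) (slope u (f n) x) < e" if "m \<ge> M" "n \<ge> M" for m n
        proof -
          have "\<bar>slope u (f m) x - slope u (f n) x\<bar> \<le> e / 2"
            using x f(1)[of m] f(1)[of n] M[OF that(1)] M[OF that(2)] by (intro h'(2)[rule_format]) auto
          then show ?thesis using \<open>0 < e\<close> by (simp add: dist_real_def)
        qed
        then show "\<exists>M. \<forall>m\<ge>M. \<forall>n\<ge>M. dist (slope u (f m) x) (slope u (f n) x) < e" by blast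
      qed
      then obtain D where D: "(\<lambda>n. slope u (f n) x) \<longlonglongrightarrow> D"
        using Cauchy_convergent convergentD by blast
      have "((\<lambda>y. slope u y x) \<longlongrightarrow> D) (at x within {s..t})"
      proof (rule tendstoI)
        fix e :: real assume "0 < e"
        obtain h' where h': "0 < h'" "\<forall>x\<in>{s..t}. \<forall>y\<in>{s..t}. \<forall>z\<in>{s..t}. x \<noteq> y \<longrightarrow> x \<noteq> z \<longrightarrow>
         \<bar>x - y\<bar> < h' \<longrightarrow> \<bar>x - z\<bar> < h' \<longrightarrow> \<bar>slope u y x - slope u z x\<bar> \<le> e / 2"
          using close[of "e / 2"] \<open>0 < e\<close> by auto
        have "dist (slope u y x) D < e" if y: "y \<in> {s..t}" "y \<noteq> x" "\<bar>x - y\<bar> < h'" for y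
        proof -
          have "(\<lambda>n. \<bar>slope u y x - slope u (f n) x\<bar>) \<longlonglongrightarrow> \<bar>slope u y x - D\<bar>"
            by (intro tendsto_intros D)
          moreover have "\<forall>\<^sub>F n in sequentially. \<bar>slope u y x - slope u (f n) x\<bar> \<le> e / 2"
            using ev[OF h'(1)]
          proof (rule eventually_mono)
            fix n assume "\<bar>x - f n\<bar> < h'"
            then show "\<bar>slope u y x - slope u (f n) x\<bar> \<le> e / 2"
              using x y f(1)[of n] by (intro h'(2)[rule_format]) auto
          qed
          ultimately have "\<bar>slope u y x - D\<bar> \<le> e / 2"
            by (rule tendsto_upperbound) simp
          then show ?thesis using \<open>0 < e\<close> by (simp add: dist_real_def)
        qed
        then show "\<forall>\<^sub>F y in at x within {s..t}. dist (slope u y x) D < e"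
          unfolding eventually_at using h'(1) by (auto simp: dist_real_def abs_minus_commute)
      qed
      then show ?thesis by blast
    qed
    then obtain d where d: "\<And>x. x \<in> {s..t} \<Longrightarrow> ((\<lambda>y. slope u y x) \<longlongrightarrow> d x) (at x within {s..t})"
      by metis
    \<comment> \<open>The limit of \<open>close\<close> as \<open>z\<close> tends to
      \<open>x\<close>. Continuity of \<open>d\<close> follows since the one number
      \<open>slope u y x\<close> is close to both \<open>d x\<close> and \<open>d y\<close>.\<close>
    have near: "\<exists>h'>0. \<forall>x\<in>{s..t}. \<forall>y\<in>{s..t}. x \<noteq> y \<longrightarrow> \<bar>x - y\<bar> < h' \<longrightarrow> \<bar>slope u y x - d x\<bar> \<le> \<epsilon>"
      if \<epsilon>: "0 < \<epsilon>" for \<epsilon>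
    proof -
      obtain h' where h': "0 < h'" "\<forall>x\<in>{s..t}. \<forall>y\<in>{s..t}. \<forall>z\<in>{s..t}. x \<noteq> y \<longrightarrow> x \<noteq> z \<longrightarrow>
         \<bar>x - y\<bar> < h' \<longrightarrow> \<bar>x - z\<bar> < h' \<longrightarrow> \<bar>slope u y x - slope u z x\<bar> \<le> \<epsilon>"
        using close[OF \<epsilon>] by auto
      have "\<bar>slope u y x - d x\<bar> \<le> \<epsilon>" if xy: "x \<in> {s..t}" "y \<in> {s..t}" "x \<noteq> y" "\<bar>x - y\<bar> < h'" for x y
      proof -
        have "((\<lambda>z. \<bar>slope u y x - slope u z x\<bar>) \<longlongrightarrow> \<bar>slope u y x - d x\<bar>) (at x within {s..t})"
          by (intro tendsto_intros d xy)
        moreover have "\<forall>\<^sub>F z in at x within {s..t}. \<bar>slope u y x - slope u z x\<bar> \<le> \<epsilon>"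
          unfolding eventually_at using h' xy
          by (intro exI[of _ h']) (auto simp: dist_real_def abs_minus_commute)
        moreover have "at x within {s..t} \<noteq> bot"
          using st(2) xy(1) by (simp add: trivial_limit_within islimpt_Icc)
        ultimately show ?thesis by (rule tendsto_upperbound)
      qed
      then show ?thesis using h'(1) by blast
    qed
    have "continuous_on {s..t} d"
    proof (unfold continuous_on_iff, intro ballI allI impI)
      fix x e :: real assume x: "x \<in> {s..t}" and "0 < e"
      obtain h' where h': "0 < h'" "\<forall>x\<in>{s..t}. \<forall>y\<in>{s..t}. x \<noteq> y \<longrightarrow> \<bar>x - y\<bar> < h' \<longrightarrow> \<bar>slope u y x - d x\<bar> \<le> e / 3"
        using near[of "e / 3"] \<open>0 < e\<close> by auto
      have "dist (d y) (d x) < e" if y: "y \<in> {s..t}" "dist y x < h'" for y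
      proof (cases "y = x")
        case False
        then have "\<bar>slope u y x - d x\<bar> \<le> e / 3" "\<bar>slope u x y - d y\<bar> \<le> e / 3"
          using h'(2) x y by (auto simp: dist_real_def abs_minus_commute)
        then show ?thesis using \<open>0 < e\<close> unfolding dist_real_def slope_commute[of u x y] by linarith
      qed (use \<open>0 < e\<close> in simp)
      then show "\<exists>h>0. \<forall>y\<in>{s..t}. dist y x < h \<longrightarrow> dist (d y) (d x) < e" using h'(1) by blast
    qed
    then show "\<exists>d. continuous_on {s..t} d \<and> (\<forall>x\<in>{s..t}. (u has_real_derivative d x) (at x within {s..t}))"
      using d has_real_derivative_iff_slope by blast
  qed
qed

text \<open>Enlarging an interval slightly changes its slope little, so one-sided information at \<open>x\<close>
  already gives a two-sided neighbourhood.\<close>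

lemma C1_near:
  assumes x: "x \<in> {a..b}" and "0 \<le> R"
    and small: "\<And>e. 0 < e \<Longrightarrow> \<exists>s t. a \<le> s \<and> s \<le> x \<and> x \<le> t \<and> t \<le> b \<and> s < t \<and> t - s < e \<and> \<bar>slope u s t\<bar> \<le> R"
  obtains \<delta> d where "0 < \<delta>" "continuous_on ({a..b} \<inter> ball x \<delta>) d"
    "\<And>y. y \<in> {a..b} \<inter> ball x \<delta> \<Longrightarrow> (u has_real_derivative d y) (at y within {a..b})"
proof -
  \<comment> \<open>The slack in \<open>R + 1\<close> absorbs the change of slope under enlargement.
    The length \<open>h\<close> is spent as \<open>h / 2\<close> on \<open>{s..t}\<close> and
    \<open>h / 4\<close> on either side.\<close>
  obtain h where h: "0 < h"
    "\<And>s t. a \<le> s \<Longrightarrow> s < t \<Longrightarrow> t \<le> b \<Longrightarrow> t - s \<le> h \<Longrightarrow> \<bar>slope u s t\<bar> \<le> R + 1 \<Longrightarrow>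
       \<exists>d. continuous_on {s..t} d \<and> (\<forall>x\<in>{s..t}. (u has_real_derivative d x) (at x within {s..t}))"
    using C1_on_interval[of "R + 1"] \<open>0 \<le> R\<close> by (metis add_increasing2 zero_le_one)
  obtain s t where st: "a \<le> s" "s \<le> x" "x \<le> t" "t \<le> b" "s < t" "t - s < h / 2" "\<bar>slope u s t\<bar> \<le> R"
    using small[of "h / 2"] h(1) by auto
  have "((\<lambda>\<tau>. slope u (max a (s - \<tau>)) (min b (t + \<tau>))) \<longlongrightarrow> slope u s t) (at_right 0)"
    (is "(?f \<longlongrightarrow> _) _")
  proof -
    have 1: "((\<lambda>\<tau>. max a (s - \<tau>)) \<longlongrightarrow> max a (s - 0)) (at_right 0)"
      "((\<lambda>\<tau>. min b (t + \<tau>)) \<longlongrightarrow> min b (t + 0)) (at_right 0)"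
      by (intro tendsto_intros)+
    then have 2: "((\<lambda>\<tau>. max a (s - \<tau>)) \<longlongrightarrow> s) (at_right 0)" "((\<lambda>\<tau>. min b (t + \<tau>)) \<longlongrightarrow> t) (at_right 0)"
      using 1 st by (simp_all add: max_absorb2 min_absorb2)
    have 3: "\<forall>\<^sub>F \<tau> in at_right 0. max a (s - \<tau>) \<in> {a..b}" "\<forall>\<^sub>F \<tau> in at_right 0. min b (t + \<tau>) \<in> {a..b}"
      unfolding eventually_at_right_field using st by (auto intro!: exI[of _ 1])
    have "((\<lambda>\<tau>. u (max a (s - \<tau>))) \<longlongrightarrow> u s) (at_right 0)" "((\<lambda>\<tau>. u (min b (t + \<tau>))) \<longlongrightarrow> u t) (at_right 0)"
      using continuous_on_tendsto_compose[OF cont 2(1) _ 3(1)] continuous_on_tendsto_compose[OF cont 2(2) _ 3(2)] st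
      by auto
    then show ?thesis unfolding slope_def using 2 st(5) by (intro tendsto_intros) auto
  qed
  then have "\<forall>\<^sub>F \<tau> in at_right 0. dist (?f \<tau>) (slope u s t) < 1" by (rule tendstoD) simp
  then obtain \<eta> where \<eta>: "0 < \<eta>" "\<And>\<tau>. 0 < \<tau> \<Longrightarrow> \<tau> < \<eta> \<Longrightarrow> dist (?f \<tau>) (slope u s t) < 1"
    unfolding eventually_at_right_field by auto
  define \<tau> where "\<tau> = min (\<eta> / 2) (h / 4)"
  have \<tau>: "0 < \<tau>" "\<tau> < \<eta>" "\<tau> \<le> h / 4" using \<eta>(1) h(1) by (auto simp: \<tau>_def)
  define p q where "p = max a (s - \<tau>)" and "q = min b (t + \<tau>)"
  have pq: "a \<le> p" "p < q" "q \<le> b" "q - p \<le> h" using st \<tau> ab by (auto simp: p_def q_def)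
  have "\<bar>slope u p q\<bar> \<le> R + 1"
    using \<eta>(2)[OF \<tau>(1,2)] st(7) unfolding p_def q_def dist_real_def by linarith
  with h(2)[OF pq] obtain d where d: "continuous_on {p..q} d"
    "\<And>x. x \<in> {p..q} \<Longrightarrow> (u has_real_derivative d x) (at x within {p..q})" by blast
  have sub: "{a..b} \<inter> ball x \<tau> \<subseteq> {p..q}" using st by (auto simp: p_def q_def dist_real_def)
  show ?thesis
  proof
    show "0 < \<tau>" by fact
    show "continuous_on ({a..b} \<inter> ball x \<tau>) d" using d(1) sub by (rule continuous_on_subset)
    fix y assume y: "y \<in> {a..b} \<inter> ball x \<tau>"
    have "at y within {p..q} = at y within {a..b}"
      using y sub pq by (intro at_within_nhd[where S = "ball x \<tau>"]) auto
    then show "(u has_real_derivative d y) (at y within {a..b})" using d(2)[of y] y sub by auto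
  qed
qed

lemma C1_near_Omega:
  assumes "x \<in> Omega a b u"
  obtains \<delta> d where "0 < \<delta>" "continuous_on ({a..b} \<inter> ball x \<delta>) d"
    "\<And>y. y \<in> {a..b} \<inter> ball x \<delta> \<Longrightarrow> (u has_real_derivative d y) (at y within {a..b})"
proof -
  have x: "x \<in> {a..b}" and "u differentiable (at x within {a..b})" using assms by (auto simp: Omega_def)
  then obtain D where D: "((\<lambda>y. slope u y x) \<longlongrightarrow> D) (at x within {a..b})"
    using real_differentiable_def has_real_derivative_iff_slope by metis
  have nb: "at x within {a..b} \<noteq> bot" using ab x by (simp add: trivial_limit_within islimpt_Icc)
  show ?thesis
  proof (rule C1_near[OF x, of "\<bar>D\<bar> + 1"])
    fix e :: real assume "0 < e"
    have "\<forall>\<^sub>F y in at x within {a..b}. dist (slope u y x) D < 1" using D by (rule tendstoD) simp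
    moreover have "\<forall>\<^sub>F y in at x within {a..b}. y \<in> {a..b} \<and> y \<noteq> x \<and> dist y x < e"
      unfolding eventually_at using \<open>0 < e\<close> by blast
    ultimately have "\<forall>\<^sub>F y in at x within {a..b}. dist (slope u y x) D < 1 \<and> y \<in> {a..b} \<and> y \<noteq> x \<and> dist y x < e"
      by (rule eventually_conj)
    then obtain y where y: "dist (slope u y x) D < 1" "y \<in> {a..b}" "y \<noteq> x" "dist y x < e"
      using eventually_happens[OF _] nb by blast
    have "\<bar>slope u y x\<bar> \<le> \<bar>D\<bar> + 1" using y(1) by (simp add: dist_real_def)
    then show "\<exists>s t. a \<le> s \<and> s \<le> x \<and> x \<le> t \<and> t \<le> b \<and> s < t \<and> t - s < e \<and> \<bar>slope u s t\<bar> \<le> \<bar>D\<bar> + 1"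
      using y x slope_commute[of u x y]
      by (intro exI[of _ "min x y"] exI[of _ "max x y"]) (auto simp: min_def max_def dist_real_def)
  qed (auto intro: that)
qed

text \<open>If arbitrarily short intervals around \<open>x\<close> had slopes below a fixed bound,
  \<open>C1_near\<close> would put \<open>x\<close> into \<open>Omega\<close>; so slopes blow up in
  modulus. Their sign is constant because the pairs of end points form a convex, hence connected,
  set on which the slope is continuous and nonzero.\<close>

lemma slope_uniform_infinite:
  assumes x: "x \<in> {a..b}" "x \<notin> Omega a b u"
  obtains \<sigma> where "\<sigma> = 1 \<or> \<sigma> = -1"
    "\<And>R. \<exists>e>0. \<forall>s t. a \<le> s \<longrightarrow> s \<le> x \<longrightarrow> x \<le> t \<longrightarrow> t \<le> b \<longrightarrow> s < t \<longrightarrow> t - s < e \<longrightarrow> R < \<sigma> * slope u s t"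
proof -
  have far: "\<exists>e>0. \<forall>s t. a \<le> s \<longrightarrow> s \<le> x \<longrightarrow> x \<le> t \<longrightarrow> t \<le> b \<longrightarrow> s < t \<longrightarrow> t - s < e \<longrightarrow> R < \<bar>slope u s t\<bar>"
    if R: "0 \<le> R" for R
  proof (rule ccontr)
    assume "\<not> ?thesis"
    then have *: "\<And>e. 0 < e \<Longrightarrow> \<exists>s t. a \<le> s \<and> s \<le> x \<and> x \<le> t \<and> t \<le> b \<and> s < t \<and> t - s < e \<and> \<bar>slope u s t\<bar> \<le> R"
      by (meson not_less)
    obtain \<delta> d where "0 < \<delta>" "continuous_on ({a..b} \<inter> ball x \<delta>) d"
      "\<And>y. y \<in> {a..b} \<inter> ball x \<delta> \<Longrightarrow> (u has_real_derivative d y) (at y within {a..b})"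
      using C1_near[OF x(1) R *] by blast
    then have "(u has_real_derivative d x) (at x within {a..b})" using x(1) by simp
    then have "x \<in> Omega a b u" using x(1) by (auto simp: Omega_def real_differentiable_def)
    with x(2) show False ..
  qed
  obtain e where e: "0 < e" "\<And>s t. a \<le> s \<Longrightarrow> s \<le> x \<Longrightarrow> x \<le> t \<Longrightarrow> t \<le> b \<Longrightarrow> s < t \<Longrightarrow> t - s < e \<Longrightarrow> 0 < \<bar>slope u s t\<bar>"
    using far[of 0] by auto
  \<comment> \<open>Since \<open>fst p = x\<close> and \<open>snd p = x\<close> are both allowed,
    one connected set covers left-sided, right-sided and two-sided intervals.\<close>
  define T where "T = {p :: real \<times> real. a \<le> fst p \<and> fst p \<le> x \<and> x \<le> snd p \<and> snd p \<le> b \<and> fst p < snd p \<and> snd p - fst p < e}"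
  have "convex T"
  proof (rule convexI)
    fix p q :: "real \<times> real" and l m :: real
    assume pq: "p \<in> T" "q \<in> T" and lm: "0 \<le> l" "0 \<le> m" "l + m = 1"
    have c: "l * y + m * z \<in> S" if "convex S" "y \<in> S" "z \<in> S" for S :: "real set" and y z
      using convexD[OF that lm] by simp
    have "l * fst p + m * fst q \<in> {a..x}" "l * snd p + m * snd q \<in> {x..b}"
      using pq by (intro c; auto simp: T_def)+
    moreover have "l * (snd p - fst p) + m * (snd q - fst q) \<in> {0<..<e}"
      using pq by (intro c) (auto simp: T_def)
    ultimately show "l *\<^sub>R p + m *\<^sub>R q \<in> T" by (auto simp: T_def algebra_simps)
  qed
  moreover have "continuous_on T (\<lambda>p. slope u (fst p) (snd p))"
    unfolding slope_def
    by (intro continuous_intros continuous_on_compose2[OF cont]) (auto simp: T_def)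
  ultimately have conn: "connected ((\<lambda>p. slope u (fst p) (snd p)) ` T)"
    by (intro connected_continuous_image convex_connected)
  have nz: "0 \<notin> (\<lambda>p. slope u (fst p) (snd p)) ` T" using e(2) by (force simp: T_def)
  have "(\<forall>p\<in>T. 0 < slope u (fst p) (snd p)) \<or> (\<forall>p\<in>T. slope u (fst p) (snd p) < 0)"
  proof (rule ccontr)
    assume "\<not> ?thesis"
    then obtain p q where "p \<in> T" "q \<in> T" "slope u (fst p) (snd p) \<le> 0" "0 \<le> slope u (fst q) (snd q)"
      by (meson not_less)
    then have "0 \<in> (\<lambda>p. slope u (fst p) (snd p)) ` T"
      using conn unfolding connected_iff_interval by blast
    with nz show False ..
  qed
  then obtain \<sigma> :: real where \<sigma>: "\<sigma> = 1 \<or> \<sigma> = -1" "\<And>p. p \<in> T \<Longrightarrow> 0 < \<sigma> * slope u (fst p) (snd p)"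
  proof (elim disjE)
    assume "\<forall>p\<in>T. 0 < slope u (fst p) (snd p)" then show ?thesis by (intro that[of 1]) auto
  next
    assume "\<forall>p\<in>T. slope u (fst p) (snd p) < 0" then show ?thesis by (intro that[of "-1"]) auto
  qed
  show ?thesis
  proof (rule that[OF \<sigma>(1)])
    fix R :: real
    obtain e' where e': "0 < e'" "\<And>s t. a \<le> s \<Longrightarrow> s \<le> x \<Longrightarrow> x \<le> t \<Longrightarrow> t \<le> b \<Longrightarrow> s < t \<Longrightarrow> t - s < e' \<Longrightarrow> \<bar>R\<bar> < \<bar>slope u s t\<bar>"
      using far[of "\<bar>R\<bar>"] by auto
    have "R < \<sigma> * slope u s t" if "a \<le> s" "s \<le> x" "x \<le> t" "t \<le> b" "s < t" "t - s < min e e'" for s t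
    proof -
      have "0 < \<sigma> * slope u s t" using \<sigma>(2)[of "(s, t)"] that by (simp add: T_def)
      moreover have "\<bar>R\<bar> < \<bar>slope u s t\<bar>" using e'(2) that by simp
      ultimately show ?thesis using \<sigma>(1) by auto
    qed
    then show "\<exists>e>0. \<forall>s t. a \<le> s \<longrightarrow> s \<le> x \<longrightarrow> x \<le> t \<longrightarrow> t \<le> b \<longrightarrow> s < t \<longrightarrow> t - s < e \<longrightarrow> R < \<sigma> * slope u s t"
      using e(1) e'(1) by (intro exI[of _ "min e e'"]) auto
  qed
qed

text \<open>If the slopes from \<open>y\<close> descended from above \<open>R + 2\<close> to below \<open>R + 1\<close>, an interval with end point
  \<open>y\<close> would have slope exactly \<open>R + 2\<close>, and the control would keep all shorter ones above \<open>R + 1\<close>.\<close>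

lemma no_descent:
  assumes "0 \<le> R" and \<sigma>: "\<sigma> = 1 \<or> \<sigma> = (-1::real)"
  obtains h where "0 < h"
    "\<And>x y. x \<in> {a..b} \<Longrightarrow> y \<in> {a..b} \<Longrightarrow> x \<noteq> y \<Longrightarrow> \<bar>x - y\<bar> \<le> h \<Longrightarrow> R + 2 < \<sigma> * slope u x y \<Longrightarrow>
       \<exists>r>0. \<forall>z. z \<in> closed_segment x y \<longrightarrow> z \<noteq> y \<longrightarrow> \<bar>z - y\<bar> < r \<longrightarrow> R + 1 \<le> \<sigma> * slope u z y"
proof -
  obtain h where h: "0 < h" "\<And>s t s' t'. a \<le> s \<Longrightarrow> s \<le> s' \<Longrightarrow> s' < t' \<Longrightarrow> t' \<le> t \<Longrightarrow> t \<le> b \<Longrightarrow>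
      t - s \<le> h \<Longrightarrow> \<bar>slope u s t\<bar> \<le> R + 2 \<Longrightarrow> \<bar>slope u s' t' - slope u s t\<bar> \<le> 1"
    using controlE[of "R + 2" 1] assms(1) by (metis add_increasing2 zero_le_numeral zero_less_one)
  show ?thesis
  proof (rule that[OF h(1)])
    fix x y assume xy: "x \<in> {a..b}" "y \<in> {a..b}" "x \<noteq> y" "\<bar>x - y\<bar> \<le> h" "R + 2 < \<sigma> * slope u x y"
    show "\<exists>r>0. \<forall>z. z \<in> closed_segment x y \<longrightarrow> z \<noteq> y \<longrightarrow> \<bar>z - y\<bar> < r \<longrightarrow> R + 1 \<le> \<sigma> * slope u z y"
    proof (rule ccontr)
      assume neg: "\<not> ?thesis"
      then have "\<exists>z. z \<in> closed_segment x y \<and> z \<noteq> y \<and> \<bar>z - y\<bar> < \<bar>x - y\<bar> \<and> \<sigma> * slope u z y < R + 1"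
        using xy(3) by (meson abs_ge_zero not_less right_minus_eq zero_less_abs_iff)
      then obtain z where z: "z \<in> closed_segment x y" "z \<noteq> y" "\<sigma> * slope u z y < R + 1" by blast
      \<comment> \<open>Everything from \<open>x\<close> to \<open>z\<close> lies on one side of
        \<open>y\<close>, so the quotient at \<open>y\<close> is continuous there and takes all
        intermediate values.\<close>
      have seg: "closed_segment x z \<subseteq> {a..b} - {y}"
        using z(1,2) xy(1-3) by (auto simp: closed_segment_eq_real_ivl split: if_splits)
      have "continuous_on (closed_segment x z) (\<lambda>p. \<sigma> * slope u p y)"
        unfolding slope_def using seg
        by (intro continuous_intros continuous_on_compose2[OF cont]) auto
      then have conn: "connected ((\<lambda>p. \<sigma> * slope u p y) ` closed_segment x z)"
        by (intro connected_continuous_image) auto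
      have "R + 2 \<in> (\<lambda>p. \<sigma> * slope u p y) ` closed_segment x z"
        using conn xy(5) z(3) unfolding connected_iff_interval
        
        by (elim ballE[of _ _ "\<sigma> * slope u z y"] ballE[of _ _ "\<sigma> * slope u x y"] allE[of _ "R + 2"]) auto
      then obtain p where p: "p \<in> closed_segment x z" "\<sigma> * slope u p y = R + 2" by auto
      have p': "p \<in> {a..b}" "p \<noteq> y" using p(1) seg by auto
      have py: "\<bar>p - y\<bar> \<le> h"
        using p(1) z(1) xy(4) by (auto simp: closed_segment_eq_real_ivl split: if_splits)
      have sl: "\<bar>slope u p y\<bar> \<le> R + 2" using p(2) \<sigma> assms(1) by auto
      have "R + 1 \<le> \<sigma> * slope u w y" if w: "w \<in> closed_segment x y" "w \<noteq> y" "\<bar>w - y\<bar> < \<bar>p - y\<bar>" for w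
      proof -
        have "\<bar>slope u w y - slope u p y\<bar> \<le> 1"
        proof (cases "p < y")
          case True
          have "w < y" "p \<le> w" using True w p(1) z(1,2) xy(3)
            by (auto simp: closed_segment_eq_real_ivl split: if_splits)
          then show ?thesis using h(2)[of p w y y] p' xy(2) py sl by auto
        next
          case False
          have "y < w" "w \<le> p" using False p'(2) w p(1) z(1,2) xy(3)
            by (auto simp: closed_segment_eq_real_ivl split: if_splits)
          then show ?thesis using h(2)[of y y w p] p' xy(2) py sl slope_commute[of u] by auto
        qed
        then show ?thesis using p(2) \<sigma> by auto
      qed
      with neg p'(2) show False by (auto dest!: spec[of _ "\<bar>p - y\<bar>"])
    qed
  qed
qed

text \<open>The delicate point is continuity of the extended derivative where it is infinite. Near
  such an \<open>x\<close> the slopes between \<open>x\<close> and \<open>y\<close> are large, which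
  by itself says nothing about the derivative at \<open>y\<close>; \<open>no_descent\<close>
  prevents the quotients at \<open>y\<close> from falling as the second point moves from
  \<open>x\<close> towards \<open>y\<close>. The factor \<sigma> treats both signs at once.\<close>

lemma tonelli: "tonelli_partial_regularity a b u"
proof -
  have nb: "at x within {a..b} \<noteq> bot" if "x \<in> {a..b}" for x
    using ab that by (simp add: trivial_limit_within islimpt_Icc)
  have infinite: "\<exists>\<sigma>. (\<sigma> = 1 \<or> \<sigma> = -1) \<and> has_ext_deriv a b u (ereal \<sigma> * \<infinity>) x \<and>
      (\<forall>R. \<exists>e>0. \<forall>s t. a \<le> s \<longrightarrow> s \<le> x \<longrightarrow> x \<le> t \<longrightarrow> t \<le> b \<longrightarrow> s < t \<longrightarrow> t - s < e \<longrightarrow> R < \<sigma> * slope u s t)"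
    if x: "x \<in> {a..b}" "x \<notin> Omega a b u" for x
  proof -
    obtain \<sigma> where \<sigma>: "\<sigma> = 1 \<or> \<sigma> = -1"
      "\<And>R. \<exists>e>0. \<forall>s t. a \<le> s \<longrightarrow> s \<le> x \<longrightarrow> x \<le> t \<longrightarrow> t \<le> b \<longrightarrow> s < t \<longrightarrow> t - s < e \<longrightarrow> R < \<sigma> * slope u s t"
      using slope_uniform_infinite[OF x] by metis
    have ev: "\<forall>\<^sub>F y in at x within {a..b}. R < \<sigma> * slope u y x" for R
    proof -
      obtain e where e: "0 < e" "\<forall>s t. a \<le> s \<longrightarrow> s \<le> x \<longrightarrow> x \<le> t \<longrightarrow> t \<le> b \<longrightarrow> s < t \<longrightarrow> t - s < e \<longrightarrow> R < \<sigma> * slope u s t"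
        using \<sigma>(2) by blast
      have "R < \<sigma> * slope u y x" if "y \<in> {a..b}" "y \<noteq> x" "dist y x < e" for y
        using e(2)[rule_format, of "min x y" "max x y"] that x(1) slope_commute[of u x y]
        by (cases "x < y") (auto simp: min_def max_def dist_real_def)
      then show ?thesis unfolding eventually_at using e(1) by blast
    qed
    have "has_ext_deriv a b u (ereal \<sigma> * \<infinity>) x"
      using \<sigma>(1)
    proof
      assume "\<sigma> = 1"
      then show ?thesis using ev by (simp add: has_ext_deriv_iff_slope tendsto_PInfty)
    next
      assume s: "\<sigma> = -1"
      have "\<forall>\<^sub>F y in at x within {a..b}. slope u y x < R" for R
        using ev[of "- R"] by (rule eventually_mono) (use s in auto)
      then show ?thesis using s by (simp add: has_ext_deriv_iff_slope tendsto_MInfty)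
    qed
    then show ?thesis using \<sigma> by blast
  qed
  have "\<exists>D. has_ext_deriv a b u D x" if "x \<in> {a..b}" for x
  proof (cases "x \<in> Omega a b u")
    case True
    then obtain D where "has_ext_deriv a b u (ereal D) x"
      using has_ext_deriv_ereal_iff by (auto simp: Omega_def real_differentiable_def)
    then show ?thesis by blast
  qed (use infinite[OF that] in blast)
  then obtain d where d: "\<And>x. x \<in> {a..b} \<Longrightarrow> has_ext_deriv a b u (d x) x" by metis
  have d_eq: "d x = D" if "x \<in> {a..b}" "has_ext_deriv a b u D x" for x D
    using d[OF that(1)] that(2) nb[OF that(1)] unfolding has_ext_deriv_def by (rule tendsto_unique[rotated])
  have "openin (top_of_set {a..b}) (Omega a b u)"
    unfolding openin_contains_ball
  proof (intro conjI ballI)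
    show "Omega a b u \<subseteq> {a..b}" by (auto simp: Omega_def)
    fix x assume "x \<in> Omega a b u"
    then obtain \<delta> d where \<delta>: "0 < \<delta>" "\<And>y. y \<in> {a..b} \<inter> ball x \<delta> \<Longrightarrow> (u has_real_derivative d y) (at y within {a..b})"
      using C1_near_Omega by metis
    then show "\<exists>e>0. ball x e \<inter> {a..b} \<subseteq> Omega a b u"
      by (intro exI[of _ \<delta>]) (fastforce simp: Omega_def real_differentiable_def)
  qed
  moreover have "{a..b} - Omega a b u = {x \<in> {a..b}. has_ext_deriv a b u (- \<infinity>) x \<or> has_ext_deriv a b u \<infinity> x}"
  proof (intro set_eqI iffI)
    fix x assume "x \<in> {a..b} - Omega a b u"
    then show "x \<in> {x \<in> {a..b}. has_ext_deriv a b u (- \<infinity>) x \<or> has_ext_deriv a b u \<infinity> x}"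
      using infinite[of x] by auto
  next
    fix x assume x: "x \<in> {x \<in> {a..b}. has_ext_deriv a b u (- \<infinity>) x \<or> has_ext_deriv a b u \<infinity> x}"
    have "x \<notin> Omega a b u"
    proof
      assume "x \<in> Omega a b u"
      then obtain D where "has_ext_deriv a b u (ereal D) x"
        using has_ext_deriv_ereal_iff by (auto simp: Omega_def real_differentiable_def)
      then show False using x d_eq[of x] d_eq[of x "ereal D"] by (metis (no_types, lifting) MInfty_neq_ereal(1) PInfty_neq_ereal(1) mem_Collect_eq)
    qed
    with x show "x \<in> {a..b} - Omega a b u" by blast
  qed
  moreover have "continuous_on {a..b} d"
    unfolding continuous_on_def
  proof
    fix x assume x: "x \<in> {a..b}"
    show "(d \<longlongrightarrow> d x) (at x within {a..b})"
    proof (cases "x \<in> Omega a b u")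
      case True
      then obtain \<delta> d' where \<delta>: "0 < \<delta>" "continuous_on ({a..b} \<inter> ball x \<delta>) d'"
        "\<And>y. y \<in> {a..b} \<inter> ball x \<delta> \<Longrightarrow> (u has_real_derivative d' y) (at y within {a..b})"
        using C1_near_Omega by metis
      have eq: "d y = ereal (d' y)" if "y \<in> {a..b} \<inter> ball x \<delta>" for y
        using \<delta>(3)[OF that] that d_eq[of y] by (simp add: has_ext_deriv_ereal_iff)
      have "(d' \<longlongrightarrow> d' x) (at x within {a..b} \<inter> ball x \<delta>)"
        using \<delta>(1,2) x unfolding continuous_on_def by auto
      then have "((\<lambda>y. ereal (d' y)) \<longlongrightarrow> ereal (d' x)) (at x within {a..b})"
        using \<delta>(1) at_within_nhd[of x "ball x \<delta>" "{a..b} \<inter> ball x \<delta>" "{a..b}"] by auto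
      moreover have "\<forall>\<^sub>F y in at x within {a..b}. ereal (d' y) = d y"
        unfolding eventually_at using \<delta>(1) eq
        by (intro exI[of _ \<delta>]) (auto simp: dist_commute)
      ultimately show ?thesis using eq[of x] \<delta>(1) x by (auto intro: Lim_transform_eventually)
    next
      case False
      then obtain \<sigma> where \<sigma>: "\<sigma> = 1 \<or> \<sigma> = -1" "has_ext_deriv a b u (ereal \<sigma> * \<infinity>) x"
        "\<And>R. \<exists>e>0. \<forall>s t. a \<le> s \<longrightarrow> s \<le> x \<longrightarrow> x \<le> t \<longrightarrow> t \<le> b \<longrightarrow> s < t \<longrightarrow> t - s < e \<longrightarrow> R < \<sigma> * slope u s t"
        using infinite[OF x] by blast
      have ev: "\<forall>\<^sub>F y in at x within {a..b}. ereal R < ereal \<sigma> * d y" if R: "0 \<le> R" for R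
      proof -
        obtain h where h: "0 < h" "\<And>x y. x \<in> {a..b} \<Longrightarrow> y \<in> {a..b} \<Longrightarrow> x \<noteq> y \<Longrightarrow> \<bar>x - y\<bar> \<le> h \<Longrightarrow> R + 2 < \<sigma> * slope u x y \<Longrightarrow>
          \<exists>r>0. \<forall>z. z \<in> closed_segment x y \<longrightarrow> z \<noteq> y \<longrightarrow> \<bar>z - y\<bar> < r \<longrightarrow> R + 1 \<le> \<sigma> * slope u z y"
          using no_descent[OF R \<sigma>(1)] by metis
        obtain e where e: "0 < e" "\<forall>s t. a \<le> s \<longrightarrow> s \<le> x \<longrightarrow> x \<le> t \<longrightarrow> t \<le> b \<longrightarrow> s < t \<longrightarrow> t - s < e \<longrightarrow> R + 2 < \<sigma> * slope u s t"
          using \<sigma>(3) by blast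
        have "ereal R < ereal \<sigma> * d y" if y: "y \<in> {a..b}" "y \<noteq> x" "dist y x < min e h" for y
        proof -
          have "R + 2 < \<sigma> * slope u x y"
            using e(2)[rule_format, of "min x y" "max x y"] y x slope_commute[of u x y]
            by (cases "x < y") (auto simp: min_def max_def dist_real_def split: if_splits)
          then obtain r where r: "0 < r" "\<And>z. z \<in> closed_segment x y \<Longrightarrow> z \<noteq> y \<Longrightarrow> \<bar>z - y\<bar> < r \<Longrightarrow> R + 1 \<le> \<sigma> * slope u z y"
            using h(2)[of x y] y x by (force simp: dist_real_def)
          \<comment> \<open>The limit defining \<open>d y\<close> may be restricted to the segment
            towards \<open>x\<close>, so a lower bound on that side alone bounds \<open>d y\<close>,
            finite or not.\<close>
          have sub: "closed_segment x y \<subseteq> {a..b}" using x y by (auto simp: closed_segment_eq_real_ivl)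
          have "((\<lambda>z. ereal (slope u z y)) \<longlongrightarrow> d y) (at y within closed_segment x y)"
            using d[OF y(1)] sub unfolding has_ext_deriv_iff_slope by (rule tendsto_within_subset)
          then have "((\<lambda>z. ereal \<sigma> * ereal (slope u z y)) \<longlongrightarrow> ereal \<sigma> * d y) (at y within closed_segment x y)"
            using \<sigma>(1) by (intro tendsto_cmult_ereal) auto
          moreover have "\<forall>\<^sub>F z in at y within closed_segment x y. ereal (R + 1) \<le> ereal \<sigma> * ereal (slope u z y)"
            unfolding eventually_at using r by (intro exI[of _ r]) (auto simp: dist_real_def)
          moreover have "at y within closed_segment x y \<noteq> bot"
            using y(2) by (auto simp: trivial_limit_within closed_segment_eq_real_ivl islimpt_Icc)
          ultimately have "ereal (R + 1) \<le> ereal \<sigma> * d y" by (rule tendsto_lowerbound)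
          then show ?thesis by (rule less_le_trans[rotated]) simp
        qed
        then show ?thesis unfolding eventually_at using e(1) h(1) by (intro exI[of _ "min e h"]) auto
      qed
      have ev': "\<forall>\<^sub>F y in at x within {a..b}. ereal R < ereal \<sigma> * d y" for R
        using eventually_mono[OF ev[of "max 0 R"]] by (auto intro: le_less_trans[of "ereal R" "ereal (max 0 R)"])
      have "d x = ereal \<sigma> * \<infinity>" using d_eq[OF x \<sigma>(2)] .
      with \<sigma>(1) show ?thesis
      proof (elim disjE)
        assume s: "\<sigma> = 1" and dx: "d x = ereal \<sigma> * \<infinity>"
        then show ?thesis using ev' by (simp add: tendsto_PInfty one_ereal_def[symmetric])
      next
        assume s: "\<sigma> = -1" and dx: "d x = ereal \<sigma> * \<infinity>"
        have "\<forall>\<^sub>F y in at x within {a..b}. d y < ereal R" for R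
          using ev'[of "- R"] by (rule eventually_mono) (use s in \<open>auto simp: ereal_uminus_less_reorder ereal_minus_less_minus simp flip: uminus_ereal.simps(1) one_ereal_def\<close>)
        then show ?thesis using s dx by (simp add: tendsto_MInfty)
      qed
    qed
  qed
  ultimately show ?thesis unfolding tonelli_partial_regularity_def using d by blast
qed

end

section \<open>A family of test functions\<close>

text \<open>Serves at the two end points where a bump is glued to zero.\<close>

lemma has_real_derivative_zero_of_quadratic:
  fixes f :: "real \<Rightarrow> real"
  assumes bound: "\<And>y. \<bar>f y\<bar> \<le> C * (y - c)\<^sup>2"
  shows "(f has_real_derivative 0) (at c)"
proof -
  have fc: "f c = 0" using bound[of c] by simp
  have "((\<lambda>y. C * \<bar>y - c\<bar>) \<longlongrightarrow> C * \<bar>c - c\<bar>) (at c)" by (intro tendsto_intros)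
  then have lim: "((\<lambda>y. C * \<bar>y - c\<bar>) \<longlongrightarrow> 0) (at c)" by simp
  have "\<forall>\<^sub>F y in at c. norm ((f y - f c) / (y - c)) \<le> C * \<bar>y - c\<bar>"
  proof (rule eventually_mono[OF eventually_neq_at_within])
    fix y assume "y \<noteq> c"
    then show "norm ((f y - f c) / (y - c)) \<le> C * \<bar>y - c\<bar>"
      using bound[of y] by (simp add: fc abs_divide divide_le_eq power2_eq_square abs_mult_self_eq mult.assoc)
  qed
  then have "((\<lambda>y. (f y - f c) / (y - c)) \<longlongrightarrow> 0) (at c)"
    by (rule Lim_null_comparison[OF _ lim])
  then show ?thesis by (simp add: has_field_derivative_iff)
qed

definition bump_poly :: "real \<Rightarrow> real \<Rightarrow> real poly" where
  "bump_poly s t = [:- (s * t), s + t, -1:]"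

lemma poly_bump_poly: "poly (bump_poly s t) x = (x - s) * (t - x)"
  by (simp add: bump_poly_def algebra_simps)

text \<open>The functions \<open>p w\<^sup>-\<^sup>m e\<^sup>-\<^sup>\<epsilon>\<^sup>/\<^sup>w\<close> with \<open>w = (x - s) (t - x)\<close> form a family closed under differentiation.\<close>

definition bump :: "real \<Rightarrow> real \<Rightarrow> real \<Rightarrow> real poly \<Rightarrow> nat \<Rightarrow> real \<Rightarrow> real" where
  "bump s t \<epsilon> p m x = (if s < x \<and> x < t
     then poly p x / ((x - s) * (t - x)) ^ m * exp (- \<epsilon> / ((x - s) * (t - x))) else 0)"

text \<open>Numerator of the derivative over the common denominator \<open>w ^ (m + 2)\<close>; the
  three terms come from differentiating \<open>p\<close>, the power of \<open>w\<close>, and the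
  exponential.\<close>

definition bump_deriv :: "real \<Rightarrow> real \<Rightarrow> real \<Rightarrow> real poly \<Rightarrow> nat \<Rightarrow> real poly" where
  "bump_deriv s t \<epsilon> p m =
     pderiv p * (bump_poly s t)\<^sup>2 - smult (real m) (p * pderiv (bump_poly s t) * bump_poly s t)
     + smult \<epsilon> (p * pderiv (bump_poly s t))"

text \<open>The inequality \<open>z \<le> exp z\<close> at \<open>z = \<epsilon> / (w * n)\<close>,
  raised to the power \<open>n\<close>: the exponential beats every power of
  \<open>1 / w\<close>.\<close>

lemma exp_minus_le_power:
  assumes "0 < (\<epsilon>::real)" "0 < w" "0 < n"
  shows "exp (- \<epsilon> / w) \<le> (real n / \<epsilon>) ^ n * w ^ n"
proof -
  have "(\<epsilon> / w / real n) ^ n \<le> exp (\<epsilon> / w / real n) ^ n"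
    using assms exp_ge_add_one_self[of "\<epsilon> / w / real n"] by (intro power_mono order_trans[OF _ exp_ge_add_one_self]) auto
  also have "\<dots> = exp (\<epsilon> / w)"
    using assms(3) by (simp flip: exp_of_nat_mult)
  finally show ?thesis
    using assms by (simp add: exp_minus divide_simps power_divide power_mult_distrib mult_ac)
qed

lemma bump_le:
  assumes "s < t" "0 < \<epsilon>"
  obtains C where "\<And>y. \<bar>bump s t \<epsilon> p m y\<bar> \<le> C * (y - s)\<^sup>2" "\<And>y. \<bar>bump s t \<epsilon> p m y\<bar> \<le> C * (y - t)\<^sup>2"
proof -
  have "compact (poly p ` {s..t})"
    by (intro compact_continuous_image continuous_intros) auto
  then have "bounded (poly p ` {s..t})" by (rule compact_imp_bounded)
  then obtain B where B: "0 < B" "\<And>x. x \<in> {s..t} \<Longrightarrow> \<bar>poly p x\<bar> \<le> B"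
    unfolding bounded_pos by auto
  \<comment> \<open>Decay of order \<open>m + 2\<close> leaves \<open>w\<^sup>2\<close> after
    division by \<open>w ^ m\<close>, and \<open>w\<close> vanishes at both ends.\<close>
  define c where "c = (real (m + 2) / \<epsilon>) ^ (m + 2)"
  have c: "0 \<le> c" using assms by (simp add: c_def)
  have main: "\<bar>bump s t \<epsilon> p m y\<bar> \<le> B * c * ((y - s) * (t - y))\<^sup>2" if y: "s < y" "y < t" for y
  proof -
    define w where "w = (y - s) * (t - y)"
    have w: "0 < w" using y by (simp add: w_def)
    have "\<bar>bump s t \<epsilon> p m y\<bar> = \<bar>poly p y\<bar> * (exp (- \<epsilon> / w) / w ^ m)"
      using y w by (simp add: bump_def w_def[symmetric] abs_mult power_abs)
    also have "\<dots> \<le> B * (c * w ^ (m + 2) / w ^ m)"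
      using B y w c exp_minus_le_power[OF assms(2) w, of "m + 2"] unfolding c_def
      by (intro mult_mono divide_right_mono) auto
    also have "c * w ^ (m + 2) / w ^ m = c * w\<^sup>2"
      using w by (simp add: power_add power2_eq_square)
    finally show ?thesis by (simp add: w_def)
  qed
  define C where "C = B * c * (t - s)\<^sup>2"
  have C: "0 \<le> C" using B c by (simp add: C_def)
  have le: "((y - s) * (t - y))\<^sup>2 \<le> (t - s)\<^sup>2 * (y - s)\<^sup>2" "((y - s) * (t - y))\<^sup>2 \<le> (t - s)\<^sup>2 * (y - t)\<^sup>2"
    if y: "s < y" "y < t" for y
  proof -
    have 1: "(t - y)\<^sup>2 \<le> (t - s)\<^sup>2" "(y - s)\<^sup>2 \<le> (t - s)\<^sup>2" using y by (auto intro!: power_mono)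
    show "((y - s) * (t - y))\<^sup>2 \<le> (t - s)\<^sup>2 * (y - s)\<^sup>2"
      using mult_right_mono[OF 1(1), of "(y - s)\<^sup>2"] by (simp add: power_mult_distrib mult.commute)
    show "((y - s) * (t - y))\<^sup>2 \<le> (t - s)\<^sup>2 * (y - t)\<^sup>2"
      using mult_right_mono[OF 1(2), of "(y - t)\<^sup>2"] by (simp add: power_mult_distrib power2_commute)
  qed
  show ?thesis
  proof (rule that[of C])
    fix y
    show "\<bar>bump s t \<epsilon> p m y\<bar> \<le> C * (y - s)\<^sup>2"
    proof (cases "s < y \<and> y < t")
      case True
      then have "\<bar>bump s t \<epsilon> p m y\<bar> \<le> B * c * ((t - s)\<^sup>2 * (y - s)\<^sup>2)"
        using B c by (intro order_trans[OF main] mult_left_mono le) auto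
      then show ?thesis by (simp add: C_def mult.assoc)
    qed (use C in \<open>auto simp: bump_def\<close>)
    show "\<bar>bump s t \<epsilon> p m y\<bar> \<le> C * (y - t)\<^sup>2"
    proof (cases "s < y \<and> y < t")
      case True
      then have "\<bar>bump s t \<epsilon> p m y\<bar> \<le> B * c * ((t - s)\<^sup>2 * (y - t)\<^sup>2)"
        using B c by (intro order_trans[OF main] mult_left_mono le) auto
      then show ?thesis by (simp add: C_def mult.assoc)
    qed (use C in \<open>auto simp: bump_def\<close>)
  qed
qed

text \<open>Inside and outside the support this is calculus. At \<open>s\<close> and
  \<open>t\<close> the quadratic bound forces derivative 0, which is also the value there of the
  next member of the family.\<close>

lemma bump_has_real_derivative:
  assumes "s < t" "0 < \<epsilon>"
  shows "(bump s t \<epsilon> p m has_real_derivative bump s t \<epsilon> (bump_deriv s t \<epsilon> p m) (m + 2) x) (at x)"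
proof -
  obtain C where C: "\<And>y. \<bar>bump s t \<epsilon> p m y\<bar> \<le> C * (y - s)\<^sup>2" "\<And>y. \<bar>bump s t \<epsilon> p m y\<bar> \<le> C * (y - t)\<^sup>2"
    using bump_le[OF assms] by metis
  consider "x = s \<or> x = t" | "x < s \<or> t < x" | "s < x" "x < t" by linarith
  then show ?thesis
  proof cases
    case 1
    then show ?thesis
      using has_real_derivative_zero_of_quadratic[OF C(1)] has_real_derivative_zero_of_quadratic[OF C(2)]
      by (auto simp: bump_def[of _ _ _ "bump_deriv s t \<epsilon> p m"])
  next
    case 2
    have "((\<lambda>_. 0) has_real_derivative 0) (at x)" by simp
    then have "(bump s t \<epsilon> p m has_real_derivative 0) (at x)"
      by (rule has_field_derivative_transform_within_open[where S = "- {s..t}"])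
        (use 2 in \<open>auto simp: bump_def\<close>)
    then show ?thesis using 2 by (auto simp: bump_def[of _ _ _ "bump_deriv s t \<epsilon> p m"])
  next
    case 3
    define W where "W = bump_poly s t"
    define w where "w = poly W x"
    have w: "0 < w" using 3 by (simp add: w_def W_def poly_bump_poly)
    have "((\<lambda>y. poly p y / poly W y ^ m * exp (- \<epsilon> / poly W y)) has_real_derivative
        (poly (pderiv p) x * w ^ 2 - real m * poly p x * poly (pderiv W) x * w + \<epsilon> * (poly p x * poly (pderiv W) x))
          / w ^ (m + 2) * exp (- \<epsilon> / w)) (at x)"
    proof -
      have "((\<lambda>y. poly p y / poly W y ^ m * exp (- \<epsilon> / poly W y)) has_real_derivative
        (poly (pderiv p) x * w ^ m - poly p x * (real m * w ^ (m - Suc 0) * poly (pderiv W) x)) / (w ^ m * w ^ m) * exp (- \<epsilon> / w)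
         + poly p x / w ^ m * (exp (- \<epsilon> / w) * (\<epsilon> * poly (pderiv W) x / (w * w)))) (at x)"
        using w unfolding w_def by (auto intro!: derivative_eq_intros simp: field_simps)
      moreover have "(poly (pderiv p) x * w ^ m - poly p x * (real m * w ^ (m - Suc 0) * poly (pderiv W) x)) / (w ^ m * w ^ m) * exp (- \<epsilon> / w)
         + poly p x / w ^ m * (exp (- \<epsilon> / w) * (\<epsilon> * poly (pderiv W) x / (w * w)))
        = (poly (pderiv p) x * w ^ 2 - real m * poly p x * poly (pderiv W) x * w + \<epsilon> * (poly p x * poly (pderiv W) x))
          / w ^ (m + 2) * exp (- \<epsilon> / w)"
        using w by (cases m) (simp_all add: divide_simps power2_eq_square, simp_all add: algebra_simps)
      ultimately show ?thesis by simp
    qed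
    moreover have "(poly (pderiv p) x * w ^ 2 - real m * poly p x * poly (pderiv W) x * w + \<epsilon> * (poly p x * poly (pderiv W) x))
          / w ^ (m + 2) * exp (- \<epsilon> / w) = bump s t \<epsilon> (bump_deriv s t \<epsilon> p m) (m + 2) x"
      using 3 by (simp add: bump_def bump_deriv_def w_def W_def poly_bump_poly mult_ac)
    ultimately have "((\<lambda>y. poly p y / poly W y ^ m * exp (- \<epsilon> / poly W y)) has_real_derivative
       bump s t \<epsilon> (bump_deriv s t \<epsilon> p m) (m + 2) x) (at x)" by simp
    then show ?thesis
      by (rule has_field_derivative_transform_within_open[where S = "{s<..<t}"])
        (use 3 in \<open>auto simp: bump_def W_def poly_bump_poly\<close>)
  qed
qed

lemma test_fun_bump:
  assumes "a < s" "s < t" "t < b" "0 < \<epsilon>"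
  shows "test_fun a b (bump s t \<epsilon> p m)"
  unfolding test_fun_def
proof (intro conjI allI)
  fix n x
  have "\<exists>q k. (deriv ^^ n) (bump s t \<epsilon> p m) = bump s t \<epsilon> q k"
  proof (induction n)
    case (Suc n)
    then obtain q k where "(deriv ^^ n) (bump s t \<epsilon> p m) = bump s t \<epsilon> q k" by blast
    moreover have "deriv (bump s t \<epsilon> q k) = bump s t \<epsilon> (bump_deriv s t \<epsilon> q k) (k + 2)"
      using bump_has_real_derivative[OF assms(2,4)] by (intro ext DERIV_imp_deriv)
    ultimately show ?case by auto
  qed auto
  then obtain q k where "(deriv ^^ n) (bump s t \<epsilon> p m) = bump s t \<epsilon> q k" by blast
  then show "(deriv ^^ n) (bump s t \<epsilon> p m) differentiable (at x)"
    using bump_has_real_derivative[OF assms(2,4), of q k x] by (metis real_differentiable_def)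
next
  have "{x. bump s t \<epsilon> p m x \<noteq> 0} \<subseteq> {s..t}" by (auto simp: bump_def split: if_splits)
  then have "closure {x. bump s t \<epsilon> p m x \<noteq> 0} \<subseteq> {s..t}" by (simp add: closure_minimal)
  then show "closure {x. bump s t \<epsilon> p m x \<noteq> 0} \<subseteq> {a<..<b}" using assms by auto
qed

section \<open>Weak derivatives and the fundamental theorem\<close>

text \<open>Weak derivatives are only Lebesgue measurable, while Fubini and the density argument
  below run over \<open>lborel\<close>. A Borel version of \<open>g\<close>, extended by zero,
  carries the integrals across.\<close>

lemma borel_representative:
  fixes g :: "real \<Rightarrow> real"
  assumes g: "g absolutely_integrable_on {a..b}"
  obtains g0 where "g0 \<in> borel_measurable lborel" "integrable lborel g0"
    "\<And>S. S \<in> sets borel \<Longrightarrow> S \<subseteq> {a..b} \<Longrightarrow> (LINT x:S|lebesgue. g x) = (LINT x:S|lborel. g0 x)"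
    "\<And>\<phi>. \<phi> \<in> borel_measurable borel \<Longrightarrow> (LINT x:{a..b}|lebesgue. g x * \<phi> x) = (LINT x|lborel. g0 x * \<phi> x)"
    "AE x in lborel. g0 x = indicator {a..b} x * g x"
proof -
  let ?h = "\<lambda>x. indicator {a..b} x * g x"
  have h: "integrable lebesgue ?h" using g by (simp add: set_integrable_def)
  obtain g0 where g0: "g0 \<in> borel_measurable lborel" "AE x in lborel. ?h x = g0 x"
    using completion_ex_borel_measurable_real[OF borel_measurable_integrable[OF h]] by blast
  have ae: "AE x in lebesgue. ?h x = g0 x" using g0(2) by (rule AE_completion)
  have "integrable lebesgue g0"
    using integrable_cong_AE_imp[OF h _ ae] g0(1) by (simp add: measurable_completion eq_commute)
  then have int: "integrable lborel g0" using g0(1) by (simp add: integrable_completion)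
  show ?thesis
  proof
    show "g0 \<in> borel_measurable lborel" "integrable lborel g0" by fact+
    show "AE x in lborel. g0 x = ?h x" using g0(2) by (auto elim!: eventually_mono)
    fix S :: "real set" assume S: "S \<in> sets borel" "S \<subseteq> {a..b}"
    have S': "S \<in> sets lebesgue" using S(1) by (simp add: sets_completionI_sets)
    have g0': "g0 \<in> borel_measurable lebesgue" using g0(1) by (simp add: measurable_completion)
    have "(LINT x:S|lebesgue. g x) = (LINT x:S|lebesgue. g0 x)"
      unfolding set_lebesgue_integral_def
    proof (rule integral_cong_AE)
      have "(\<lambda>x. indicator S x *\<^sub>R g x) = (\<lambda>x. indicator S x *\<^sub>R ?h x)" using S(2) by (auto simp: indicator_def fun_eq_iff)
      then show "(\<lambda>x. indicator S x *\<^sub>R g x) \<in> borel_measurable lebesgue"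
        using borel_measurable_scaleR[OF borel_measurable_indicator[OF S'] borel_measurable_integrable[OF h]] by simp
      show "(\<lambda>x. indicator S x *\<^sub>R g0 x) \<in> borel_measurable lebesgue"
        by (rule borel_measurable_scaleR[OF borel_measurable_indicator[OF S'] g0'])
      show "AE x in lebesgue. indicator S x *\<^sub>R g x = indicator S x *\<^sub>R g0 x"
        using ae by (rule eventually_mono) (use S(2) in \<open>auto simp: indicator_def split: if_splits\<close>)
    qed
    also have "\<dots> = (LINT x:S|lborel. g0 x)"
      unfolding set_lebesgue_integral_def using g0(1) S(1) by (intro integral_completion) auto
    finally show "(LINT x:S|lebesgue. g x) = (LINT x:S|lborel. g0 x)" .
  next
    fix \<phi> :: "real \<Rightarrow> real" assume \<phi>: "\<phi> \<in> borel_measurable borel"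
    have \<phi>': "\<phi> \<in> borel_measurable lebesgue" using \<phi> by (simp add: measurable_completion)
    have "(LINT x:{a..b}|lebesgue. g x * \<phi> x) = (LINT x|lebesgue. ?h x * \<phi> x)"
      by (simp add: set_lebesgue_integral_def mult.assoc)
    also have "\<dots> = (LINT x|lebesgue. g0 x * \<phi> x)"
    proof (rule integral_cong_AE)
      show "(\<lambda>x. ?h x * \<phi> x) \<in> borel_measurable lebesgue"
        by (rule borel_measurable_times[OF borel_measurable_integrable[OF h] \<phi>'])
      show "(\<lambda>x. g0 x * \<phi> x) \<in> borel_measurable lebesgue"
        using g0(1) by (intro borel_measurable_times \<phi>') (simp add: measurable_completion)
      show "AE x in lebesgue. ?h x * \<phi> x = g0 x * \<phi> x" using ae by (rule eventually_mono) simp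
    qed
    also have "\<dots> = (LINT x|lborel. g0 x * \<phi> x)"
      using g0(1) \<phi> by (intro integral_completion) auto
    finally show "(LINT x:{a..b}|lebesgue. g x * \<phi> x) = (LINT x|lborel. g0 x * \<phi> x)" .
  qed
qed

lemma test_fun_C1:
  assumes "test_fun a b \<phi>"
  shows "(\<phi> has_real_derivative deriv \<phi> x) (at x)" "continuous_on S \<phi>" "continuous_on S (deriv \<phi>)"
    "x \<notin> {a<..<b} \<Longrightarrow> \<phi> x = 0" 
proof -
  have d: "(deriv ^^ n) \<phi> differentiable (at x)" for n x using assms by (auto simp: test_fun_def)
  have D0: "(\<phi> has_real_derivative deriv \<phi> x) (at x)" for x
    using d[of 0 x] by (auto simp: real_differentiable_def dest: DERIV_imp_deriv)
  then show "(\<phi> has_real_derivative deriv \<phi> x) (at x)" .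
  show "continuous_on S \<phi>" by (meson D0 DERIV_continuous_on has_field_derivative_at_within)
  have "continuous_on S (deriv \<phi>)"
    using d[of 1] by (intro differentiable_imp_continuous_on) (auto simp: differentiable_on_def intro: differentiable_at_withinI)
  then show "continuous_on S (deriv \<phi>)" .
  show "\<phi> x = 0" if "x \<notin> {a<..<b}"
    using assms that closure_subset[of "{x. \<phi> x \<noteq> 0}"] by (auto simp: test_fun_def)
qed

text \<open>Fubini on the triangle \<open>y \<le> x\<close>: integrating \<open>deriv \<phi>\<close>
  over \<open>{y..b}\<close> first gives \<open>- \<phi> y\<close>, which is then integrated against
  \<open>g\<close>. The constant \<open>v a\<close> drops out because \<phi> vanishes at both
  ends.\<close>

lemma has_weak_deriv_of_integral:
  assumes ab: "a < b" and g: "g absolutely_integrable_on {a..b}"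
    and v: "\<And>x. x \<in> {a..b} \<Longrightarrow> v x = v a + integral {a..x} g"
  shows "has_weak_deriv a b v g"
  unfolding has_weak_deriv_def
proof (intro conjI allI impI)
  show "g absolutely_integrable_on {a..b}" by fact
  fix \<phi> assume \<phi>: "test_fun a b \<phi>"
  obtain g0 where g0: "g0 \<in> borel_measurable lborel" "integrable lborel g0"
    "\<And>S. S \<in> sets borel \<Longrightarrow> S \<subseteq> {a..b} \<Longrightarrow> (LINT x:S|lebesgue. g x) = (LINT x:S|lborel. g0 x)"
    "\<And>\<phi>. \<phi> \<in> borel_measurable borel \<Longrightarrow> (LINT x:{a..b}|lebesgue. g x * \<phi> x) = (LINT x|lborel. g0 x * \<phi> x)"
    "AE x in lborel. g0 x = indicator {a..b} x * g x"
    by (rule borel_representative[OF g]) (rule that; assumption)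
  note [measurable] = g0(1)
  have cd: "continuous_on UNIV (deriv \<phi>)" "continuous_on UNIV \<phi>" using test_fun_C1[OF \<phi>] by auto
  have [measurable]: "deriv \<phi> \<in> borel_measurable borel" "\<phi> \<in> borel_measurable borel"
    using cd by (auto intro: borel_measurable_continuous_onI)
  define A where "A x = indicator {a..b} x * deriv \<phi> x" for x
  have A_meas [measurable]: "A \<in> borel_measurable borel" unfolding A_def by measurable
  have A_int: "integrable lborel A"
    using borel_integrable_atLeastAtMost'[OF continuous_on_subset[OF cd(1)], of a b]
    by (simp add: A_def[abs_def] set_integrable_def)
  have A_tail: "(LINT x|lborel. A x * indicator {y..} x) = - \<phi> y" if "y \<in> {a..b}" for y
  proof -
    have "(LINT x|lborel. A x * indicator {y..} x) = (LINT x|lborel. indicator {y..b} x * deriv \<phi> x)"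
      using that by (intro Bochner_Integration.integral_cong) (auto simp: A_def indicator_def)
    also have "\<dots> = \<phi> b - \<phi> y"
      using integral_FTC_atLeastAtMost[of y b \<phi> "deriv \<phi>"] that test_fun_C1[OF \<phi>]
      by (simp add: has_real_derivative_iff_has_vector_derivative[symmetric] has_field_derivative_at_within)
    finally show ?thesis using test_fun_C1(4)[OF \<phi>, of b] by simp
  qed
  define P where "P = (\<lambda>x y. A x * g0 y * indicator {y..} x)"
  have ind: "(\<lambda>(x :: real, y). indicator {y..} x :: real) = indicator {p. snd p \<le> fst p}"
    by (auto simp: indicator_def)
  have [measurable]: "(\<lambda>(x, y). P x y) \<in> borel_measurable (lborel \<Otimes>\<^sub>M lborel)"
  proof -
    have [measurable]: "(\<lambda>(x :: real, y). indicator {y..} x :: real) \<in> borel_measurable (lborel \<Otimes>\<^sub>M lborel)"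
    proof -
      have "closed {p :: real \<times> real. snd p \<le> fst p}" by (intro closed_Collect_le continuous_intros)
      then have "{p :: real \<times> real. snd p \<le> fst p} \<in> sets (lborel \<Otimes>\<^sub>M lborel)"
        unfolding lborel_prod sets_lborel by (rule borel_closed)
      then show ?thesis unfolding ind by (rule borel_measurable_indicator)
    qed
    have "(\<lambda>p. A (fst p) * g0 (snd p) * (\<lambda>(x, y). indicator {y..} x) p) \<in> borel_measurable (lborel \<Otimes>\<^sub>M lborel)"
      by measurable
    then show ?thesis by (simp add: P_def case_prod_beta')
  qed
  have "integrable (lborel \<Otimes>\<^sub>M lborel) (\<lambda>(x, y). A x * g0 y)"
  proof (rule lborel_pair.Fubini_integrable)
    have "(\<lambda>p. A (fst p) * g0 (snd p)) \<in> borel_measurable (lborel \<Otimes>\<^sub>M lborel)" by measurable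
    then show "(\<lambda>(x, y). A x * g0 y) \<in> borel_measurable (lborel \<Otimes>\<^sub>M lborel)" by (simp add: case_prod_beta')
    show "integrable lborel (\<lambda>x. LINT y|lborel. norm (case (x, y) of (x, y) \<Rightarrow> A x * g0 y))"
      using A_int by (simp add: abs_mult)
    show "AE x in lborel. integrable lborel (\<lambda>y. case (x, y) of (x, y) \<Rightarrow> A x * g0 y)"
      using g0(2) by simp
  qed
  then have P_int: "integrable (lborel \<Otimes>\<^sub>M lborel) (\<lambda>(x, y). P x y)"
    by (rule Bochner_Integration.integrable_bound) (auto simp: P_def indicator_def)
  have v_eq: "v x = v a + (LINT y|lborel. g0 y * indicator {y..} x)" if x: "x \<in> {a..b}" for x
  proof -
    have "integral {a..x} g = (LINT y:{a..x}|lebesgue. g y)"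
      using set_integrable_subset[OF g, of "{a..x}"] x by (intro set_lebesgue_integral_eq_integral(2)[symmetric]) auto
    also have "\<dots> = (LINT y:{a..x}|lborel. g0 y)" using x by (intro g0(3)) auto
    also have "\<dots> = (LINT y|lborel. g0 y * indicator {y..} x)"
      unfolding set_lebesgue_integral_def
    proof (rule integral_cong_AE)
      show "AE y in lborel. indicator {a..x} y *\<^sub>R g0 y = g0 y * indicator {y..} x"
        using g0(5) by (rule eventually_mono) (use x in \<open>auto simp: indicator_def split: if_splits\<close>)
      have "(\<lambda>y. g0 y * indicator {..x} y) \<in> borel_measurable lborel" by measurable
      then show "(\<lambda>y. g0 y * indicator {y..} x) \<in> borel_measurable lborel"
        by (simp add: indicator_def)
    qed measurable
    finally show ?thesis using v[OF x] by simp
  qed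
  have "(LINT x:{a..b}|lebesgue. v x * deriv \<phi> x) = (LINT x:{a..b}|lebesgue. (v a + (LINT y|lborel. g0 y * indicator {y..} x)) * deriv \<phi> x)"
  proof (rule set_lebesgue_integral_cong)
    show "\<forall>x. x \<in> {a..b} \<longrightarrow> v x * deriv \<phi> x = (v a + (LINT y|lborel. g0 y * indicator {y..} x)) * deriv \<phi> x"
      using v_eq by metis
  qed simp
  also have "\<dots> = (LINT x|lebesgue. v a * A x + (LINT y|lborel. P x y))"
  proof -
    have "(LINT y|lborel. P x y) = A x * (LINT y|lborel. g0 y * indicator {y..} x)" for x
      by (simp add: P_def mult.assoc)
    then show ?thesis
      unfolding set_lebesgue_integral_def
      by (intro Bochner_Integration.integral_cong) (auto simp: A_def algebra_simps)
  qed
  also have "\<dots> = (LINT x|lborel. v a * A x + (LINT y|lborel. P x y))"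
    by (intro integral_completion) measurable
  also have "\<dots> = v a * (LINT x|lborel. A x) + (LINT x|lborel. LINT y|lborel. P x y)"
    using A_int lborel_pair.integrable_fst[OF P_int] by (subst Bochner_Integration.integral_add) auto
  also have "(LINT x|lborel. A x) = 0"
  proof -
    have "(LINT x|lborel. A x) = (LINT x|lborel. A x * indicator {a..} x)"
      by (intro Bochner_Integration.integral_cong) (auto simp: A_def indicator_def)
    then show ?thesis using A_tail[of a] ab test_fun_C1(4)[OF \<phi>, of a] by simp
  qed
  also have "(LINT x|lborel. LINT y|lborel. P x y) = (LINT y|lborel. LINT x|lborel. P x y)"
    using lborel_pair.Fubini_integral[OF P_int] by simp
  also have "\<dots> = (LINT y|lborel. - (g0 y * \<phi> y))"
  proof (rule integral_cong_AE)
    show "AE y in lborel. (LINT x|lborel. P x y) = - (g0 y * \<phi> y)"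
      using g0(5)
    proof (rule eventually_mono)
      fix y assume y: "g0 y = indicator {a..b} y * g y"
      have "(\<lambda>x. P x y) = (\<lambda>x. g0 y * (A x * indicator {y..} x))" by (auto simp: P_def)
      then have "(LINT x|lborel. P x y) = g0 y * (LINT x|lborel. A x * indicator {y..} x)" by simp
      then show "(LINT x|lborel. P x y) = - (g0 y * \<phi> y)"
        using A_tail[of y] y by (cases "y \<in> {a..b}") auto
    qed
    show "(\<lambda>y. LINT x|lborel. P x y) \<in> borel_measurable lborel"
      by (rule borel_measurable_integrable[OF lborel_pair.integrable_snd[OF P_int]])
  qed measurable
  also have "\<dots> = - (LINT x:{a..b}|lebesgue. g x * \<phi> x)" using g0(4)[of \<phi>] by simp
  finally show "(LINT x:{a..b}|lebesgue. v x * deriv \<phi> x) = - (LINT x:{a..b}|lebesgue. g x * \<phi> x)" by simp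
qed

text \<open>Closed intervals generate the Borel sets and are stable under intersection, so the
  integral of the difference vanishes over every Borel set; an integrable function with this
  property is zero almost everywhere.\<close>

lemma AE_eq_of_integral_Icc_eq:
  fixes f g :: "real \<Rightarrow> real"
  assumes f: "f absolutely_integrable_on {a..b}" and g: "g absolutely_integrable_on {a..b}"
    and eq: "\<And>s t. a \<le> s \<Longrightarrow> s \<le> t \<Longrightarrow> t \<le> b \<Longrightarrow> integral {s..t} f = integral {s..t} g"
  shows "AE x in lebesgue. x \<in> {a..b} \<longrightarrow> f x = g x"
proof -
  define h where "h x = f x - g x" for x
  have h: "h absolutely_integrable_on {a..b}" unfolding h_def using f g by (rule set_integral_diff(1))
  obtain h0 where h0: "h0 \<in> borel_measurable lborel" "integrable lborel h0"
    "\<And>S. S \<in> sets borel \<Longrightarrow> S \<subseteq> {a..b} \<Longrightarrow> (LINT x:S|lebesgue. h x) = (LINT x:S|lborel. h0 x)"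
    "AE x in lborel. h0 x = indicator {a..b} x * h x"
    by (rule borel_representative[OF h]) (rule that; assumption)
  have Icc: "(LINT x:{s..t}|lborel. h0 x) = 0" if "a \<le> s" "s \<le> t" "t \<le> b" for s t
  proof -
    have sub: "{s..t} \<subseteq> {a..b}" using that by auto
    have i: "f absolutely_integrable_on {s..t}" "g absolutely_integrable_on {s..t}" "h absolutely_integrable_on {s..t}"
      using set_integrable_subset[OF f _ sub] set_integrable_subset[OF g _ sub] set_integrable_subset[OF h _ sub] by auto
    have "integral {s..t} h = integral {s..t} f - integral {s..t} g"
      unfolding h_def using i by (intro Henstock_Kurzweil_Integration.integral_diff set_lebesgue_integral_eq_integral(1))
    then show ?thesis
      using h0(3)[of "{s..t}"] sub set_lebesgue_integral_eq_integral(2)[OF i(3)] eq[OF that] by simp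
  qed
  \<comment> \<open>The generator consists of all intervals of the line; as \<open>h0\<close>
    vanishes almost everywhere off \<open>{a..b}\<close>, they may be clipped.\<close>
  have Icc': "(LINT x:{s..t}|lborel. h0 x) = 0" for s t
  proof (cases "max a s \<le> min b t")
    case True
    have "(LINT x:{s..t}|lborel. h0 x) = (LINT x:{max a s..min b t}|lborel. h0 x)"
      unfolding set_lebesgue_integral_def using h0(1)
      by (intro integral_cong_AE eventually_mono[OF h0(4)]) (auto simp: indicator_def split: if_splits)
    then show ?thesis using Icc[of "max a s" "min b t"] True by simp
  next
    case False
    have "(LINT x:{s..t}|lborel. h0 x) = (LINT x:{}|lborel. h0 x)"
      unfolding set_lebesgue_integral_def using h0(1)
      by (intro integral_cong_AE eventually_mono[OF h0(4)]) (use False in \<open>auto simp: indicator_def split: if_splits\<close>)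
    then show ?thesis by (simp add: set_lebesgue_integral_def)
  qed
  have hi: "set_integrable lborel S h0" if "S \<in> sets borel" for S
    unfolding set_integrable_def using h0(2) that by (intro integrable_mult_indicator) auto
  \<comment> \<open>Total mass zero is what the complement step of the induction needs.\<close>
  have all: "(LINT x:UNIV|lborel. h0 x) = 0"
  proof -
    have "(LINT x:UNIV|lborel. h0 x) = (LINT x:{a..b}|lborel. h0 x)"
      unfolding set_lebesgue_integral_def using h0(1)
      by (intro integral_cong_AE eventually_mono[OF h0(4)]) (auto simp: indicator_def split: if_splits)
    then show ?thesis using Icc' by simp
  qed
  have zero: "(LINT x:S|lborel. h0 x) = 0" if "S \<in> sets lborel" for S
  proof -
    have sets_eq: "sets borel = sigma_sets UNIV (range (\<lambda>(a, b). {a..b::real}))"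
      by (simp add: borel_eq_atLeastAtMost)
    have "Int_stable (range (\<lambda>(a, b). {a..b::real}))" by (auto simp: Int_stable_def)
    moreover have "range (\<lambda>(a, b). {a..b::real}) \<subseteq> Pow UNIV" by auto
    moreover have "S \<in> sigma_sets UNIV (range (\<lambda>(a, b). {a..b::real}))"
      using that sets_eq by simp
    ultimately show ?thesis
    proof (induction S rule: sigma_sets_induct_disjoint)
      fix A assume "A \<in> range (\<lambda>(a, b). {a..b::real})"
      then show "(LINT x:A|lborel. h0 x) = 0" using Icc' by auto
    next
      show "(LINT x:{}|lborel. h0 x) = 0" by (simp add: set_lebesgue_integral_def)
    next
      fix A assume A: "A \<in> sigma_sets UNIV (range (\<lambda>(a, b). {a..b::real}))" "(LINT x:A|lborel. h0 x) = 0"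
      then have A': "A \<in> sets borel" by (simp add: sets_eq)
      have "(LINT x:A \<union> (UNIV - A)|lborel. h0 x) = (LINT x:A|lborel. h0 x) + (LINT x:UNIV - A|lborel. h0 x)"
        using A' by (intro set_integral_Un hi) auto
      then show "(LINT x:UNIV - A|lborel. h0 x) = 0" using A(2) all by simp
    next
      fix A :: "nat \<Rightarrow> real set" assume A: "disjoint_family A" "range A \<subseteq> sigma_sets UNIV (range (\<lambda>(a, b). {a..b::real}))"
        "\<And>i. (LINT x:A i|lborel. h0 x) = 0"
      then have A': "A i \<in> sets borel" for i by (auto simp: sets_eq)
      have "(LINT x:(\<Union>i. A i)|lborel. h0 x) = (\<Sum>i. (LINT x:A i|lborel. h0 x))"
        using A' A(1) by (intro lebesgue_integral_countable_add hi) (auto simp: disjoint_family_on_def)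
      then show "(LINT x:(\<Union>i. A i)|lborel. h0 x) = 0" using A(3) by simp
    qed
  qed
  have "AE x in lborel. h0 x = 0"
    by (rule sigma_finite_measure.density_zero[OF sigma_finite_lborel h0(2) zero])
  with h0(4) have "AE x in lborel. x \<in> {a..b} \<longrightarrow> f x = g x"
    by eventually_elim (auto simp: h_def)
  then show ?thesis by (rule AE_completion)
qed

text \<open>An approximate identity: the nonnegative densities \<open>f n\<close>, with
  antiderivatives \<open>F n\<close>, have mass tending to \<open>m\<close> that accumulates at
  \<open>c\<close>. In \<open>conc\<close>, \<open>{p'..q'}\<close> is the part far from
  \<open>c\<close>, and its mass tends to zero.\<close>

lemma integral_concentrating_tendsto:
  fixes F f :: "nat \<Rightarrow> real \<Rightarrow> real"
  assumes pq: "p \<le> q" and c: "c \<in> {p..q}" and u: "continuous_on {p..q} u"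
    and der: "\<And>n x. x \<in> {p..q} \<Longrightarrow> (F n has_real_derivative f n x) (at x within {p..q})"
    and f_cont: "\<And>n. continuous_on {p..q} (f n)"
    and f_nonneg: "\<And>n x. x \<in> {p..q} \<Longrightarrow> 0 \<le> f n x"
    and mass: "(\<lambda>n. F n q - F n p) \<longlonglongrightarrow> m"
    and conc: "\<And>\<delta>. 0 < \<delta> \<Longrightarrow> \<exists>p' q'. p \<le> p' \<and> p' \<le> q' \<and> q' \<le> q \<and>
       (\<forall>x\<in>{p..q} - {p'..q'}. \<bar>x - c\<bar> < \<delta>) \<and> (\<lambda>n. F n q' - F n p') \<longlonglongrightarrow> 0"
  shows "(\<lambda>n. integral {p..q} (\<lambda>x. u x * f n x)) \<longlonglongrightarrow> u c * m"
proof -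
  have FTC: "(f n has_integral F n y - F n x) {x..y}" if "p \<le> x" "x \<le> y" "y \<le> q" for n x y
    using that by (intro fundamental_theorem_of_calculus)
      (auto simp flip: has_real_derivative_iff_has_vector_derivative intro!: DERIV_subset[OF der])
  have "bounded (u ` {p..q})"
    using u by (intro compact_imp_bounded compact_continuous_image) auto
  then obtain U where U: "0 < U" "\<And>x. x \<in> {p..q} \<Longrightarrow> \<bar>u x\<bar> \<le> U" unfolding bounded_pos by auto
  define E where "E n = integral {p..q} (\<lambda>x. (u x - u c) * f n x)" for n
  have E_eq: "integral {p..q} (\<lambda>x. u x * f n x) = u c * (F n q - F n p) + E n" for n
  proof -
    have "((\<lambda>x. (u x - u c) * f n x) has_integral E n) {p..q}"
      unfolding E_def using u f_cont by (intro integrable_integral integrable_continuous_real continuous_intros)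
    from has_integral_add[OF has_integral_mult_right[OF FTC[of p q n], of "u c"] this] pq
    have "((\<lambda>x. u x * f n x) has_integral u c * (F n q - F n p) + E n) {p..q}"
      by (simp add: algebra_simps)
    then show ?thesis by (rule integral_unique)
  qed
  have "E \<longlonglongrightarrow> 0"
  proof (rule LIMSEQ_I)
    fix e :: real assume e: "0 < e"
    \<comment> \<open>The total mass is eventually below \<open>\<bar>m\<bar> + 1\<close>, so
      oscillation \<rho> near \<open>c\<close> costs less than \<open>e / 2\<close>; the far part
      has oscillation at most \<open>2 * U\<close> and mass below
      \<open>e / (4 * U)\<close>.\<close>
    define \<rho> where "\<rho> = e / (2 * (\<bar>m\<bar> + 1))"
    have \<rho>: "0 < \<rho>" using e by (simp add: \<rho>_def)
    obtain \<delta> where \<delta>: "0 < \<delta>" "\<And>x. x \<in> {p..q} \<Longrightarrow> \<bar>x - c\<bar> < \<delta> \<Longrightarrow> \<bar>u x - u c\<bar> < \<rho>"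
      using u c \<rho> unfolding continuous_on_iff dist_real_def by metis
    obtain p' q' where pq': "p \<le> p'" "p' \<le> q'" "q' \<le> q" "\<And>x. x \<in> {p..q} - {p'..q'} \<Longrightarrow> \<bar>x - c\<bar> < \<delta>"
      "(\<lambda>n. F n q' - F n p') \<longlonglongrightarrow> 0" using conc[OF \<delta>(1)] by blast
    have "\<forall>\<^sub>F n in sequentially. dist (F n q - F n p) m < 1" using mass by (rule tendstoD) simp
    moreover have "\<forall>\<^sub>F n in sequentially. dist (F n q' - F n p') 0 < e / (4 * U)"
      using pq'(5) by (rule tendstoD) (use e U in auto)
    ultimately have "\<forall>\<^sub>F n in sequentially. norm (E n - 0) < e"
    proof eventually_elim
      fix n assume n: "dist (F n q - F n p) m < 1" "dist (F n q' - F n p') 0 < e / (4 * U)"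
      define B where "B x = \<rho> * f n x + (if x \<in> {p'..q'} then 2 * U * f n x else 0)" for x
      have "(B has_integral \<rho> * (F n q - F n p) + 2 * U * (F n q' - F n p')) {p..q}"
        unfolding B_def
      proof (intro has_integral_add has_integral_mult_right FTC)
        show "((\<lambda>x. if x \<in> {p'..q'} then 2 * U * f n x else 0) has_integral 2 * U * (F n q' - F n p')) {p..q}"
          using pq' by (subst has_integral_restrict) (auto intro!: has_integral_mult_right FTC)
      qed (use pq in auto)
      then have B: "B integrable_on {p..q}" "integral {p..q} B = \<rho> * (F n q - F n p) + 2 * U * (F n q' - F n p')"
        by (auto intro: integral_unique)
      have "norm (E n) \<le> integral {p..q} B"
        unfolding E_def
      proof (rule integral_norm_bound_integral[OF _ B(1)])
        show "(\<lambda>x. (u x - u c) * f n x) integrable_on {p..q}"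
          using u f_cont by (intro integrable_continuous_real continuous_intros)
        fix x assume x: "x \<in> {p..q}"
        show "norm ((u x - u c) * f n x) \<le> B x"
        proof (cases "x \<in> {p'..q'}")
          case True
          have "\<bar>u x - u c\<bar> \<le> \<rho> + 2 * U" using U(2)[OF x] U(2)[OF c] \<rho> by linarith
          then have "\<bar>u x - u c\<bar> * f n x \<le> (\<rho> + 2 * U) * f n x" using f_nonneg[OF x] by (rule mult_right_mono)
          moreover have "norm ((u x - u c) * f n x) = \<bar>u x - u c\<bar> * f n x" using f_nonneg[OF x, of n] by (simp add: abs_mult)
          moreover have "B x = (\<rho> + 2 * U) * f n x" using True by (simp add: B_def algebra_simps)
          ultimately show ?thesis by linarith
        next
          case False
          have "\<bar>u x - u c\<bar> \<le> \<rho>" using \<delta>(2)[OF x] pq'(4)[of x] x False by force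
          moreover have "B x = \<rho> * f n x" using False by (auto simp: B_def)
          ultimately show ?thesis using f_nonneg[OF x, of n] by (simp add: abs_mult mult_right_mono)
        qed
      qed
      moreover have "\<rho> * (F n q - F n p) \<le> \<rho> * (\<bar>m\<bar> + 1)"
        using n(1) \<rho> by (intro mult_left_mono) (auto simp: dist_real_def)
      moreover have "\<rho> * (\<bar>m\<bar> + 1) = e / 2" by (simp add: \<rho>_def divide_simps)
      moreover have "2 * U * (F n q' - F n p') < e / 2"
      proof -
        have "F n q' - F n p' < e / (4 * U)" using n(2) by (simp add: dist_real_def)
        then show ?thesis using U(1) by (simp add: field_simps)
      qed
      ultimately show "norm (E n - 0) < e" unfolding B(2) by simp
    qed
    then show "\<exists>no. \<forall>n\<ge>no. norm (E n - 0) < e" unfolding eventually_sequentially .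
  qed
  from tendsto_add[OF tendsto_mult_left[OF mass, of "u c"] this]
  show ?thesis unfolding E_eq by simp
qed

lemma bump_tendsto_1:
  assumes "s < x" "x < t"
  shows "(\<lambda>n. bump s t (1 / real (Suc n)) 1 0 x) \<longlonglongrightarrow> 1"
proof -
  have "(\<lambda>n. exp (- (1 / real (Suc n)) / ((x - s) * (t - x)))) \<longlonglongrightarrow> exp (- 0 / ((x - s) * (t - x)))"
    using assms by (intro tendsto_intros LIMSEQ_inverse_real_of_nat[unfolded inverse_eq_divide]) auto
  then show ?thesis using assms by (simp add: bump_def)
qed

lemma bump_le_1:
  assumes "0 < \<epsilon>"
  shows "\<bar>bump s t \<epsilon> 1 0 x\<bar> \<le> 1"
  using assms by (auto simp: bump_def divide_le_0_iff)

text \<open>The bumps converge to the indicator of \<open>{s<..<t}\<close>, so their derivatives act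
  in the limit like a point mass at \<open>s\<close> minus one at \<open>t\<close>. Cutting at the
  midpoint, where the derivative changes sign, makes each half an approximate identity.\<close>

lemma integral_bump_deriv_tendsto:
  assumes st: "s < t" and u: "continuous_on {s..t} u"
  defines "\<phi> \<equiv> \<lambda>n. bump s t (1 / real (Suc n)) 1 0"
  shows "(\<lambda>n. integral {s..t} (\<lambda>x. u x * deriv (\<phi> n) x)) \<longlonglongrightarrow> u s - u t"
proof -
  define m where "m = (s + t) / 2"
  have m: "s < m" "m < t" using st by (auto simp: m_def)
  define f where "f n = bump s t (1 / real (Suc n)) (bump_deriv s t (1 / real (Suc n)) 1 0) 2" for n
  have der: "(\<phi> n has_real_derivative f n x) (at x)" for n x
    using bump_has_real_derivative[OF st, of "1 / real (Suc n)" 1 0 x] unfolding \<phi>_def f_def by (simp add: numeral_2_eq_2)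
  have f_cont: "continuous_on S (f n)" for n S
    unfolding f_def
    by (rule DERIV_continuous_on, rule has_field_derivative_at_within, rule bump_has_real_derivative[OF st]) simp
  have pd: "poly (pderiv (bump_poly s t)) x = s + t - 2 * x" for x
    by (simp add: bump_poly_def pderiv_pCons)
  \<comment> \<open>For \<open>p = 1\<close> and \<open>m = 0\<close> only the term from the
    exponential survives in \<open>bump_deriv\<close>; its sign is that of
    \<open>s + t - 2 * x\<close>.\<close>
  have sign: "f n x = bump s t (1 / real (Suc n)) 1 2 x * ((s + t - 2 * x) / real (Suc n))" for n x
    by (simp add: f_def bump_def bump_deriv_def pd mult_ac)
  have pos: "0 \<le> bump s t (1 / real (Suc n)) 1 2 x" for n x by (simp add: bump_def)
  have lim: "(\<lambda>n. \<phi> n x) \<longlonglongrightarrow> 1" if "s < x" "x < t" for x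
    unfolding \<phi>_def using bump_tendsto_1[OF that] .
  have ends: "\<phi> n s = 0" "\<phi> n t = 0" for n by (auto simp: \<phi>_def bump_def)
  have deriv_eq: "deriv (\<phi> n) = f n" for n using der DERIV_imp_deriv by blast
  have left: "(\<lambda>n. integral {s..m} (\<lambda>x. u x * f n x)) \<longlonglongrightarrow> u s * 1"
  proof (rule integral_concentrating_tendsto[where F = \<phi>])
    show "continuous_on {s..m} u" using u m by (auto intro: continuous_on_subset)
    show "0 \<le> f n x" if "x \<in> {s..m}" for n x unfolding sign using that by (intro mult_nonneg_nonneg pos) (auto simp: m_def)
    show "(\<lambda>n. \<phi> n m - \<phi> n s) \<longlonglongrightarrow> 1" using lim[OF m] by (simp add: ends)
    fix \<delta> :: real assume "0 < \<delta>"
    \<comment> \<open>Away from \<open>s\<close> the bump tends to 1 at both \<open>p\<close> and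
      \<open>m\<close>, so the mass of its derivative in between disappears.\<close>
    define p where "p = min (s + \<delta> / 2) m"
    have p: "s < p" "p \<le> m" "p < t" using m \<open>0 < \<delta>\<close> by (auto simp: p_def)
    have "(\<lambda>n. \<phi> n m - \<phi> n p) \<longlonglongrightarrow> 1 - 1" by (intro tendsto_diff lim m p)
    then show "\<exists>p' q'. s \<le> p' \<and> p' \<le> q' \<and> q' \<le> m \<and> (\<forall>x\<in>{s..m} - {p'..q'}. \<bar>x - s\<bar> < \<delta>) \<and> (\<lambda>n. \<phi> n q' - \<phi> n p') \<longlonglongrightarrow> 0"
      using p \<open>0 < \<delta>\<close> by (intro exI[of _ p] exI[of _ m]) (auto simp: p_def)
  qed (use m der f_cont in \<open>auto intro: has_field_derivative_at_within\<close>)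
  have right: "(\<lambda>n. integral {m..t} (\<lambda>x. u x * - f n x)) \<longlonglongrightarrow> u t * 1"
  proof (rule integral_concentrating_tendsto[where F = "\<lambda>n x. - \<phi> n x"])
    show "continuous_on {m..t} u" using u m by (auto intro: continuous_on_subset)
    show "0 \<le> - f n x" if "x \<in> {m..t}" for n x
      unfolding sign mult_minus_right[symmetric] using that
      by (intro mult_nonneg_nonneg pos) (auto simp: m_def divide_le_0_iff)
    show "((\<lambda>x. - \<phi> n x) has_real_derivative - f n x) (at x within {m..t})" for n x
      by (rule DERIV_minus[OF has_field_derivative_at_within[OF der]])
    show "continuous_on {m..t} (\<lambda>x. - f n x)" for n using f_cont by (rule continuous_on_minus)
    show "(\<lambda>n. - \<phi> n t - - \<phi> n m) \<longlonglongrightarrow> 1" using lim[OF m] by (simp add: ends)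
    fix \<delta> :: real assume "0 < \<delta>"
    define q where "q = max (t - \<delta> / 2) m"
    have q: "s < q" "m \<le> q" "q < t" using m \<open>0 < \<delta>\<close> by (auto simp: q_def)
    have "(\<lambda>n. - \<phi> n q - - \<phi> n m) \<longlonglongrightarrow> - 1 - - 1" by (intro tendsto_diff tendsto_minus lim m q)
    then show "\<exists>p' q'. m \<le> p' \<and> p' \<le> q' \<and> q' \<le> t \<and> (\<forall>x\<in>{m..t} - {p'..q'}. \<bar>x - t\<bar> < \<delta>) \<and> (\<lambda>n. - \<phi> n q' - - \<phi> n p') \<longlonglongrightarrow> 0"
      using q \<open>0 < \<delta>\<close> by (intro exI[of _ m] exI[of _ q]) (auto simp: q_def)
  qed (use m in auto)
  have "integral {s..t} (\<lambda>x. u x * f n x) = integral {s..m} (\<lambda>x. u x * f n x) - integral {m..t} (\<lambda>x. u x * - f n x)" for n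
  proof -
    have "(\<lambda>x. u x * f n x) integrable_on {s..t}"
      by (intro integrable_continuous_real continuous_on_mult u f_cont)
    from Henstock_Kurzweil_Integration.integral_combine[OF _ _ this, of m] m show ?thesis by auto
  qed
  with tendsto_diff[OF left right] show ?thesis unfolding deriv_eq by simp
qed

text \<open>The weak derivative is tested with bumps on \<open>{s..t}\<close>: one side tends to
  \<open>u s - u t\<close> by the previous lemma, the other to minus the integral of
  \<open>g\<close> by dominated convergence. Bumps need support inside \<open>{a<..<b}\<close>, so
  the end points are reached by continuity.\<close>

lemma weak_deriv_FTC:
  assumes ab: "a < b" and u: "continuous_on {a..b} u" and g: "has_weak_deriv a b u g"
    and st: "a \<le> s" "s \<le> t" "t \<le> b"
  shows "integral {s..t} g = u t - u s"
proof -
  have gi: "g absolutely_integrable_on {a..b}" using g by (simp add: has_weak_deriv_def)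
  have gS: "g integrable_on {a..b}" using gi by (rule set_lebesgue_integral_eq_integral)
  have inner: "integral {s..t} g = u t - u s" if st: "a < s" "s < t" "t < b" for s t
  proof -
    define \<phi> where "\<phi> n = bump s t (1 / real (Suc n)) 1 0" for n
    have test: "test_fun a b (\<phi> n)" for n unfolding \<phi>_def by (intro test_fun_bump st) simp
    have zero: "deriv (\<phi> n) x = 0" if "x \<notin> {s..t}" for n x
    proof (rule DERIV_imp_deriv)
      show "(\<phi> n has_real_derivative 0) (at x)"
        by (rule has_field_derivative_transform_within_open[where S = "- {s..t}" and f = "\<lambda>_. 0"])
          (use that in \<open>auto simp: \<phi>_def bump_def\<close>)
    qed
    have lhs: "(LINT x:{a..b}|lebesgue. u x * deriv (\<phi> n) x) = integral {s..t} (\<lambda>x. u x * deriv (\<phi> n) x)" for n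
    proof -
      have "continuous_on {a..b} (\<lambda>x. u x * deriv (\<phi> n) x)"
        by (intro continuous_on_mult u test_fun_C1(3)[OF test])
      then have "(LINT x:{a..b}|lebesgue. u x * deriv (\<phi> n) x) = integral {a..b} (\<lambda>x. u x * deriv (\<phi> n) x)"
        by (intro set_lebesgue_integral_eq_integral absolutely_integrable_continuous_real)
      also have "\<dots> = integral {a..b} (\<lambda>x. if x \<in> {s..t} then u x * deriv (\<phi> n) x else 0)"
        using zero by (intro Henstock_Kurzweil_Integration.integral_cong) simp
      also have "\<dots> = integral {s..t} (\<lambda>x. u x * deriv (\<phi> n) x)"
        using st by (intro integral_restrict_Int[THEN trans]) (simp add: Int_absorb1)
      finally show ?thesis .
    qed
    have "(\<lambda>n. LINT x:{a..b}|lebesgue. u x * deriv (\<phi> n) x) \<longlonglongrightarrow> u s - u t"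
      unfolding lhs unfolding \<phi>_def using st by (intro integral_bump_deriv_tendsto continuous_on_subset[OF u]) auto
    then have l1: "(\<lambda>n. - (LINT x:{a..b}|lebesgue. g x * \<phi> n x)) \<longlonglongrightarrow> u s - u t"
      using g test unfolding has_weak_deriv_def by simp
    have h: "integrable lebesgue (\<lambda>x. indicator {a..b} x * g x)" using gi by (simp add: set_integrable_def)
    have "(\<lambda>n. LINT x|lebesgue. indicator {a..b} x * g x * \<phi> n x) \<longlonglongrightarrow> (LINT x|lebesgue. indicator {a..b} x * g x * indicator {s<..<t} x)"
    proof (rule integral_dominated_convergence[where w = "\<lambda>x. norm (indicator {a..b} x * g x)"])
      show "(\<lambda>x. indicator {a..b} x * g x * indicator {s<..<t} x) \<in> borel_measurable lebesgue"
        by (intro borel_measurable_times borel_measurable_integrable[OF h] borel_measurable_indicator) auto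
      have "\<phi> n \<in> borel_measurable lebesgue" for n
        using borel_measurable_continuous_onI[OF test_fun_C1(2)[OF test]] by (simp add: measurable_completion)
      then show "(\<lambda>x. indicator {a..b} x * g x * \<phi> n x) \<in> borel_measurable lebesgue" for n
        by (intro borel_measurable_times borel_measurable_integrable[OF h])
      show "integrable lebesgue (\<lambda>x. norm (indicator {a..b} x * g x))" using h by (rule integrable_norm)
      have "(\<lambda>n. \<phi> n x) \<longlonglongrightarrow> indicator {s<..<t} x" for x
        using bump_tendsto_1[of s x t] by (cases "s < x \<and> x < t") (auto simp: \<phi>_def bump_def)
      then show "AE x in lebesgue. (\<lambda>n. indicator {a..b} x * g x * \<phi> n x) \<longlonglongrightarrow> indicator {a..b} x * g x * indicator {s<..<t} x"
        by (intro AE_I2 tendsto_mult_left)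
      have "norm (indicator {a..b} x * g x * \<phi> n x) \<le> norm (indicator {a..b} x * g x)" for n x
        using mult_left_mono[OF bump_le_1[of "1 / real (Suc n)" s t x], of "norm (indicator {a..b} x * g x)"]
        by (simp add: \<phi>_def abs_mult)
      then show "AE x in lebesgue. norm (indicator {a..b} x * g x * \<phi> n x) \<le> norm (indicator {a..b} x * g x)" for n
        by simp
    qed
    moreover have "(LINT x|lebesgue. indicator {a..b} x * g x * indicator {s<..<t} x) = (LINT x:{s<..<t}|lebesgue. g x)"
      unfolding set_lebesgue_integral_def using st
      by (intro Bochner_Integration.integral_cong) (auto simp: indicator_def)
    moreover have "\<dots> = integral {s<..<t} g"
      using st by (intro set_lebesgue_integral_eq_integral set_integrable_subset[OF gi]) auto
    moreover have "\<dots> = integral {s..t} g" using integral_open_interval[of s t g] by simp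
    ultimately have "(\<lambda>n. LINT x:{a..b}|lebesgue. g x * \<phi> n x) \<longlonglongrightarrow> integral {s..t} g"
      by (simp add: set_lebesgue_integral_def mult.assoc)
    from tendsto_minus[OF this] l1 have "- integral {s..t} g = u s - u t" by (rule LIMSEQ_unique)
    then show ?thesis by simp
  qed
  \<comment> \<open>Constant in the interior by \<open>inner\<close>, hence by continuity on the
    closed interval.\<close>
  define H where "H x = u x - integral {a..x} g" for x
  have comb: "integral {x..y} g = integral {a..y} g - integral {a..x} g" if "a \<le> x" "x \<le> y" "y \<le> b" for x y
  proof -
    have "g integrable_on {a..y}" using gS that by (auto intro: integrable_subinterval_real)
    then show ?thesis using Henstock_Kurzweil_Integration.integral_combine[of a x y g] that by simp
  qed
  have "continuous_on {a..b} H"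
    unfolding H_def by (intro continuous_intros u indefinite_integral_continuous_1 gS)
  then have "continuous_on (closure {a<..<b}) H" using ab by simp
  moreover have "H x = H ((a + b) / 2)" if "x \<in> {a<..<b}" for x
  proof -
    have "H x = H y" if "a < x" "x < y" "y < b" for x y
      using inner[OF that] comb[of x y] that by (simp add: H_def)
    moreover have "a < (a + b) / 2" "(a + b) / 2 < b" using ab by auto
    ultimately show ?thesis
      using that by (metis greaterThanLessThan_iff linorder_neqE_linordered_idom)
  qed
  ultimately have const: "H x = H ((a + b) / 2)" if "x \<in> closure {a<..<b}" for x
    using that by (rule continuous_constant_on_closure)
  have "s \<in> closure {a<..<b}" "t \<in> closure {a<..<b}" using st ab by auto
  then have "H s = H t" using const[of s] const[of t] by metis
  then show ?thesis using comb[OF st] by (simp add: H_def)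
qed

section \<open>Comparison with chords\<close>

lemma abs_cont_on_imp_continuous_on:
  assumes "abs_cont_on a b u"
  shows "continuous_on {a..b} u"
  unfolding continuous_on_iff
proof (intro ballI allI impI)
  fix x e :: real assume x: "x \<in> {a..b}" and "0 < e"
  obtain \<delta> where \<delta>: "0 < \<delta>" "\<And>(n::nat) p q.
      (\<forall>i<n. a \<le> p i \<and> p i \<le> q i \<and> q i \<le> b) \<and> disjoint_family_on (\<lambda>i. {p i<..<q i}) {..<n} \<and>
      (\<Sum>i<n. q i - p i) < \<delta> \<longrightarrow> (\<Sum>i<n. \<bar>u (q i) - u (p i)\<bar>) < e"
    using assms \<open>0 < e\<close> unfolding abs_cont_on_def by blast
  have "dist (u y) (u x) < e" if "y \<in> {a..b}" "dist y x < \<delta>" for y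
    using \<delta>(2)[of 1 "\<lambda>_. min x y" "\<lambda>_. max x y"] x that
    by (auto simp: dist_real_def disjoint_family_on_def min_def max_def abs_minus_commute split: if_splits)
  then show "\<exists>d>0. \<forall>y\<in>{a..b}. dist y x < d \<longrightarrow> dist (u y) (u x) < e" using \<delta>(1) by blast
qed

lemma absolutely_integrable_splice:
  fixes f h :: "real \<Rightarrow> real"
  assumes f: "f absolutely_integrable_on {a..b}" and h: "h absolutely_integrable_on {s..t}"
    and sub: "{s..t} \<subseteq> {a..b}"
  shows "(\<lambda>x. if x \<in> {s..t} then h x else f x) absolutely_integrable_on {a..b}"
    and "integral {a..b} (\<lambda>x. if x \<in> {s..t} then h x else f x) =
      integral {a..b} f - integral {s..t} f + integral {s..t} h"
proof -
  have fs: "f absolutely_integrable_on {s..t}" by (rule set_integrable_subset[OF f _ sub]) simp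
  define d where "d x = (if x \<in> {s..t} then h x - f x else 0)" for x
  have d: "d absolutely_integrable_on {a..b}"
  proof -
    have "(\<lambda>x. h x - f x) absolutely_integrable_on {s..t}" using h fs by (rule set_integral_diff(1))
    moreover have "(\<lambda>x. indicator {s..t} x *\<^sub>R (h x - f x)) = (\<lambda>x. indicator {a..b} x *\<^sub>R d x)"
      using sub by (auto simp: d_def indicator_def fun_eq_iff)
    ultimately show ?thesis by (simp only: set_integrable_def)
  qed
  have eq: "(\<lambda>x. if x \<in> {s..t} then h x else f x) = (\<lambda>x. f x + d x)" by (auto simp: d_def)
  show "(\<lambda>x. if x \<in> {s..t} then h x else f x) absolutely_integrable_on {a..b}"
    unfolding eq using f d by (rule set_integral_add(1))
  have "((\<lambda>x. h x - f x) has_integral integral {s..t} h - integral {s..t} f) {s..t}"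
    using set_lebesgue_integral_eq_integral(1)[OF h] set_lebesgue_integral_eq_integral(1)[OF fs]
    by (intro has_integral_diff integrable_integral)
  then have "(d has_integral integral {s..t} h - integral {s..t} f) {a..b}"
    unfolding d_def by (simp only: has_integral_restrict[OF sub])
  from has_integral_add[OF integrable_integral[OF set_lebesgue_integral_eq_integral(1)[OF f]] this]
  show "integral {a..b} (\<lambda>x. if x \<in> {s..t} then h x else f x) = integral {a..b} f - integral {s..t} f + integral {s..t} h"
    unfolding eq by (simp add: integral_unique)
qed

text \<open>The chord is the antiderivative of \<open>g1\<close>, so the converse of
  \<open>weak_deriv_FTC\<close> applies. That \<open>g1\<close> is modified on the closed interval,
  \<open>chord\<close> on the open one, matters only at two points.\<close>

lemma has_weak_deriv_chord:
  assumes ab: "a < b" and u: "continuous_on {a..b} u" and g: "has_weak_deriv a b u g"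
    and st: "a \<le> s" "s < t" "t \<le> b"
  defines "g1 \<equiv> \<lambda>x. if x \<in> {s..t} then slope u s t else g x"
  shows "has_weak_deriv a b (chord u s t) g1" "continuous_on {a..b} (chord u s t)"
proof -
  let ?k = "slope u s t"
  have kt: "?k * (t - s) = u t - u s"
    using st(2) by (intro slope_mult) simp
  have gi: "g absolutely_integrable_on {a..b}" using g by (simp add: has_weak_deriv_def)
  have g1i: "g1 absolutely_integrable_on {a..b}"
    unfolding g1_def using st
    by (intro absolutely_integrable_splice(1)[OF gi] absolutely_integrable_continuous_real) auto
  have g1S: "g1 integrable_on {a..b}" using g1i by (rule set_lebesgue_integral_eq_integral)
  have out: "integral {x..y} g1 = u y - u x" if "a \<le> x" "x \<le> y" "y \<le> b" "y \<le> s \<or> t \<le> x" for x y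
  proof -
    have "integral {x..y} g1 = integral {x..y} g"
      by (rule integral_spike[of "{s, t}"]) (use that st in \<open>auto simp: g1_def\<close>)
    then show ?thesis using weak_deriv_FTC[OF ab u g that(1-3)] by simp
  qed
  have ins: "integral {x..y} g1 = ?k * (y - x)" if "s \<le> x" "x \<le> y" "y \<le> t" for x y
  proof -
    have "integral {x..y} g1 = integral {x..y} (\<lambda>_. ?k)"
      by (rule Henstock_Kurzweil_Integration.integral_cong) (use that in \<open>auto simp: g1_def\<close>)
    then show ?thesis using that by simp
  qed
  have comb: "integral {a..x} g1 = integral {a..y} g1 + integral {y..x} g1" if "a \<le> y" "y \<le> x" "x \<le> b" for x y
  proof -
    have "g1 integrable_on {a..x}" using g1S that by (auto intro: integrable_subinterval_real)
    then show ?thesis using Henstock_Kurzweil_Integration.integral_combine[of a y x g1] that by simp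
  qed
  have v: "chord u s t x = chord u s t a + integral {a..x} g1" if x: "x \<in> {a..b}" for x
  proof -
    have ca: "chord u s t a = u a" using st by (simp add: chord_def)
    consider "x \<le> s" | "s < x" "x < t" | "t \<le> x" by linarith
    then show ?thesis
    proof cases
      case 1 then show ?thesis using out[of a x] x ca by (simp add: chord_def)
    next
      case 2 then show ?thesis using comb[of s x] out[of a s] ins[of s x] st x ca by (simp add: chord_def)
    next
      case 3 then show ?thesis using comb[of s x] comb[of s t] comb[of t x] out[of a s] ins[of s t] out[of t x] st x ca kt by (simp add: chord_def)
    qed
  qed
  show "has_weak_deriv a b (chord u s t) g1" using has_weak_deriv_of_integral[OF ab g1i v] .
  have "continuous_on {a..b} (\<lambda>x. chord u s t a + integral {a..x} g1)"
    by (intro continuous_intros indefinite_integral_continuous_1 g1S)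
  then show "continuous_on {a..b} (chord u s t)" by (rule continuous_on_eq) (rule v[symmetric])
qed

lemma has_weak_deriv_weak_deriv:
  "has_weak_deriv a b u g \<Longrightarrow> has_weak_deriv a b u (weak_deriv a b u)"
  unfolding weak_deriv_def by (rule someI[of "has_weak_deriv a b u"])

text \<open>Frees later arguments from the choice made in \<open>weak_deriv\<close>: by the
  fundamental theorem any two weak derivatives have equal integrals over all subintervals.\<close>

lemma weak_deriv_AE_eq:
  assumes "a < b" "continuous_on {a..b} u" "has_weak_deriv a b u g"
  shows "AE x in lebesgue. x \<in> {a..b} \<longrightarrow> weak_deriv a b u x = g x"
proof (rule AE_eq_of_integral_Icc_eq)
  have w: "has_weak_deriv a b u (weak_deriv a b u)" using assms(3) by (rule has_weak_deriv_weak_deriv)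
  show "weak_deriv a b u absolutely_integrable_on {a..b}" "g absolutely_integrable_on {a..b}"
    using assms(3) w by (auto simp: has_weak_deriv_def)
  show "integral {s..t} (weak_deriv a b u) = integral {s..t} g" if "a \<le> s" "s \<le> t" "t \<le> b" for s t
    using weak_deriv_FTC[OF assms(1,2) w that] weak_deriv_FTC[OF assms that] by simp
qed

section \<open>Measurability and integrability of the Lagrangian along a curve\<close>

lemma lagrangian_measurable:
  fixes L :: "real \<Rightarrow> real \<Rightarrow> real \<Rightarrow> real"
  assumes ab: "a < b"
    and L: "continuous_on ({a..b} \<times> UNIV \<times> UNIV) (\<lambda>(x, w, v). L x w v)"
    and w: "continuous_on {a..b} w" and g: "g absolutely_integrable_on {a..b}"
  shows "(\<lambda>x. indicator {a..b} x * L x (w x) (g x)) \<in> borel_measurable lebesgue"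
proof -
  \<comment> \<open>Clamping to \<open>{a..b}\<close> extends \<open>L\<close> and \<open>w\<close>
    continuously to the whole line, so that measurability follows by composition.\<close>
  define cl where "cl x = max a (min b x)" for x
  have cl: "cl x \<in> {a..b}" for x using ab by (auto simp: cl_def)
  have cl_cont: "continuous_on UNIV cl" unfolding cl_def by (intro continuous_intros)
  have "continuous_on UNIV (\<lambda>p. (\<lambda>(x, w, v). L x w v) (cl (fst p), fst (snd p), snd (snd p)))"
    using cl by (intro continuous_on_compose2[OF L] continuous_intros continuous_on_compose2[OF cl_cont]) auto
  then have Lc: "(\<lambda>p. L (cl (fst p)) (fst (snd p)) (snd (snd p))) \<in> borel_measurable borel"
    by (intro borel_measurable_continuous_onI) (simp add: case_prod_beta')
  have "continuous_on UNIV (\<lambda>x. w (cl x))"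
    using cl by (intro continuous_on_compose2[OF w cl_cont]) auto
  then have wc: "(\<lambda>x. w (cl x)) \<in> borel_measurable lebesgue"
    using borel_measurable_continuous_onI[of "\<lambda>x. w (cl x)"] by (simp add: measurable_completion)
  have h: "(\<lambda>x. indicator {a..b} x * g x) \<in> borel_measurable lebesgue"
    using g borel_measurable_integrable unfolding set_integrable_def by force
  have "(\<lambda>x. (x, w (cl x), indicator {a..b} x * g x)) \<in> lebesgue \<rightarrow>\<^sub>M borel"
    by (intro borel_measurable_Pair wc h) (simp add: measurable_completion)
  from measurable_compose[OF this Lc]
  have "(\<lambda>x. L (cl x) (w (cl x)) (indicator {a..b} x * g x)) \<in> borel_measurable lebesgue" by simp
  then have "(\<lambda>x. indicator {a..b} x * L (cl x) (w (cl x)) (indicator {a..b} x * g x)) \<in> borel_measurable lebesgue"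
    by (intro borel_measurable_times borel_measurable_indicator) auto
  moreover have "(\<lambda>x. indicator {a..b} x * L (cl x) (w (cl x)) (indicator {a..b} x * g x)) = (\<lambda>x. indicator {a..b} x * L x (w x) (g x))"
    by (auto simp: indicator_def cl_def max_def min_def fun_eq_iff)
  ultimately show ?thesis by simp
qed

lemma J_eq_nn_integral:
  "J L a b w = enn2ereal (\<integral>\<^sup>+x. ennreal (indicator {a..b} x * L x (w x) (weak_deriv a b w x)) \<partial>lebesgue) -
     enn2ereal (\<integral>\<^sup>+x. ennreal (- (indicator {a..b} x * L x (w x) (weak_deriv a b w x))) \<partial>lebesgue)"
proof -
  have "ennreal r * indicator S x = ennreal (indicator S x * r)" for r and S :: "real set" and x
    by (auto simp: indicator_def)
  then show ?thesis unfolding J_def by simp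
qed

lemma J_eq_integral:
  assumes "(\<lambda>x. L x (w x) (weak_deriv a b w x)) absolutely_integrable_on {a..b}"
  shows "J L a b w = ereal (integral {a..b} (\<lambda>x. L x (w x) (weak_deriv a b w x)))"
proof -
  let ?F = "\<lambda>x. indicator {a..b} x * L x (w x) (weak_deriv a b w x)"
  have i: "integrable lebesgue ?F" using assms by (simp add: set_integrable_def)
  have fin: "(\<integral>\<^sup>+x. ennreal (?F x) \<partial>lebesgue) \<noteq> \<infinity>" "(\<integral>\<^sup>+x. ennreal (- ?F x) \<partial>lebesgue) \<noteq> \<infinity>"
    using i unfolding real_integrable_def by auto
  have e: "enn2ereal X = ereal (enn2real X)" if "X \<noteq> \<infinity>" for X
    using that by (cases X) (auto simp: ennreal_top_neq_one)
  have "J L a b w = ereal (enn2real (\<integral>\<^sup>+x. ennreal (?F x) \<partial>lebesgue) - enn2real (\<integral>\<^sup>+x. ennreal (- ?F x) \<partial>lebesgue))"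
    unfolding J_eq_nn_integral e[OF fin(1)] e[OF fin(2)] by simp
  also have "\<dots> = ereal (LINT x|lebesgue. ?F x)" using real_lebesgue_integral_def[OF i] by simp
  also have "(LINT x|lebesgue. ?F x) = integral {a..b} (\<lambda>x. L x (w x) (weak_deriv a b w x))"
    using set_lebesgue_integral_eq_integral(2)[OF assms] by (simp add: set_lebesgue_integral_def)
  finally show ?thesis .
qed

text \<open>A lower bound makes the negative part integrable, so the difference in \<open>J\<close>
  is never of the form infinity minus infinity, and \<open>J\<close> below \<open>c\<close> forces a
  finite positive part.\<close>

lemma J_finite_imp_integrable:
  assumes meas: "(\<lambda>x. indicator {a..b} x * L x (w x) (weak_deriv a b w x)) \<in> borel_measurable lebesgue"
    and lower: "\<And>x v. x \<in> {a..b} \<Longrightarrow> - B \<le> L x (w x) v"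
    and fin: "J L a b w \<le> ereal c"
  shows "(\<lambda>x. L x (w x) (weak_deriv a b w x)) absolutely_integrable_on {a..b}"
proof -
  let ?F = "\<lambda>x. indicator {a..b} x * L x (w x) (weak_deriv a b w x)"
  have "(\<integral>\<^sup>+x. ennreal (- ?F x) \<partial>lebesgue) \<le> (\<integral>\<^sup>+x. ennreal \<bar>B\<bar> * indicator {a..b} x \<partial>lebesgue)"
  proof (rule nn_integral_mono)
    fix x :: real
    have "- ?F x \<le> \<bar>B\<bar>" if "x \<in> {a..b}" using lower[OF that, of "weak_deriv a b w x"] that by simp
    then show "ennreal (- ?F x) \<le> ennreal \<bar>B\<bar> * indicator {a..b} x"
      by (cases "x \<in> {a..b}") (auto intro: ennreal_leI)
  qed
  also have "\<dots> = ennreal \<bar>B\<bar> * emeasure lebesgue {a..b}" by (intro nn_integral_cmult_indicator) simp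
  also have "\<dots> < \<infinity>" by (simp add: ennreal_mult_less_top emeasure_lborel_Icc_eq)
  finally have neg: "(\<integral>\<^sup>+x. ennreal (- ?F x) \<partial>lebesgue) \<noteq> \<infinity>" by simp
  have pos: "(\<integral>\<^sup>+x. ennreal (?F x) \<partial>lebesgue) \<noteq> \<infinity>"
  proof
    assume "(\<integral>\<^sup>+x. ennreal (?F x) \<partial>lebesgue) = \<infinity>"
    with fin neg show False unfolding J_eq_nn_integral
      by (cases "\<integral>\<^sup>+x. ennreal (- ?F x) \<partial>lebesgue") auto
  qed
  show ?thesis unfolding set_integrable_def real_integrable_def using meas pos neg by simp
qed

text \<open>Outside \<open>{s..t}\<close> both integrands agree almost everywhere, and all integrals
  involved are finite, so the outer contributions cancel as real numbers.\<close>

lemma chord_minimality: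
  fixes L :: "real \<Rightarrow> real \<Rightarrow> real \<Rightarrow> real"
  assumes ab: "a < b"
    and L: "continuous_on ({a..b} \<times> UNIV \<times> UNIV) (\<lambda>(x, w, v). L x w v)"
    and u: "continuous_on {a..b} u" and g: "has_weak_deriv a b u g"
    and F: "(\<lambda>x. L x (u x) (weak_deriv a b u x)) absolutely_integrable_on {a..b}"
    and st: "a \<le> s" "s < t" "t \<le> b"
    and min: "J L a b u \<le> J L a b (chord u s t) + ereal \<eta>"
  shows "integral {s..t} (\<lambda>x. L x (u x) (weak_deriv a b u x)) \<le>
    integral {s..t} (\<lambda>x. L x (u s + slope u s t * (x - s)) (slope u s t)) + \<eta>"
proof -
  let ?k = "slope u s t" and ?w = "chord u s t" and ?g = "weak_deriv a b u"
  let ?F = "\<lambda>x. L x (u x) (?g x)" and ?H = "\<lambda>x. L x (u s + ?k * (x - s)) ?k"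
  have kt: "?k * (t - s) = u t - u s"
    using st(2) by (intro slope_mult) simp
  have g': "has_weak_deriv a b u ?g" using g by (rule has_weak_deriv_weak_deriv)
  note w = has_weak_deriv_chord[OF ab u g' st]
  have wg: "weak_deriv a b ?w absolutely_integrable_on {a..b}"
    using has_weak_deriv_weak_deriv[OF w(1)] by (simp add: has_weak_deriv_def)
  have "continuous_on {s..t} (\<lambda>x. (\<lambda>(x, w, v). L x w v) (x, u s + ?k * (x - s), ?k))"
    using st by (intro continuous_on_compose2[OF L] continuous_intros) auto
  then have H: "?H absolutely_integrable_on {s..t}" by (intro absolutely_integrable_continuous_real) simp
  \<comment> \<open>The integrand of the chord written with its explicit derivative; the one built
    from \<open>weak_deriv\<close> agrees with it only almost everywhere.\<close>
  define S where "S x = (if x \<in> {s..t} then ?H x else ?F x)" for x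
  have S: "S absolutely_integrable_on {a..b}" "integral {a..b} S = integral {a..b} ?F - integral {s..t} ?F + integral {s..t} ?H"
    unfolding S_def using st by (intro absolutely_integrable_splice[OF F H]; simp)+
  have ae: "AE x in lebesgue. x \<in> {a..b} \<longrightarrow> L x (?w x) (weak_deriv a b ?w x) = S x"
    using weak_deriv_AE_eq[OF ab w(2,1)]
  proof (rule eventually_mono, intro impI)
    fix x assume *: "x \<in> {a..b} \<longrightarrow> weak_deriv a b ?w x = (if x \<in> {s..t} then ?k else ?g x)" "x \<in> {a..b}"
    have "?w x = (if x \<in> {s..t} then u s + ?k * (x - s) else u x)"
      using kt by (auto simp: chord_def)
    with * show "L x (?w x) (weak_deriv a b ?w x) = S x" by (auto simp: S_def)
  qed
  have meas: "(\<lambda>x. indicator {a..b} x *\<^sub>R L x (?w x) (weak_deriv a b ?w x)) \<in> borel_measurable lebesgue"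
    using lagrangian_measurable[OF ab L w(2) wg] by simp
  have measS: "(\<lambda>x. indicator {a..b} x *\<^sub>R S x) \<in> borel_measurable lebesgue"
    using S(1) unfolding set_integrable_def by (rule borel_measurable_integrable)
  have ae': "AE x in lebesgue. indicator {a..b} x *\<^sub>R S x = indicator {a..b} x *\<^sub>R L x (?w x) (weak_deriv a b ?w x)"
    using ae by (rule eventually_mono) (auto simp: indicator_def)
  have W: "(\<lambda>x. L x (?w x) (weak_deriv a b ?w x)) absolutely_integrable_on {a..b}"
    using S(1) meas ae' unfolding set_integrable_def by (rule integrable_cong_AE_imp)
  have "(LINT x:{a..b}|lebesgue. S x) = (LINT x:{a..b}|lebesgue. L x (?w x) (weak_deriv a b ?w x))"
    unfolding set_lebesgue_integral_def using measS meas ae' by (rule integral_cong_AE)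
  then have "integral {a..b} (\<lambda>x. L x (?w x) (weak_deriv a b ?w x)) = integral {a..b} S"
    using set_lebesgue_integral_eq_integral(2)[OF S(1)] set_lebesgue_integral_eq_integral(2)[OF W] by simp
  then have "integral {a..b} ?F \<le> integral {a..b} S + \<eta>"
    using min unfolding J_eq_integral[where L = L, OF F] J_eq_integral[where L = L, OF W] by simp
  then show ?thesis using S(2) by simp
qed

section \<open>The energy estimate\<close>

text \<open>Cauchy-Schwarz against the constant 1, obtained from the nonnegative integral of
  \<open>(q z - m)\<^sup>2\<close> with \<open>m\<close> the mean of \<open>q\<close>.\<close>

lemma square_integral_le:
  fixes q :: "real \<Rightarrow> real"
  assumes q: "q integrable_on {x..y}" and q2: "(\<lambda>z. (q z)\<^sup>2) integrable_on {x..y}" and "x \<le> y"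
  shows "(integral {x..y} q)\<^sup>2 \<le> (y - x) * integral {x..y} (\<lambda>z. (q z)\<^sup>2)"
proof (cases "x = y")
  case False
  with \<open>x \<le> y\<close> have xy: "0 < y - x" by simp
  define I m where "I = integral {x..y} q" and "m = I / (y - x)"
  have "((\<lambda>z. (q z)\<^sup>2 - 2 * m * q z + m\<^sup>2) has_integral integral {x..y} (\<lambda>z. (q z)\<^sup>2) - 2 * m * I + (y - x) * m\<^sup>2) {x..y}"
    unfolding I_def using has_integral_const_real[of "m\<^sup>2" x y] \<open>x \<le> y\<close>
    by (intro has_integral_add has_integral_diff has_integral_mult_right integrable_integral q q2) simp
  moreover have "(\<lambda>z. (q z)\<^sup>2 - 2 * m * q z + m\<^sup>2) = (\<lambda>z. (q z - m)\<^sup>2)"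
    by (auto simp: power2_eq_square algebra_simps)
  ultimately have "((\<lambda>z. (q z - m)\<^sup>2) has_integral integral {x..y} (\<lambda>z. (q z)\<^sup>2) - 2 * m * I + (y - x) * m\<^sup>2) {x..y}"
    by simp
  then have "0 \<le> integral {x..y} (\<lambda>z. (q z)\<^sup>2) - 2 * m * I + (y - x) * m\<^sup>2"
    by (rule has_integral_nonneg) simp
  moreover have mI: "m * (y - x) = I" using xy by (simp add: m_def)
  then have "(y - x) * m\<^sup>2 = m * I" by (metis mult.commute mult.left_commute power2_eq_square)
  ultimately have "0 \<le> integral {x..y} (\<lambda>z. (q z)\<^sup>2) - m * I" by (simp add: mult.commute)
  then have "0 \<le> (y - x) * (integral {x..y} (\<lambda>z. (q z)\<^sup>2) - m * I)" using xy by simp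
  also have "\<dots> = (y - x) * integral {x..y} (\<lambda>z. (q z)\<^sup>2) - m * (y - x) * I" by (simp add: algebra_simps)
  finally show ?thesis unfolding mI by (simp add: I_def power2_eq_square)
qed simp

locale regular_lagrangian =
  fixes a b \<mu> :: real
    and L :: "real \<Rightarrow> real \<Rightarrow> real \<Rightarrow> real"
    and C \<alpha> :: "(real \<times> real \<times> real) set \<Rightarrow> real"
  assumes ab: "a < b"
    and L_cont: "continuous_on ({a..b} \<times> UNIV \<times> UNIV) (\<lambda>(x, w, v). L x w v)"
    and holder:
      "\<And>G. compact G \<Longrightarrow> G \<subseteq> {a..b} \<times> UNIV \<times> UNIV \<Longrightarrow>
         0 < C G \<and> 0 < \<alpha> G \<and>
         (\<forall>(x\<^sub>1, u\<^sub>1, v\<^sub>1)\<in>G. \<forall>(x\<^sub>2, u\<^sub>2, v\<^sub>2)\<in>G.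
            \<bar>L x\<^sub>1 u\<^sub>1 v\<^sub>1 - L x\<^sub>2 u\<^sub>2 v\<^sub>2\<bar>
              \<le> C G * (\<bar>x\<^sub>1 - x\<^sub>2\<bar> + \<bar>u\<^sub>1 - u\<^sub>2\<bar> + \<bar>v\<^sub>1 - v\<^sub>2\<bar>) powr \<alpha> G)"
    and Lv_exists: "\<And>x w v. x \<in> {a..b} \<Longrightarrow> L x w differentiable (at v)"
    and Lvv_exists: "\<And>x w v. x \<in> {a..b} \<Longrightarrow> Dv L x w differentiable (at v)"
    and Lvv_cont: "continuous_on ({a..b} \<times> UNIV \<times> UNIV) (\<lambda>(x, w, v). Dv (Dv L) x w v)"
    and mu_pos: "0 < \<mu>"
    and Lvv_ge: "\<And>x w v. x \<in> {a..b} \<Longrightarrow> \<mu> \<le> Dv (Dv L) x w v"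
begin

lemma L_deriv: "x \<in> {a..b} \<Longrightarrow> (L x w has_real_derivative Dv L x w v) (at v)"
  using Lv_exists[of x w v] unfolding Dv_def real_differentiable_def by (auto dest: DERIV_imp_deriv)

lemma Lv_deriv: "x \<in> {a..b} \<Longrightarrow> (Dv L x w has_real_derivative Dv (Dv L) x w v) (at v)"
  using Lvv_exists[of x w v] unfolding Dv_def[of "Dv L"] real_differentiable_def by (auto dest: DERIV_imp_deriv)

text \<open>Subtracting the tangent and the quadratic term leaves a function whose derivative at
  \<open>y\<close> has the sign of \<open>y - k\<close>, since L_v grows at rate at least \<mu>; its
  minimum is at \<open>k\<close>.\<close>

lemma uniformly_convex:
  assumes x: "x \<in> {a..b}"
  shows "L x w k + Dv L x w k * (v - k) + \<mu> / 2 * (v - k)\<^sup>2 \<le> L x w v"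
proof -
  define g where "g y = L x w y - Dv L x w k * (y - k) - \<mu> / 2 * (y - k)\<^sup>2" for y
  have der: "(g has_real_derivative Dv L x w y - Dv L x w k - \<mu> * (y - k)) (at y)" for y
    unfolding g_def by (auto intro!: derivative_eq_intros L_deriv[OF x])
  have inc: "\<mu> * (z - y) \<le> Dv L x w z - Dv L x w y" if yz: "y < z" for y z
  proof -
    obtain \<xi> where "Dv L x w z - Dv L x w y = (z - y) * Dv (Dv L) x w \<xi>"
      using MVT2[OF yz, of "Dv L x w" "Dv (Dv L) x w"] Lv_deriv[OF x] by auto
    then show ?thesis using Lvv_ge[OF x, of w \<xi>] yz by (simp add: mult.commute mult_left_mono)
  qed
  have "g k \<le> g v"
  proof (cases "k \<le> v")
    case True
    then show ?thesis
    proof (rule DERIV_nonneg_imp_nondecreasing)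
      fix y assume "k \<le> y" "y \<le> v"
      then show "\<exists>d. (g has_real_derivative d) (at y) \<and> 0 \<le> d"
        using der[of y] inc[of k y] by (cases "k = y") fastforce+
    qed
  next
    case False
    then have "v \<le> k" by simp
    then show ?thesis
    proof (rule DERIV_nonpos_imp_nonincreasing)
      fix y assume "v \<le> y" "y \<le> k"
      then show "\<exists>d. (g has_real_derivative d) (at y) \<and> d \<le> 0"
        using der[of y] inc[of y k] by (cases "k = y") (fastforce simp: algebra_simps)+
    qed
  qed
  then show ?thesis by (simp add: g_def)
qed

text \<open>The mean value theorem for L, then for L_v; positivity of L_vv turns the upper bound
  \<open>B\<close> into a bound in modulus.\<close>

lemma difference_quotient_error:
  assumes x: "x \<in> {a..b}" and "0 < \<tau>"
    and B: "\<And>y. k \<le> y \<Longrightarrow> y \<le> k + \<tau> \<Longrightarrow> Dv (Dv L) x w y \<le> B"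
  shows "\<bar>L x w (k + \<tau>) - L x w k - \<tau> * Dv L x w k\<bar> \<le> B * \<tau>\<^sup>2"
proof -
  have "k < k + \<tau>" using assms by simp
  from MVT2[OF this, of "L x w" "Dv L x w"] L_deriv[OF x]
  obtain \<xi> where \<xi>: "k < \<xi>" "\<xi> < k + \<tau>" "L x w (k + \<tau>) - L x w k = \<tau> * Dv L x w \<xi>" by auto
  from MVT2[OF \<xi>(1), of "Dv L x w" "Dv (Dv L) x w"] Lv_deriv[OF x]
  obtain \<eta> where \<eta>: "k < \<eta>" "\<eta> < \<xi>" "Dv L x w \<xi> - Dv L x w k = (\<xi> - k) * Dv (Dv L) x w \<eta>" by auto
  have pos: "0 \<le> Dv (Dv L) x w \<eta>" using Lvv_ge[OF x, of w \<eta>] mu_pos by linarith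
  have "(\<xi> - k) * Dv (Dv L) x w \<eta> \<le> \<tau> * B"
    using \<xi> \<eta> B[of \<eta>] pos by (intro mult_mono) auto
  moreover have "0 \<le> (\<xi> - k) * Dv (Dv L) x w \<eta>" using \<xi> pos by simp
  moreover have "L x w (k + \<tau>) - L x w k - \<tau> * Dv L x w k = \<tau> * ((\<xi> - k) * Dv (Dv L) x w \<eta>)"
    unfolding \<xi>(3) \<eta>(3)[symmetric] by (simp add: right_diff_distrib)
  ultimately show ?thesis
    using \<open>0 < \<tau>\<close> mult_left_mono[of "(\<xi> - k) * Dv (Dv L) x w \<eta>" "\<tau> * B" \<tau>]
    by (simp add: power2_eq_square mult_ac)
qed

text \<open>Comparing \<open>L\<^sub>v\<close> with difference quotients of step \<open>d\<^sup>\<alpha>\<^sup>/\<^sup>2\<close>, \<open>d\<close> the distance of the base points,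
  halves the Hoelder exponent.\<close>

lemma holder_L_Lv:
  obtains E \<beta> where "0 < E" "0 < \<beta>"
    "\<And>x y w z k. x \<in> {a..b} \<Longrightarrow> y \<in> {a..b} \<Longrightarrow> \<bar>w\<bar> \<le> U \<Longrightarrow> \<bar>z\<bar> \<le> U \<Longrightarrow> \<bar>k\<bar> \<le> R \<Longrightarrow>
       \<bar>L x w k - L y z k\<bar> \<le> E * (\<bar>x - y\<bar> + \<bar>w - z\<bar>) powr (2 * \<beta>)"
    "\<And>x y w z k. x \<in> {a..b} \<Longrightarrow> y \<in> {a..b} \<Longrightarrow> \<bar>w\<bar> \<le> U \<Longrightarrow> \<bar>z\<bar> \<le> U \<Longrightarrow> \<bar>k\<bar> \<le> R \<Longrightarrow>
       \<bar>x - y\<bar> + \<bar>w - z\<bar> \<le> 1 \<Longrightarrow>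
       \<bar>Dv L x w k - Dv L y z k\<bar> \<le> E * (\<bar>x - y\<bar> + \<bar>w - z\<bar>) powr \<beta>"
proof -
  \<comment> \<open>The extra 1 in the last factor leaves room for difference quotients of step at
    most 1 in \<open>v\<close>.\<close>
  define G where "G = {a..b} \<times> {-U..U} \<times> {-(R + 1)..R + 1}"
  have G: "compact G" "G \<subseteq> {a..b} \<times> UNIV \<times> UNIV" by (auto simp: G_def intro!: compact_Times)
  have "bounded ((\<lambda>(x, w, v). Dv (Dv L) x w v) ` G)"
    using G by (intro compact_imp_bounded compact_continuous_image continuous_on_subset[OF Lvv_cont])
  then obtain B where "0 < B" and B: "\<And>x w v. (x, w, v) \<in> G \<Longrightarrow> \<bar>Dv (Dv L) x w v\<bar> \<le> B"
    unfolding bounded_pos by fastforce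
  define E where "E = 2 * (C G + B)"
  define \<beta> where "\<beta> = \<alpha> G / 2"
  have C: "0 < C G" and \<beta>: "0 < \<beta>" using holder[OF G] by (auto simp: \<beta>_def)
  have HL: "\<bar>L x w k - L y z k\<bar> \<le> C G * (\<bar>x - y\<bar> + \<bar>w - z\<bar>) powr (2 * \<beta>)"
    if "x \<in> {a..b}" "y \<in> {a..b}" "\<bar>w\<bar> \<le> U" "\<bar>z\<bar> \<le> U" "\<bar>k\<bar> \<le> R + 1" for x y w z k
  proof -
    have "(x, w, k) \<in> G" "(y, z, k) \<in> G" using that by (auto simp: G_def)
    then show ?thesis using holder[OF G] by (fastforce simp: \<beta>_def)
  qed
  show ?thesis
  proof (rule that[of E \<beta>])
    show "0 < E" using C \<open>0 < B\<close> by (simp add: E_def)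
    show "0 < \<beta>" by fact
  next
    fix x y w z k assume *: "x \<in> {a..b}" "y \<in> {a..b}" "\<bar>w\<bar> \<le> U" "\<bar>z\<bar> \<le> U" "\<bar>k\<bar> \<le> R"
    have "\<bar>L x w k - L y z k\<bar> \<le> C G * (\<bar>x - y\<bar> + \<bar>w - z\<bar>) powr (2 * \<beta>)" using HL * by simp
    also have "\<dots> \<le> E * (\<bar>x - y\<bar> + \<bar>w - z\<bar>) powr (2 * \<beta>)"
      using C \<open>0 < B\<close> by (intro mult_right_mono) (auto simp: E_def)
    finally show "\<bar>L x w k - L y z k\<bar> \<le> E * (\<bar>x - y\<bar> + \<bar>w - z\<bar>) powr (2 * \<beta>)" .
  next
    fix x y w z k assume *: "x \<in> {a..b}" "y \<in> {a..b}" "\<bar>w\<bar> \<le> U" "\<bar>z\<bar> \<le> U" "\<bar>k\<bar> \<le> R" "\<bar>x - y\<bar> + \<bar>w - z\<bar> \<le> 1"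
    define d where "d = \<bar>x - y\<bar> + \<bar>w - z\<bar>"
    have "\<bar>Dv L x w k - Dv L y z k\<bar> \<le> E * d powr \<beta>"
    proof (cases "d = 0")
      case True
      then have "x = y" "w = z" by (auto simp: d_def)
      then show ?thesis by (simp add: True)
    next
      case False
      then have d: "0 < d" "d \<le> 1" using * by (auto simp: d_def)
      \<comment> \<open>This step balances the errors: L contributes
        \<open>C G * \<tau>\<^sup>2\<close> by the Hoelder bound, the quotients contribute
        \<open>B * \<tau>\<^sup>2\<close>, each twice; dividing by \<tau> leaves
        \<open>E * \<tau>\<close>.\<close>
      define \<tau> where "\<tau> = d powr \<beta>"
      have \<tau>: "0 < \<tau>" "\<tau> \<le> 1" using d \<beta> powr_mono2[of \<beta> d 1] by (auto simp: \<tau>_def)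
      have \<tau>2: "d powr (2 * \<beta>) = \<tau>\<^sup>2" by (simp add: \<tau>_def powr_add[symmetric] power2_eq_square)
      have e1: "\<bar>L x w (k + \<tau>) - L x w k - \<tau> * Dv L x w k\<bar> \<le> B * \<tau>\<^sup>2"
        using * \<tau> B[of x w] by (intro difference_quotient_error) (auto simp: G_def abs_le_iff)
      have e2: "\<bar>L y z (k + \<tau>) - L y z k - \<tau> * Dv L y z k\<bar> \<le> B * \<tau>\<^sup>2"
        using * \<tau> B[of y z] by (intro difference_quotient_error) (auto simp: G_def abs_le_iff)
      have e3: "\<bar>L x w (k + \<tau>) - L y z (k + \<tau>)\<bar> \<le> C G * \<tau>\<^sup>2" "\<bar>L x w k - L y z k\<bar> \<le> C G * \<tau>\<^sup>2"
        using HL[of x y w z "k + \<tau>"] HL[of x y w z k] * \<tau> unfolding d_def[symmetric] \<tau>2 by auto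
      have "\<bar>\<tau> * Dv L x w k - \<tau> * Dv L y z k\<bar> \<le> 2 * (C G * \<tau>\<^sup>2) + 2 * (B * \<tau>\<^sup>2)"
        using e1 e2 e3 by linarith
      also have "\<bar>\<tau> * Dv L x w k - \<tau> * Dv L y z k\<bar> = \<tau> * \<bar>Dv L x w k - Dv L y z k\<bar>"
        using \<tau>(1) by (simp add: abs_mult flip: right_diff_distrib)
      also have "2 * (C G * \<tau>\<^sup>2) + 2 * (B * \<tau>\<^sup>2) = \<tau> * (E * \<tau>)"
        by (simp add: E_def power2_eq_square algebra_simps)
      finally have "\<tau> * \<bar>Dv L x w k - Dv L y z k\<bar> \<le> \<tau> * (E * \<tau>)" .
      then show ?thesis using \<tau>(1) by (simp add: \<tau>_def)
    qed
    then show "\<bar>Dv L x w k - Dv L y z k\<bar> \<le> E * (\<bar>x - y\<bar> + \<bar>w - z\<bar>) powr \<beta>" by (simp add: d_def)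
  qed
qed

text \<open>Convexity bounds L_v at \<open>v = 0\<close> by \<open>2 * m\<close> through the values
  of L at -1, 0 and 1. Completing the square then bounds the quadratic minorant from below by
  \<open>- (m + 2 * m\<^sup>2 / \<mu>)\<close>.\<close>

lemma lagrangian_bounded_below:
  obtains B where "\<And>x w v. x \<in> {a..b} \<Longrightarrow> \<bar>w\<bar> \<le> U \<Longrightarrow> - B \<le> L x w v"
proof -
  define G where "G = {a..b} \<times> {-U..U} \<times> {-1..1::real}"
  have G: "compact G" "G \<subseteq> {a..b} \<times> UNIV \<times> UNIV" by (auto simp: G_def intro!: compact_Times)
  have "bounded ((\<lambda>(x, w, v). L x w v) ` G)"
    using G by (intro compact_imp_bounded compact_continuous_image continuous_on_subset[OF L_cont])
  then obtain m where "0 < m" and m: "\<And>x w v. (x, w, v) \<in> G \<Longrightarrow> \<bar>L x w v\<bar> \<le> m"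
    unfolding bounded_pos by fastforce
  show ?thesis
  proof
    fix x w v assume x: "x \<in> {a..b}" and w: "\<bar>w\<bar> \<le> U"
    have G': "(x, w, y) \<in> G" if "\<bar>y\<bar> \<le> 1" for y using x w that by (auto simp: G_def)
    let ?p = "Dv L x w 0"
    have "L x w 0 + ?p \<le> L x w 1" "L x w 0 - ?p \<le> L x w (-1)"
      using uniformly_convex[OF x, of w 0 1] uniformly_convex[OF x, of w 0 "-1"] mu_pos by auto
    then have "\<bar>?p\<bar> \<le> 2 * m" using m[OF G', of 0] m[OF G', of 1] m[OF G', of "-1"] by auto
    then have "\<bar>?p * v\<bar> \<le> 2 * m * \<bar>v\<bar>" by (simp add: abs_mult mult_right_mono)
    moreover have "0 \<le> \<mu> / 2 * (\<bar>v\<bar> - 2 * m / \<mu>)\<^sup>2" using mu_pos by simp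
    moreover have "\<mu> / 2 * (\<bar>v\<bar> - 2 * m / \<mu>)\<^sup>2 = \<mu> / 2 * v\<^sup>2 - 2 * m * \<bar>v\<bar> + 2 * m\<^sup>2 / \<mu>"
      using mu_pos by (simp add: power2_diff) (simp add: power2_eq_square field_simps)
    moreover have "L x w 0 + ?p * v + \<mu> / 2 * v\<^sup>2 \<le> L x w v" using uniformly_convex[OF x, of w 0 v] by simp
    ultimately show "- (m + 2 * m\<^sup>2 / \<mu>) \<le> L x w v" using m[OF G', of 0] by auto
  qed
qed

text \<open>Uniform convexity at slope \<open>k\<close> is integrated and compared with the chord.
  Of the quadratic term \<mu>/2, one half survives as the energy and the other absorbs the error
  from freezing the linear coefficient; the remaining errors are powers of the length.\<close>

lemma energy_decay:
  assumes u: "continuous_on {a..b} u"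
    and g: "g absolutely_integrable_on {a..b}" and g2: "(\<lambda>x. (g x)\<^sup>2) absolutely_integrable_on {a..b}"
    and FTC: "\<And>s t. a \<le> s \<Longrightarrow> s \<le> t \<Longrightarrow> t \<le> b \<Longrightarrow> integral {s..t} g = u t - u s"
    and F: "(\<lambda>x. L x (u x) (g x)) absolutely_integrable_on {a..b}"
    and N: "0 \<le> N" "integral {a..b} (\<lambda>x. (g x)\<^sup>2) \<le> N\<^sup>2"
    and \<omega>_mono: "\<And>k k' h. 0 \<le> k \<Longrightarrow> k \<le> k' \<Longrightarrow> 0 \<le> h \<Longrightarrow> \<omega> k h \<le> \<omega> k' h"
    and \<omega>_nonneg: "\<And>k h. 0 \<le> k \<Longrightarrow> 0 \<le> h \<Longrightarrow> 0 \<le> \<omega> k h"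
    and "0 < \<delta>"
    and min: "\<And>s t. a \<le> s \<Longrightarrow> s < t \<Longrightarrow> t \<le> b \<Longrightarrow> t - s \<le> \<delta> \<Longrightarrow>
       integral {s..t} (\<lambda>x. L x (u x) (g x)) \<le>
       integral {s..t} (\<lambda>x. L x (u s + slope u s t * (x - s)) (slope u s t)) + \<omega> \<bar>slope u s t\<bar> (t - s) * (t - s)"
    and R: "0 \<le> R"
  obtains A h\<^sub>0 \<beta> :: real where "0 < A" "0 < h\<^sub>0" "0 < \<beta>"
    "\<And>s t. a \<le> s \<Longrightarrow> s < t \<Longrightarrow> t \<le> b \<Longrightarrow> t - s \<le> h\<^sub>0 \<Longrightarrow> \<bar>slope u s t\<bar> \<le> R \<Longrightarrow>
       integral {s..t} (\<lambda>x. (g x - slope u s t)\<^sup>2) \<le> (t - s) * (A * (\<omega> R (t - s) + (t - s) powr \<beta>))"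
proof -
  have sub: "f absolutely_integrable_on {s..t}" if "f absolutely_integrable_on {a..b}" "a \<le> s" "t \<le> b" for s t and f :: "real \<Rightarrow> real"
    using that by (intro set_integrable_subset[OF that(1)]) auto
  have int: "f integrable_on {s..t}" if "f absolutely_integrable_on {a..b}" "a \<le> s" "t \<le> b" for s t and f :: "real \<Rightarrow> real"
    using sub[OF that] by (rule set_lebesgue_integral_eq_integral)
  \<comment> \<open>Cauchy-Schwarz with the bound \<open>N\<close> on the L2 norm of the
    derivative.\<close>
  have u_holder: "\<bar>u y - u x\<bar> \<le> N * sqrt (y - x)" if "a \<le> x" "x \<le> y" "y \<le> b" for x y
  proof -
    have "integral {x..y} (\<lambda>z. (g z)\<^sup>2) \<le> integral {a..b} (\<lambda>z. (g z)\<^sup>2)"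
      using that by (intro integral_subset_le int[OF g2]) auto
    then have "(u y - u x)\<^sup>2 \<le> (y - x) * N\<^sup>2"
      using square_integral_le[OF int[OF g that(1,3)] int[OF g2 that(1,3)] that(2)] FTC[OF that] N that
        mult_left_mono[of "integral {x..y} (\<lambda>z. (g z)\<^sup>2)" "N\<^sup>2" "y - x"] by auto
    from real_sqrt_le_mono[OF this] show ?thesis using N that by (simp add: real_sqrt_mult mult.commute)
  qed
  have "bounded (u ` {a..b})" using u by (intro compact_imp_bounded compact_continuous_image) auto
  then obtain U where "\<forall>x\<in>{a..b}. \<bar>u x\<bar> \<le> U" unfolding bounded_pos by auto
  then have U: "\<bar>u x\<bar> \<le> U" if "x \<in> {a..b}" for x using that by blast
  obtain E \<beta> where E: "0 < E" "0 < \<beta>"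
    and EL: "\<And>x y w z k. x \<in> {a..b} \<Longrightarrow> y \<in> {a..b} \<Longrightarrow> \<bar>w\<bar> \<le> U + 1 \<Longrightarrow> \<bar>z\<bar> \<le> U + 1 \<Longrightarrow> \<bar>k\<bar> \<le> R \<Longrightarrow>
       \<bar>L x w k - L y z k\<bar> \<le> E * (\<bar>x - y\<bar> + \<bar>w - z\<bar>) powr (2 * \<beta>)"
    and ELv: "\<And>x y w z k. x \<in> {a..b} \<Longrightarrow> y \<in> {a..b} \<Longrightarrow> \<bar>w\<bar> \<le> U + 1 \<Longrightarrow> \<bar>z\<bar> \<le> U + 1 \<Longrightarrow> \<bar>k\<bar> \<le> R \<Longrightarrow>
       \<bar>x - y\<bar> + \<bar>w - z\<bar> \<le> 1 \<Longrightarrow> \<bar>Dv L x w k - Dv L y z k\<bar> \<le> E * (\<bar>x - y\<bar> + \<bar>w - z\<bar>) powr \<beta>"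
    by (rule holder_L_Lv[of "U + 1" R]) (rule that; assumption)
  \<comment> \<open>Chosen so that \<open>D = N' * sqrt h\<close> dominates
    \<open>h + N * sqrt h\<close> (as \<open>h \<le> sqrt h\<close>) as well as
    \<open>2 * N * sqrt h\<close>, the distance between graph and chord. The bound on
    \<open>h\<^sub>0\<close> gives \<open>D \<le> 1\<close>, which the Hoelder bound for L_v
    requires.\<close>
  define N' where "N' = 1 + 2 * N"
  have N': "0 < N'" "1 \<le> N'" using N by (auto simp: N'_def)
  define h\<^sub>0 where "h\<^sub>0 = min \<delta> ((1 / N')\<^sup>2)"
  define A\<^sub>1 where "A\<^sub>1 = (E\<^sup>2 / \<mu> + E) * N' powr (2 * \<beta>)"
  have A\<^sub>1: "0 < A\<^sub>1" using E mu_pos N' by (simp add: A\<^sub>1_def add_pos_pos)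
  define A where "A = 4 / \<mu> * (1 + A\<^sub>1)"
  show ?thesis
  proof (rule that[of A h\<^sub>0 \<beta>])
    show "0 < A" "0 < h\<^sub>0" "0 < \<beta>" using A\<^sub>1 mu_pos N' E \<open>0 < \<delta>\<close> by (auto simp: A_def h\<^sub>0_def)
    fix s t assume st: "a \<le> s" "s < t" "t \<le> b" "t - s \<le> h\<^sub>0" and kR: "\<bar>slope u s t\<bar> \<le> R"
    define h k where "h = t - s" and "k = slope u s t"
    have h: "0 < h" "h \<le> \<delta>" using st by (auto simp: h_def h\<^sub>0_def)
    have "sqrt h \<le> 1 / N'" using st N' by (intro real_le_lsqrt) (auto simp: h_def h\<^sub>0_def)
    then have sh: "N' * sqrt h \<le> 1" using N' by (simp add: field_simps)
    have "1 * sqrt h \<le> N' * sqrt h" using N' h by (intro mult_right_mono) auto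
    then have "sqrt h \<le> 1" using sh by linarith
    then have "sqrt h * sqrt h \<le> 1 * sqrt h" using h by (intro mult_right_mono) auto
    then have hs: "h \<le> sqrt h" using h by simp
    define D where "D = N' * sqrt h"
    have D: "0 < D" "D \<le> 1" "h + N * sqrt h \<le> D" "2 * N * sqrt h \<le> D"
    proof -
      have "D = sqrt h + 2 * (N * sqrt h)" by (simp add: D_def N'_def algebra_simps)
      moreover have "0 \<le> N * sqrt h" "0 < sqrt h" using N h by auto
      moreover have "D \<le> 1" using sh by (simp add: D_def)
      ultimately show "0 < D" "D \<le> 1" "h + N * sqrt h \<le> D" "2 * N * sqrt h \<le> D" using hs by linarith+
    qed
    have "0 \<le> N * sqrt h" using N h by simp
    then have ND: "N * sqrt h \<le> 1" using D(2,4) by linarith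
    have us: "\<bar>u x - u s\<bar> \<le> N * sqrt h" if "x \<in> {s..t}" for x
    proof -
      have "\<bar>u x - u s\<bar> \<le> N * sqrt (x - s)" using u_holder[of s x] that st by auto
      also have "\<dots> \<le> N * sqrt h" using that N by (intro mult_left_mono) (auto simp: h_def)
      finally show ?thesis .
    qed
    define ch where "ch x = u s + k * (x - s)" for x
    have chs: "\<bar>ch x - u s\<bar> \<le> N * sqrt h" if x: "x \<in> {s..t}" for x
    proof -
      have "\<bar>k\<bar> * (x - s) \<le> \<bar>k\<bar> * (t - s)" using x by (intro mult_left_mono) auto
      also have "\<dots> = \<bar>u t - u s\<bar>" using slope_mult[of s t u] st by (simp add: k_def abs_mult flip: slope_mult)
      also have "\<dots> \<le> N * sqrt h" using us[of t] st by simp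
      finally show ?thesis using x by (simp add: ch_def abs_mult)
    qed
    define p where "p = Dv L s (u s) k"
    define e where "e = (E\<^sup>2 / \<mu> + E) * D powr (2 * \<beta>)"
    \<comment> \<open>Pointwise lower bound with constant linear coefficient \<open>p\<close>; the
      error \<open>e\<close> collects the moves from \<open>(x, u x)\<close> to
      \<open>(s, u s)\<close> in L_v and to \<open>(x, ch x)\<close> in L.\<close>
    have point: "L x (ch x) k + p * (g x - k) + \<mu> / 4 * (g x - k)\<^sup>2 - e \<le> L x (u x) (g x)" if x: "x \<in> {s..t}" for x
    proof -
      have x': "x \<in> {a..b}" "s \<in> {a..b}" using x st by auto
      have Uu: "\<bar>u x\<bar> \<le> U + 1" "\<bar>u s\<bar> \<le> U + 1" "\<bar>ch x\<bar> \<le> U + 1"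
        using U[OF x'(1)] U[OF x'(2)] chs[OF x] ND by auto
      have d1: "\<bar>x - s\<bar> + \<bar>u x - u s\<bar> \<le> D" using us[OF x] D(3) x by (auto simp: h_def)
      have d2: "\<bar>x - x\<bar> + \<bar>u x - ch x\<bar> \<le> D" using us[OF x] chs[OF x] D(4) by auto
      let ?q = "g x - k" and ?r = "Dv L x (u x) k - p"
      have "\<bar>?r\<bar> \<le> E * (\<bar>x - s\<bar> + \<bar>u x - u s\<bar>) powr \<beta>"
        unfolding p_def using x' Uu kR d1 D by (intro ELv) (auto simp: k_def)
      also have "\<dots> \<le> E * D powr \<beta>" using d1 E by (intro mult_left_mono powr_mono2) auto
      finally have r: "\<bar>?r\<bar> \<le> E * D powr \<beta>" .
      then have "?r\<^sup>2 \<le> (E * D powr \<beta>)\<^sup>2" by (metis abs_ge_zero power2_abs power_mono)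
      also have "\<dots> = E\<^sup>2 * D powr (2 * \<beta>)" by (simp add: power_mult_distrib powr_add[symmetric] power2_eq_square)
      finally have r2: "?r\<^sup>2 / \<mu> \<le> E\<^sup>2 / \<mu> * D powr (2 * \<beta>)" using mu_pos by (simp add: divide_right_mono)
      \<comment> \<open>Young's inequality by completing the square: \<open>?r * ?q\<close> is paid
        for by a quarter of \<open>\<mu> * ?q\<^sup>2\<close>.\<close>
      have "0 \<le> \<mu> * (?q / 2 + ?r / \<mu>)\<^sup>2" using mu_pos by simp
      also have "\<dots> = \<mu> / 4 * ?q\<^sup>2 + ?r * ?q + ?r\<^sup>2 / \<mu>"
        using mu_pos by (simp add: power2_eq_square field_simps)
      finally have young: "- (\<mu> / 4 * ?q\<^sup>2) - ?r\<^sup>2 / \<mu> \<le> ?r * ?q" by simp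
      have "\<bar>L x (u x) k - L x (ch x) k\<bar> \<le> E * (\<bar>x - x\<bar> + \<bar>u x - ch x\<bar>) powr (2 * \<beta>)"
        using x' Uu kR by (intro EL) (auto simp: k_def)
      also have "\<dots> \<le> E * D powr (2 * \<beta>)" using d2 E by (intro mult_left_mono powr_mono2) auto
      finally have l: "L x (ch x) k - E * D powr (2 * \<beta>) \<le> L x (u x) k" by linarith
      have "L x (u x) k + Dv L x (u x) k * ?q + \<mu> / 2 * ?q\<^sup>2 \<le> L x (u x) (g x)"
        using uniformly_convex[OF x'(1)] by simp
      moreover have "Dv L x (u x) k * ?q = p * ?q + ?r * ?q" by (simp add: algebra_simps)
      moreover have "e = E\<^sup>2 / \<mu> * D powr (2 * \<beta>) + E * D powr (2 * \<beta>)" by (simp add: e_def algebra_simps)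
      ultimately show ?thesis using young r2 l by linarith
    qed
    \<comment> \<open>The slope \<open>k\<close> is the mean of \<open>g\<close>, which removes the
      linear term after integration.\<close>
    have q: "(\<lambda>x. g x - k) integrable_on {s..t}" "integral {s..t} (\<lambda>x. g x - k) = 0"
    proof -
      have "((\<lambda>x. g x - k) has_integral (u t - u s) - (t - s) * k) {s..t}"
        using integrable_integral[OF int[OF g st(1,3)]] FTC[of s t] st has_integral_const_real[of k s t]
        by (intro has_integral_diff) auto
      moreover have "(u t - u s) - (t - s) * k = 0" using slope_mult[of s t u] st by (simp add: k_def mult.commute)
      ultimately show "(\<lambda>x. g x - k) integrable_on {s..t}" "integral {s..t} (\<lambda>x. g x - k) = 0" by (auto simp: integral_unique)
    qed
    have "(\<lambda>x. (g x)\<^sup>2 - 2 * k * g x + k\<^sup>2) integrable_on {s..t}"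
      using int[OF g st(1,3)] int[OF g2 st(1,3)] by (intro integrable_add integrable_diff integrable_on_mult_right) auto
    then have q2: "(\<lambda>x. (g x - k)\<^sup>2) integrable_on {s..t}"
      by (simp add: power2_diff algebra_simps)
    have "continuous_on {s..t} (\<lambda>x. (\<lambda>(x, w, v). L x w v) (x, ch x, k))"
      unfolding ch_def using st by (intro continuous_on_compose2[OF L_cont] continuous_intros) auto
    then have H: "(\<lambda>x. L x (ch x) k) integrable_on {s..t}" by (intro integrable_continuous_real) simp
    let ?I = "integral {s..t} (\<lambda>x. (g x - k)\<^sup>2)"
    have "((\<lambda>x. L x (ch x) k + p * (g x - k) + \<mu> / 4 * (g x - k)\<^sup>2 - e) has_integral
        integral {s..t} (\<lambda>x. L x (ch x) k) + p * 0 + \<mu> / 4 * ?I - (t - s) * e) {s..t}"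
      using integrable_integral[OF q(1)] q(2) has_integral_const_real[of e s t] st
      by (intro has_integral_diff has_integral_add has_integral_mult_right integrable_integral[OF H] integrable_integral[OF q2]) auto
    from has_integral_le[OF this integrable_integral[OF int[OF F st(1,3)]] point]
    have "integral {s..t} (\<lambda>x. L x (ch x) k) + \<mu> / 4 * ?I - h * e \<le> integral {s..t} (\<lambda>x. L x (u x) (g x))"
      by (simp add: h_def)
    also have "\<dots> \<le> integral {s..t} (\<lambda>x. L x (ch x) k) + \<omega> \<bar>k\<bar> h * h"
      using min[OF st(1-3)] h by (simp add: ch_def k_def h_def)
    finally have "\<mu> / 4 * ?I \<le> h * (\<omega> \<bar>k\<bar> h + e)" by (simp add: algebra_simps)
    also have "\<dots> \<le> h * (\<omega> R h + A\<^sub>1 * h powr \<beta>)"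
    proof -
      have "D powr (2 * \<beta>) = N' powr (2 * \<beta>) * h powr \<beta>"
        using N' h by (simp add: D_def powr_mult powr_half_sqrt[symmetric] powr_powr)
      then have "e = A\<^sub>1 * h powr \<beta>" by (simp add: e_def A\<^sub>1_def)
      then show ?thesis using h kR \<omega>_mono[of "\<bar>k\<bar>" R h] by (intro mult_left_mono) (auto simp: k_def)
    qed
    also have "\<dots> \<le> h * ((1 + A\<^sub>1) * (\<omega> R h + h powr \<beta>))"
      using h A\<^sub>1 \<omega>_nonneg[OF R, of h] by (intro mult_left_mono) (auto simp: algebra_simps)
    finally have "?I \<le> h * (A * (\<omega> R h + h powr \<beta>))" using mu_pos by (simp add: A_def field_simps)
    then show "integral {s..t} (\<lambda>x. (g x - slope u s t)\<^sup>2) \<le> (t - s) * (A * (\<omega> R (t - s) + (t - s) powr \<beta>))"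
      by (simp add: h_def k_def)
  qed
qed

end

section \<open>Dyadic iteration\<close>

text \<open>The mean of \<open>g - k\<close> over the inner interval is the slope difference.
  Cauchy-Schwarz there, then enlarging the domain to \<open>{s..t}\<close>; the length ratio of at
  most 2 gives the factor under the root.\<close>

lemma slope_oscillation:
  fixes g :: "real \<Rightarrow> real"
  assumes g: "g absolutely_integrable_on {a..b}" and g2: "(\<lambda>x. (g x)\<^sup>2) absolutely_integrable_on {a..b}"
    and FTC: "\<And>s t. a \<le> s \<Longrightarrow> s \<le> t \<Longrightarrow> t \<le> b \<Longrightarrow> integral {s..t} g = u t - u s"
    and st: "a \<le> s" "s \<le> s'" "s' < t'" "t' \<le> t" "t \<le> b" "t - s \<le> 2 * (t' - s')"
    and X: "integral {s..t} (\<lambda>x. (g x - k)\<^sup>2) \<le> (t - s) * X"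
  shows "\<bar>slope u s' t' - k\<bar> \<le> sqrt (2 * X)"
proof -
  have int: "f integrable_on {x..y}" if "f absolutely_integrable_on {a..b}" "a \<le> x" "y \<le> b" for x y and f :: "real \<Rightarrow> real"
    using set_integrable_subset[OF that(1), of "{x..y}"] that by (intro set_lebesgue_integral_eq_integral(1)) auto
  have q2: "(\<lambda>x. (g x - k)\<^sup>2) integrable_on {x..y}" if "a \<le> x" "y \<le> b" for x y
  proof -
    have "(\<lambda>x. (g x)\<^sup>2 - 2 * k * g x + k\<^sup>2) integrable_on {x..y}"
      using int[OF g that] int[OF g2 that] by (intro integrable_add integrable_diff integrable_on_mult_right) auto
    then show ?thesis by (simp add: power2_diff algebra_simps)
  qed
  let ?h = "t' - s'"
  have h: "0 < ?h" using st by simp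
  have "((\<lambda>x. g x - k) has_integral (u t' - u s') - ?h * k) {s'..t'}"
    using integrable_integral[OF int[OF g, of s' t']] FTC[of s' t'] st has_integral_const_real[of k s' t']
    by (intro has_integral_diff) auto
  moreover have "(u t' - u s') - ?h * k = (slope u s' t' - k) * ?h"
    using slope_mult[of s' t' u] st by (simp add: algebra_simps)
  ultimately have q: "((\<lambda>x. g x - k) has_integral (slope u s' t' - k) * ?h) {s'..t'}" by simp
  have "((slope u s' t' - k) * ?h)\<^sup>2 \<le> ?h * integral {s'..t'} (\<lambda>x. (g x - k)\<^sup>2)"
    using square_integral_le[OF has_integral_integrable[OF q] q2[of s' t']] integral_unique[OF q] st by simp
  also have "\<dots> \<le> ?h * integral {s..t} (\<lambda>x. (g x - k)\<^sup>2)"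
    using st by (intro mult_left_mono integral_subset_le q2) auto
  also have "\<dots> \<le> ?h * (2 * ?h * X)"
  proof -
    have "0 \<le> integral {s..t} (\<lambda>x. (g x - k)\<^sup>2)" using st by (intro integral_nonneg q2) auto
    then have "0 \<le> (t - s) * X" using X by linarith
    then have "0 \<le> X" using st by (simp add: zero_le_mult_iff)
    then have "(t - s) * X \<le> 2 * ?h * X" using st by (intro mult_right_mono) auto
    then show ?thesis using X h by (intro mult_left_mono) auto
  qed
  finally have "(slope u s' t' - k)\<^sup>2 * ?h\<^sup>2 \<le> (2 * X) * ?h\<^sup>2"
    by (simp add: power_mult_distrib power2_eq_square mult_ac)
  then have "(slope u s' t' - k)\<^sup>2 \<le> 2 * X" using h by simp
  then show ?thesis by (rule real_le_rsqrt[of "\<bar>_\<bar>", simplified])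
qed

text \<open>The outer interval is halved repeatedly, always keeping \<open>{s'..t'}\<close> inside,
  until the lengths are within a factor 2. Assumption \<open>small\<close> is inherited: what one
  step adds to the slope is what leaves the sum, so every intermediate slope stays below
  \<open>R\<close>.\<close>

lemma slope_chain:
  fixes \<phi> :: "real \<Rightarrow> real"
  assumes step: "\<And>s t s' t'. a \<le> s \<Longrightarrow> s \<le> s' \<Longrightarrow> s' < t' \<Longrightarrow> t' \<le> t \<Longrightarrow> t \<le> b \<Longrightarrow>
      t - s \<le> 2 * (t' - s') \<Longrightarrow> t - s \<le> h\<^sub>0 \<Longrightarrow> \<bar>slope u s t\<bar> \<le> R \<Longrightarrow>
      \<bar>slope u s' t' - slope u s t\<bar> \<le> \<phi> (t - s)"
    and nonneg: "\<And>h. 0 < h \<Longrightarrow> 0 \<le> \<phi> h"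
    and st: "a \<le> s" "s \<le> s'" "s' < t'" "t' \<le> t" "t \<le> b" "t - s \<le> h\<^sub>0" "t - s \<le> 2 ^ n * (t' - s')"
    and small: "\<bar>slope u s t\<bar> + (\<Sum>j<n. \<phi> ((t - s) / 2 ^ j)) \<le> R"
  shows "\<bar>slope u s' t' - slope u s t\<bar> \<le> (\<Sum>j<n. \<phi> ((t - s) / 2 ^ j))"
  using st small
proof (induction n arbitrary: s t)
  case 0
  then have "s = s'" "t = t'" by auto
  then show ?case by simp
next
  case (Suc n)
  define h where "h = t - s"
  have h: "0 < h" using Suc.prems by (simp add: h_def)
  have sum: "(\<Sum>j<Suc n. \<phi> (h / 2 ^ j)) = \<phi> h + (\<Sum>j<n. \<phi> (h / 2 / 2 ^ j))"
    by (subst sum.lessThan_Suc_shift) (simp add: mult.commute)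
  have pos: "0 \<le> (\<Sum>j<n. \<phi> (h / 2 / 2 ^ j))" using h by (intro sum_nonneg nonneg) auto
  have R: "\<bar>slope u s t\<bar> \<le> R"
    using Suc.prems(8) pos nonneg[OF h] unfolding h_def[symmetric] sum by linarith
  show ?case
  proof (cases "h \<le> 2 * (t' - s')")
    case True
    then have "\<bar>slope u s' t' - slope u s t\<bar> \<le> \<phi> h" unfolding h_def using Suc.prems R by (intro step) (auto simp: h_def)
    then show ?thesis unfolding h_def[symmetric] sum using pos by linarith
  next
    case False
    \<comment> \<open>Placed as far right as possible without passing \<open>s'\<close> or pushing
      \<open>q\<close> beyond \<open>t\<close>. As \<open>t' - s'\<close> is below
      \<open>h / 2\<close>, the half-length interval still contains \<open>{s'..t'}\<close>.\<close>
    define p where "p = min s' (t - h / 2)"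
    define q where "q = p + h / 2"
    have pq: "s \<le> p" "p \<le> s'" "t' \<le> q" "q \<le> t" "q - p = h / 2" "p < q"
      using Suc.prems(1-5) False h by (auto simp: p_def q_def h_def min_def field_simps)
    have 1: "\<bar>slope u p q - slope u s t\<bar> \<le> \<phi> h" unfolding h_def using Suc.prems R pq by (intro step) (auto simp: h_def)
    have "\<bar>slope u s' t' - slope u p q\<bar> \<le> (\<Sum>j<n. \<phi> ((q - p) / 2 ^ j))"
    proof (rule Suc.IH)
      show "\<bar>slope u p q\<bar> + (\<Sum>j<n. \<phi> ((q - p) / 2 ^ j)) \<le> R"
        using 1 Suc.prems(8) unfolding h_def[symmetric] sum pq(5) by linarith
      show "q - p \<le> 2 ^ n * (t' - s')" using Suc.prems(7) pq(5) by (simp add: h_def)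
      show "q - p \<le> h\<^sub>0" using Suc.prems(6) pq(5) h by (simp add: h_def)
    qed (use Suc.prems pq in auto)
    then show ?thesis unfolding h_def[symmetric] sum using 1 unfolding pq(5) by linarith
  qed
qed

text \<open>On \<open>(h/2\<^sup>j, 2h/2\<^sup>j]\<close> the integrand \<open>F \<xi> / \<xi>\<close> is at least \<open>f (h/2\<^sup>j) / (2h/2\<^sup>j)\<close>, so each of these intervals
  contributes at least \<open>f (h/2\<^sup>j) / 2\<close> to the Dini integral.\<close>

lemma dini_dyadic_sum:
  fixes f F :: "real \<Rightarrow> real"
  assumes nonneg: "\<And>x. 0 < x \<Longrightarrow> 0 \<le> f x" and mono: "\<And>x y. 0 < x \<Longrightarrow> x \<le> y \<Longrightarrow> f x \<le> f y"
    and le: "\<And>x. 0 < x \<Longrightarrow> f x \<le> F x"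
    and dini: "((\<lambda>\<epsilon>. \<integral>\<^sup>+\<xi>\<in>{0<..exp 1 * \<epsilon>}. ennreal (F \<xi> / \<xi>) \<partial>lebesgue) \<longlongrightarrow> 0) (at_right 0)"
    and e: "0 < e"
  obtains h\<^sub>1 where "0 < h\<^sub>1" "\<And>h n. 0 < h \<Longrightarrow> h \<le> h\<^sub>1 \<Longrightarrow> (\<Sum>j<n. f (h / 2 ^ j)) \<le> e"
proof -
  have "\<forall>\<^sub>F \<epsilon> in at_right 0. (\<integral>\<^sup>+\<xi>\<in>{0<..exp 1 * \<epsilon>}. ennreal (F \<xi> / \<xi>) \<partial>lebesgue) < ennreal (e / 2)"
    using dini by (rule order_tendstoD) (use e in simp)
  then obtain \<eta> where \<eta>: "0 < \<eta>" "\<And>\<epsilon>. 0 < \<epsilon> \<Longrightarrow> \<epsilon> < \<eta> \<Longrightarrow>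
      (\<integral>\<^sup>+\<xi>\<in>{0<..exp 1 * \<epsilon>}. ennreal (F \<xi> / \<xi>) \<partial>lebesgue) < ennreal (e / 2)"
    unfolding eventually_at_right_field by auto
  show ?thesis
  proof (rule that[of "exp 1 * \<eta> / 4"])
    show "0 < exp 1 * \<eta> / 4" using \<eta> by simp
    \<comment> \<open>The first dyadic interval ends at \<open>2 * h\<close>, so the hypothesis is
      used at \<open>2 * h / exp 1\<close>, which is at most \<open>\<eta> / 2\<close>.\<close>
    fix h n assume h: "0 < h" "h \<le> exp 1 * \<eta> / 4"
    define H where "H j = 2 * h / 2 ^ j" for j :: nat
    have H: "0 < H j" "H (Suc j) < H j" "H (Suc j) = h / 2 ^ j" for j using h by (auto simp: H_def field_simps)
    define c where "c j = f (h / 2 ^ j) / H j" for j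
    have cpos: "0 \<le> c j" for j using nonneg[of "h / 2 ^ j"] h H(1)[of j] by (simp add: c_def)
    \<comment> \<open>The comparison is pointwise with a step function, so that only monotonicity of
      the integral acts on \<open>F\<close>, whose measurability is not known.\<close>
    have bound: "(\<Sum>j<n. ennreal (c j) * indicator {H (Suc j)<..H j} \<xi>) \<le> ennreal (F \<xi> / \<xi>) * indicator {H n<..H 0} \<xi>" for \<xi> n
    proof (induction n)
      case (Suc n)
      have H0: "H n \<le> H 0" using h by (simp add: H_def field_simps)
      consider "H n < \<xi>" | "\<xi> \<le> H (Suc n)" | "H (Suc n) < \<xi>" "\<xi> \<le> H n" by linarith
      then show ?case
      proof cases
        case 1
        then have "indicator {H (Suc n)<..H n} \<xi> = (0::ennreal)" "(indicator {H (Suc n)<..H 0} \<xi> :: ennreal) = indicator {H n<..H 0} \<xi>"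
          using H(2)[of n] by (auto simp: indicator_def)
        then show ?thesis using Suc by simp
      next
        case 2
        then have "indicator {H (Suc n)<..H n} \<xi> = (0::ennreal)" "indicator {H n<..H 0} \<xi> = (0::ennreal)"
          using H(2)[of n] by (auto simp: indicator_def)
        then show ?thesis using Suc by simp
      next
        case 3
        have \<xi>: "0 < \<xi>" using 3 H(1)[of "Suc n"] by linarith
        have "f (h / 2 ^ n) \<le> F \<xi>"
          using mono[of "h / 2 ^ n" \<xi>] le[OF \<xi>] 3(1) h unfolding H(3) by simp
        then have "c n \<le> F \<xi> / \<xi>"
          unfolding c_def using 3 \<xi> nonneg[of "h / 2 ^ n"] h by (intro frac_le) auto
        moreover have "indicator {H n<..H 0} \<xi> = (0::ennreal)" using 3 by (auto simp: indicator_def)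
        moreover have "\<xi> \<in> {H (Suc n)<..H n}" "\<xi> \<in> {H (Suc n)<..H 0}" using 3 H0 by auto
        ultimately show ?thesis using Suc by (simp add: ennreal_leI)
      qed
    qed simp
    have mass: "c j * (H j - H (Suc j)) = f (h / 2 ^ j) / 2" for j
      using h by (simp add: c_def H_def field_simps)
    have "ennreal (\<Sum>j<n. f (h / 2 ^ j) / 2) = (\<Sum>j<n. ennreal (c j * (H j - H (Suc j))))"
      unfolding mass using h by (intro sum_ennreal[symmetric]) (simp add: nonneg)
    also have "\<dots> = (\<Sum>j<n. \<integral>\<^sup>+\<xi>. ennreal (c j) * indicator {H (Suc j)<..H j} \<xi> \<partial>lebesgue)"
      using cpos H(2) by (intro sum.cong) (auto simp: nn_integral_cmult_indicator ennreal_mult less_imp_le)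
    also have "\<dots> = (\<integral>\<^sup>+\<xi>. (\<Sum>j<n. ennreal (c j) * indicator {H (Suc j)<..H j} \<xi>) \<partial>lebesgue)"
      by (intro nn_integral_sum[symmetric] borel_measurable_times_ennreal borel_measurable_const borel_measurable_indicator) auto
    also have "\<dots> \<le> (\<integral>\<^sup>+\<xi>\<in>{0<..exp 1 * (2 * h / exp 1)}. ennreal (F \<xi> / \<xi>) \<partial>lebesgue)"
    proof (rule nn_integral_mono)
      fix \<xi>
      have "indicator {H n<..H 0} \<xi> \<le> (indicator {0<..exp 1 * (2 * h / exp 1)} \<xi> :: ennreal)"
        using H(1)[of n] by (auto simp: indicator_def H_def)
      then show "(\<Sum>j<n. ennreal (c j) * indicator {H (Suc j)<..H j} \<xi>) \<le> ennreal (F \<xi> / \<xi>) * indicator {0<..exp 1 * (2 * h / exp 1)} \<xi>"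
        by (intro order_trans[OF bound mult_left_mono]) auto
    qed
    also have "\<dots> < ennreal (e / 2)" using h \<eta>(1) by (intro \<eta>(2)) (auto simp: field_simps)
    finally have "(\<Sum>j<n. f (h / 2 ^ j) / 2) < e / 2" using e by (simp add: ennreal_less_iff sum_nonneg nonneg h(1))
    then show "(\<Sum>j<n. f (h / 2 ^ j)) \<le> e" by (simp flip: sum_divide_distrib)
  qed
qed

lemma powr_dyadic_sum:
  assumes "0 < (\<gamma>::real)" "0 < e"
  obtains h\<^sub>1 where "0 < h\<^sub>1" "\<And>h n. 0 < h \<Longrightarrow> h \<le> h\<^sub>1 \<Longrightarrow> (\<Sum>j<n. (h / 2 ^ j) powr \<gamma>) \<le> e"
proof -
  define r where "r = 2 powr - \<gamma>"
  have r: "0 < r" "r < 1" using assms powr_less_mono[of "- \<gamma>" 0 2] by (auto simp: r_def)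
  \<comment> \<open>A geometric series of ratio \<open>r\<close>: its sum is at most
    \<open>h powr \<gamma> / (1 - r)\<close>, and this bound on \<open>h\<close> makes that at most
    \<open>e\<close>.\<close>
  show ?thesis
  proof (rule that[of "(e * (1 - r)) powr (1 / \<gamma>)"])
    show "0 < (e * (1 - r)) powr (1 / \<gamma>)" using r assms by simp
    fix h n assume h: "0 < h" "h \<le> (e * (1 - r)) powr (1 / \<gamma>)"
    have "(h / 2 ^ j) powr \<gamma> = h powr \<gamma> * r ^ j" for j
    proof -
      have "(2 ^ j) powr \<gamma> = (2 powr \<gamma>) ^ j" for j :: nat
        by (simp add: powr_powr flip: powr_realpow) (simp add: mult.commute)
      then have "h powr \<gamma> / (2 ^ j) powr \<gamma> = h powr \<gamma> * r ^ j"
        by (simp add: r_def powr_minus power_inverse divide_inverse)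
      then show ?thesis using h by (subst powr_divide) auto
    qed
    then have "(\<Sum>j<n. (h / 2 ^ j) powr \<gamma>) = h powr \<gamma> * (\<Sum>j<n. r ^ j)" by (simp add: sum_distrib_left)
    also have "\<dots> \<le> (e * (1 - r)) * (1 / (1 - r))"
    proof (rule mult_mono)
      have "h powr \<gamma> \<le> ((e * (1 - r)) powr (1 / \<gamma>)) powr \<gamma>" using h assms by (intro powr_mono2) auto
      also have "\<dots> = e * (1 - r)" using assms r by (simp add: powr_powr)
      finally show "h powr \<gamma> \<le> e * (1 - r)" .
      show "(\<Sum>j<n. r ^ j) \<le> 1 / (1 - r)"
        using r by (simp add: sum_gp_strict divide_right_mono)
    qed (use r assms in \<open>auto intro: sum_nonneg\<close>)
    also have "\<dots> = e" using r by simp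
    finally show "(\<Sum>j<n. (h / 2 ^ j) powr \<gamma>) \<le> e" .
  qed
qed

text \<open>Inside \<open>omega_hat\<close> the monotone \<omega> is taken at a larger argument, and
  \<open>omega_hat\<close> is one of three nonnegative summands of \<open>omega_bar\<close>.\<close>

lemma sqrt_omega_le_omega_bar:
  assumes mono: "mono_on {0..} (\<omega> k)" and nonneg: "\<And>\<epsilon>. 0 \<le> \<epsilon> \<Longrightarrow> 0 \<le> \<omega> k \<epsilon>" and "0 \<le> N" "0 < x"
  shows "sqrt (\<omega> k x) \<le> omega_bar \<omega> N \<alpha>k k x"
proof -
  have "\<omega> k x \<le> \<omega> k (x + N * sqrt x)" using assms by (intro mono_onD[OF mono]) auto
  then have "sqrt (\<omega> k x) \<le> omega_hat \<omega> N k x" by (simp add: omega_hat_def)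
  also have "0 \<le> omega_hat \<omega> N k x" using assms by (simp add: omega_hat_def)
  then have "omega_hat \<omega> N k x \<le> omega_bar \<omega> N \<alpha>k k x" by (simp add: omega_bar_def)
  finally show ?thesis .
qed

theorem theorem2p5:
  fixes a b \<mu> c N \<delta>\<^sub>0 :: real
    and L :: "real \<Rightarrow> real \<Rightarrow> real \<Rightarrow> real"
    and K :: "(real \<times> real) set"
    and \<omega> :: "real \<Rightarrow> real \<Rightarrow> real"
    and C \<alpha> :: "(real \<times> real \<times> real) set \<Rightarrow> real"
    and M :: "real \<Rightarrow> real"
    and u :: "real \<Rightarrow> real"
  assumes ab: "a < b"
    and L_cont: "continuous_on ({a..b} \<times> UNIV \<times> UNIV) (\<lambda>(x, w, v). L x w v)"
    and K_compact: "compact K"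
    and K_sub: "K \<subseteq> {a..b} \<times> UNIV"
    and omega_nonneg: "\<And>k \<epsilon>. 0 \<le> k \<Longrightarrow> 0 \<le> \<epsilon> \<Longrightarrow> 0 \<le> \<omega> k \<epsilon>"
    and omega_mono1: "\<And>\<epsilon>. 0 \<le> \<epsilon> \<Longrightarrow> mono_on {0..} (\<lambda>k. \<omega> k \<epsilon>)"
    and omega_mono2: "\<And>k. 0 \<le> k \<Longrightarrow> mono_on {0..} (\<omega> k)"
    and omega_zero: "\<And>k. 0 \<le> k \<Longrightarrow> \<omega> k 0 = 0"
    and holder:
      "\<And>G. compact G \<Longrightarrow> G \<subseteq> {a..b} \<times> UNIV \<times> UNIV \<Longrightarrow>
         0 < C G \<and> 0 < \<alpha> G \<and>
         (\<forall>(x\<^sub>1, u\<^sub>1, v\<^sub>1)\<in>G. \<forall>(x\<^sub>2, u\<^sub>2, v\<^sub>2)\<in>G.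
            \<bar>L x\<^sub>1 u\<^sub>1 v\<^sub>1 - L x\<^sub>2 u\<^sub>2 v\<^sub>2\<bar>
              \<le> C G * (\<bar>x\<^sub>1 - x\<^sub>2\<bar> + \<bar>u\<^sub>1 - u\<^sub>2\<bar> + \<bar>v\<^sub>1 - v\<^sub>2\<bar>) powr \<alpha> G)"
    and Lv_exists: "\<And>x w v. x \<in> {a..b} \<Longrightarrow> L x w differentiable (at v)"
    and Lvv_exists: "\<And>x w v. x \<in> {a..b} \<Longrightarrow> Dv L x w differentiable (at v)"
    and Lvv_cont: "continuous_on ({a..b} \<times> UNIV \<times> UNIV) (\<lambda>(x, w, v). Dv (Dv L) x w v)"
    and mu_pos: "0 < \<mu>"
    and Lvv_ge: "\<And>x w v. x \<in> {a..b} \<Longrightarrow> \<mu> \<le> Dv (Dv L) x w v"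
    and c_pos: "0 < c"
    and N_pos: "0 < N"
    and N_bound:
      "\<And>w. w \<in> W11 a b \<Longrightarrow> graph_in a b K w \<Longrightarrow> J L a b w \<le> ereal c \<Longrightarrow>
         L2_bounded a b (weak_deriv a b w) N"
    and delta_pos: "0 < \<delta>\<^sub>0"
    and delta_le: "\<delta>\<^sub>0 + N * sqrt \<delta>\<^sub>0 \<le> 1"
    and M_pos: "\<And>k. 0 \<le> k \<Longrightarrow> 0 < M k"
    and M_bound:
      "\<And>k \<zeta>. 0 \<le> k \<Longrightarrow> M k \<le> \<bar>\<zeta>\<bar> \<Longrightarrow>
         \<omega> k (\<delta>\<^sub>0 + N * sqrt \<delta>\<^sub>0)
           \<le> \<mu> / 4 * \<zeta>\<^sup>2 - 2 * bound_const L (K0 a b K \<delta>\<^sub>0 N) k * (\<bar>\<zeta>\<bar> + 1)"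
    and dini:
      "\<And>k. 0 \<le> k \<Longrightarrow>
         ((\<lambda>\<epsilon>. \<integral>\<^sup>+\<xi>\<in>{0<..exp 1 * \<epsilon>}.
              ennreal (omega_bar \<omega> N (\<alpha> (slab (K0 a b K \<delta>\<^sub>0 N) (k + M k))) k \<xi> / \<xi>) \<partial>lebesgue)
            \<longlongrightarrow> 0) (at_right 0)"
    and u: "u \<in> almost_minimizers \<omega> a b L K c \<delta>\<^sub>0"
  shows "tonelli_partial_regularity a b u"
proof -
  interpret regular_lagrangian a b \<mu> L C \<alpha>
    by unfold_locales (fact ab L_cont holder Lv_exists Lvv_exists Lvv_cont mu_pos Lvv_ge)+
  have uW: "u \<in> W11 a b" and uK: "graph_in a b K u" and uJ: "J L a b u \<le> ereal c"
    and u_min: "\<And>s t. s \<in> {a..b} \<Longrightarrow> t \<in> {a..b} \<Longrightarrow> s < t \<Longrightarrow> \<bar>s - t\<bar> \<le> \<delta>\<^sub>0 \<Longrightarrow>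
      J L a b u \<le> J L a b (chord u s t) + ereal (\<omega> \<bar>slope u s t\<bar> \<bar>s - t\<bar> * \<bar>s - t\<bar>)"
    using u by (auto simp: almost_minimizers_def)
  have u_cont: "continuous_on {a..b} u" using uW by (auto simp: W11_def intro: abs_cont_on_imp_continuous_on)
  define g where "g = weak_deriv a b u"
  have g: "has_weak_deriv a b u g"
    using uW has_weak_deriv_weak_deriv by (auto simp: W11_def g_def)
  have gi: "g absolutely_integrable_on {a..b}" using g by (simp add: has_weak_deriv_def)
  note FTC = weak_deriv_FTC[OF ab u_cont g]
  have g2: "(\<lambda>x. (g x)\<^sup>2) absolutely_integrable_on {a..b}" and gN: "integral {a..b} (\<lambda>x. (g x)\<^sup>2) \<le> N\<^sup>2"
  proof -
    have L2: "L2_bounded a b g N" unfolding g_def using uW uK uJ by (rule N_bound)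
    then show *: "(\<lambda>x. (g x)\<^sup>2) absolutely_integrable_on {a..b}" by (simp add: L2_bounded_def)
    have "sqrt (integral {a..b} (\<lambda>x. (g x)\<^sup>2)) \<le> N"
      using L2 set_lebesgue_integral_eq_integral(2)[OF *] by (simp add: L2_bounded_def)
    then show "integral {a..b} (\<lambda>x. (g x)\<^sup>2) \<le> N\<^sup>2" by (rule sqrt_le_D)
  qed
  have "bounded (u ` {a..b})" using u_cont by (intro compact_imp_bounded compact_continuous_image) auto
  then obtain U where U: "\<forall>x\<in>{a..b}. \<bar>u x\<bar> \<le> U" unfolding bounded_pos by auto
  \<comment> \<open>The graph of \<open>u\<close> is bounded, so L is bounded below along it
    uniformly in \<open>v\<close>; together with the bound on \<open>J\<close> this makes the
    integrand integrable.\<close>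
  obtain B where B: "\<And>x w v. x \<in> {a..b} \<Longrightarrow> \<bar>w\<bar> \<le> U \<Longrightarrow> - B \<le> L x w v"
    using lagrangian_bounded_below[of U] by metis
  have F: "(\<lambda>x. L x (u x) (g x)) absolutely_integrable_on {a..b}"
    unfolding g_def
  proof (rule J_finite_imp_integrable[where L = L, OF _ _ uJ])
    show "(\<lambda>x. indicator {a..b} x * L x (u x) (weak_deriv a b u x)) \<in> borel_measurable lebesgue"
      using lagrangian_measurable[OF ab L_cont u_cont gi] by (simp add: g_def)
    show "- B \<le> L x (u x) v" if "x \<in> {a..b}" for x v using that U by (intro B) auto
  qed
  have min: "integral {s..t} (\<lambda>x. L x (u x) (g x)) \<le>
       integral {s..t} (\<lambda>x. L x (u s + slope u s t * (x - s)) (slope u s t)) + \<omega> \<bar>slope u s t\<bar> (t - s) * (t - s)"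
    if st: "a \<le> s" "s < t" "t \<le> b" "t - s \<le> \<delta>\<^sub>0" for s t
    using chord_minimality[OF ab L_cont u_cont g F[unfolded g_def] st(1-3) u_min[of s t]] st
    by (simp add: g_def)
  have \<omega>_mono: "\<omega> k h \<le> \<omega> k' h" if "0 \<le> k" "k \<le> k'" "0 \<le> h" for k k' h
    using mono_onD[OF omega_mono1[OF that(3)], of k k'] that by simp
  interpret slope_control a b u
  proof
    show "a < b" "continuous_on {a..b} u" by fact+
    fix R \<epsilon> :: real assume R: "0 \<le> R" and \<epsilon>: "0 < \<epsilon>"
    \<comment> \<open>Everything is set up at level \<open>R + 1\<close>: slopes start below
      \<open>R\<close> and may drift by at most 1 along the chain.\<close>
    then have R1: "0 \<le> R + 1" by simp
    obtain A h\<^sub>0 \<beta> :: real where A: "0 < A" "0 < h\<^sub>0" "0 < \<beta>"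
      and decay: "\<And>s t. a \<le> s \<Longrightarrow> s < t \<Longrightarrow> t \<le> b \<Longrightarrow> t - s \<le> h\<^sub>0 \<Longrightarrow> \<bar>slope u s t\<bar> \<le> R + 1 \<Longrightarrow>
        integral {s..t} (\<lambda>x. (g x - slope u s t)\<^sup>2) \<le> (t - s) * (A * (\<omega> (R + 1) (t - s) + (t - s) powr \<beta>))"
    proof (rule energy_decay[OF u_cont gi g2 FTC F _ gN \<omega>_mono omega_nonneg delta_pos min R1])
      show "0 \<le> N" using N_pos by simp
    qed ((rule that; assumption) | assumption)+
    define A' where "A' = sqrt (2 * A)"
    have A': "0 < A'" using A by (simp add: A'_def)
    define \<phi> where "\<phi> h = A' * (sqrt (\<omega> (R + 1) h) + h powr (\<beta> / 2))" for h
    have \<phi>_nonneg: "0 \<le> \<phi> h" if "0 < h" for h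
      using that A' omega_nonneg[OF R1, of h] by (simp add: \<phi>_def)
    have step: "\<bar>slope u s' t' - slope u s t\<bar> \<le> \<phi> (t - s)"
      if st: "a \<le> s" "s \<le> s'" "s' < t'" "t' \<le> t" "t \<le> b" "t - s \<le> 2 * (t' - s')" "t - s \<le> h\<^sub>0" "\<bar>slope u s t\<bar> \<le> R + 1"
      for s t s' t'
    proof -
      let ?h = "t - s"
      have h: "0 < ?h" using st by simp
      have "\<bar>slope u s' t' - slope u s t\<bar> \<le> sqrt (2 * (A * (\<omega> (R + 1) ?h + ?h powr \<beta>)))"
        using slope_oscillation[OF gi g2 FTC st(1-6) decay] st by simp
      also have "\<dots> = A' * sqrt (\<omega> (R + 1) ?h + ?h powr \<beta>)" by (simp add: A'_def mult.assoc flip: real_sqrt_mult)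
      also have "\<dots> \<le> A' * (sqrt (\<omega> (R + 1) ?h) + sqrt (?h powr \<beta>))"
        using A' omega_nonneg[OF R1, of ?h] h by (intro mult_left_mono sqrt_add_le_add_sqrt) auto
      also have "sqrt (?h powr \<beta>) = ?h powr (\<beta> / 2)" using h by (simp add: powr_half_sqrt[symmetric] powr_powr)
      finally show ?thesis by (simp add: \<phi>_def)
    qed
    \<comment> \<open>Two sums, each at most \<open>e\<close>, multiplied by \<open>A'\<close>, give
      a drift of at most \<open>min \<epsilon> 1\<close>: \<epsilon> is the required precision, 1
      the room up to \<open>R + 1\<close>.\<close>
    define e where "e = min \<epsilon> 1 / (2 * A')"
    have e: "0 < e" using \<epsilon> A' by (simp add: e_def)
    obtain h\<^sub>1 where h\<^sub>1: "0 < h\<^sub>1" "\<And>h n. 0 < h \<Longrightarrow> h \<le> h\<^sub>1 \<Longrightarrow> (\<Sum>j<n. sqrt (\<omega> (R + 1) (h / 2 ^ j))) \<le> e"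
    proof (rule dini_dyadic_sum[OF _ _ _ dini[OF R1] e])
      show "0 \<le> sqrt (\<omega> (R + 1) x)" if "0 < x" for x using omega_nonneg[OF R1, of x] that by simp
      show "sqrt (\<omega> (R + 1) x) \<le> sqrt (\<omega> (R + 1) y)" if "0 < x" "x \<le> y" for x y
        using mono_onD[OF omega_mono2[OF R1], of x y] that by simp
      show "sqrt (\<omega> (R + 1) x) \<le> omega_bar \<omega> N (\<alpha> (slab (K0 a b K \<delta>\<^sub>0 N) (R + 1 + M (R + 1)))) (R + 1) x" if "0 < x" for x
        using omega_mono2[OF R1] omega_nonneg[OF R1] N_pos that by (intro sqrt_omega_le_omega_bar) auto
    qed (rule that; assumption)
    obtain h\<^sub>2 where h\<^sub>2: "0 < h\<^sub>2" "\<And>h n. 0 < h \<Longrightarrow> h \<le> h\<^sub>2 \<Longrightarrow> (\<Sum>j<n. (h / 2 ^ j) powr (\<beta> / 2)) \<le> e"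
      using powr_dyadic_sum[of "\<beta> / 2" e] A(3) e by (metis half_gt_zero)
    have sum_small: "(\<Sum>j<n. \<phi> (h / 2 ^ j)) \<le> min \<epsilon> 1" if h: "0 < h" "h \<le> h\<^sub>1" "h \<le> h\<^sub>2" for h n
    proof -
      have "(\<Sum>j<n. \<phi> (h / 2 ^ j)) = A' * ((\<Sum>j<n. sqrt (\<omega> (R + 1) (h / 2 ^ j))) + (\<Sum>j<n. (h / 2 ^ j) powr (\<beta> / 2)))"
        by (simp only: \<phi>_def sum.distrib flip: sum_distrib_left)
      also have "\<dots> \<le> A' * (e + e)" using h A' by (intro mult_left_mono add_mono h\<^sub>1 h\<^sub>2) auto
      also have "\<dots> = min \<epsilon> 1" using A' by (simp add: e_def)
      finally show ?thesis .
    qed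
    define h where "h = min h\<^sub>0 (min h\<^sub>1 h\<^sub>2)"
    have "\<bar>slope u s' t' - slope u s t\<bar> \<le> \<epsilon>"
      if st: "a \<le> s" "s \<le> s'" "s' < t'" "t' \<le> t" "t \<le> b" "t - s \<le> h" "\<bar>slope u s t\<bar> \<le> R" for s t s' t'
    proof -
      \<comment> \<open>The number of halvings depends on the inner interval, but the bound on the
        sum does not depend on \<open>n\<close>.\<close>
      obtain n where "(t - s) / (t' - s') < 2 ^ n" using real_arch_pow[of 2] by auto
      then have n: "t - s \<le> 2 ^ n * (t' - s')" using st by (simp add: field_simps)
      have small: "(\<Sum>j<n. \<phi> ((t - s) / 2 ^ j)) \<le> min \<epsilon> 1" using st by (intro sum_small) (auto simp: h_def)
      have "\<bar>slope u s' t' - slope u s t\<bar> \<le> (\<Sum>j<n. \<phi> ((t - s) / 2 ^ j))"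
        by (rule slope_chain[where R = "R + 1" and h\<^sub>0 = h\<^sub>0, OF step \<phi>_nonneg st(1-5) _ n])
          (use st small in \<open>auto simp: h_def\<close>)
      then show ?thesis using small by simp
    qed
    moreover have "0 < h" using A h\<^sub>1 h\<^sub>2 by (simp add: h_def)
    ultimately show "\<exists>h>0. \<forall>s t s' t'. a \<le> s \<longrightarrow> s \<le> s' \<longrightarrow> s' < t' \<longrightarrow> t' \<le> t \<longrightarrow> t \<le> b \<longrightarrow> t - s \<le> h \<longrightarrow>
         \<bar>slope u s t\<bar> \<le> R \<longrightarrow> \<bar>slope u s' t' - slope u s t\<bar> \<le> \<epsilon>"
      by blast
  qed
  show ?thesis by (rule tonelli)
qed

end
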